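(* Let $h\ge0$ and $q>0$ be integers and let $G$ be a strongly stable, $(h,q)$-eventually time-periodic ($(h,q)$-ETP) distributed system over a finite directed graph $\mathcal{G}(V,E)$. (i) $G$ has an $(h,q)$-ETP balanced realization with $(h,q)$-ETP balanced generalized gramians $\Sigma_{\mathrm{eper}}^{(k)}(t)$, $\Sigma_{\mathrm{eper}}^{(ij)}(t)$, $(t,k)\in\mathbb{N}_0\times V$, $(i,j)\in E$. (ii) Consider such a balanced realization and gramians, partitioned as $\Sigma_{\mathrm{eper}}^{(k)}(t)=\mathrm{diag}(\Gamma_{\mathrm{eper}}^{(k)}(t),\Omega_{\mathrm{eper}}^{(k)}(t))$ and $\Sigma_{\mathrm{eper}}^{(ij)}(t)=\mathrm{diag}(\Gamma_{\mathrm{eper}}^{(ij)}(t),\Omega_{\mathrm{eper}}^{(ij)}(t))$ with $(h,q)$-ETP truncation orders $r^{(k)}(t)$, $r^{(ij)}(t)$. Then the system $G_r$ resulting from balanced truncation has an $(h,q)$-ETP balanced realization and satisfies $$\|G-G_r\|<2\,\zeta(\Omega_{\mathrm{eper}}),$$ where $\Omega_{\mathrm{eper}}$ is the finite block-diagonal matrix whose diagonal blocks are all the $\Omega_{\mathrm{eper}}^{(k)}(t)$, $k\in V$, and $\Omega_{\mathrm{eper}}^{(ij)}(t)$, $(i,j)\in E$, for $t\in\{0,1,\dots,h+q-1\}$ (blocks of dimension zero omitted), and $\zeta(X)$ denotes the sum of the distinct diagonal entries of a square matrix $X$.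
   Context: **Systems.** $\mathcal{G}(V,E)$ is a finite directed graph with $V=\{1,\dots,N\}$. For $k\in V$, $E_{\mathrm{in}}^{(k)}=\{i\in V\mid (i,k)\in E\}$ and $E_{\mathrm{out}}^{(k)}=\{j\in V\mid (k,j)\in E\}$, both ordered increasingly. A distributed system $G$ has, for each $k\in V$ and $t\in\mathbb{N}_0$, a temporal state $x^{(k)}(t)\in\mathbb{R}^{n^{(k)}(t)}$, input $u^{(k)}(t)\in\mathbb{R}^{n_u^{(k)}(t)}$, output $y^{(k)}(t)\in\mathbb{R}^{n_y^{(k)}(t)}$, and for each edge $(i,j)\in E$ a spatial state $x^{(ij)}(t)\in\mathbb{R}^{n^{(ij)}(t)}$ (all dimensions may vary with time and may be zero). Let $x_{\mathrm{in}}^{(k)}(t)$ be the vertical concatenation of $x^{(ik)}(t)$, $i\in E_{\mathrm{in}}^{(k)}$, and $x_{\mathrm{out}}^{(k)}(t)$ the vertical concatenation of $x^{(kj)}(t)$, $j\in E_{\mathrm{out}}^{(k)}$. The dynamics are, with $x^{(k)}(0)=0$, $x_{\mathrm{in}}^{(k)}(0)=0$, for all $(t,k)\in\mathbb{N}_0\times V$, $$\begin{bmatrix} x^{(k)}(t+1) \\ x_{\mathrm{out}}^{(k)}(t+1)\end{bmatrix}=A^{(k)}(t)\begin{bmatrix} x^{(k)}(t) \\ x_{\mathrm{in}}^{(k)}(t)\end{bmatrix}+B^{(k)}(t)u^{(k)}(t),\qquad y^{(k)}(t)=C^{(k)}(t)\begin{bmatrix} x^{(k)}(t) \\ x_{\mathrm{in}}^{(k)}(t)\end{bmatrix}+D^{(k)}(t)u^{(k)}(t),$$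 where the matrices are uniformly bounded in $t$. The quadruple $(A^{(k)}(t),B^{(k)}(t),C^{(k)}(t),D^{(k)}(t))$ is the realization of $G$. For a family $Z^{(ij)}(t)$ of matrices indexed by edges, $Z_{\mathrm{in}}^{(k)}(t)=\mathrm{diag}(Z^{(ik)}(t))_{i\in E_{\mathrm{in}}^{(k)}}$ and $Z_{\mathrm{out}}^{(k)}(t)=\mathrm{diag}(Z^{(kj)}(t))_{j\in E_{\mathrm{out}}^{(k)}}$ (block-diagonal). **Strong stability.** $G$ is strongly stable if there exist $\beta>0$ and uniformly bounded positive definite $W^{(k)}(t)\succ\beta I$ (size $n^{(k)}(t)$), $W^{(ij)}(t)\succ\beta I$ (size $n^{(ij)}(t)$) such that for all $(t,k)\in\mathbb{N}_0\times V$ $$A^{(k)}(t)^T\mathrm{diag}(W^{(k)}(t+1),W_{\mathrm{out}}^{(k)}(t+1))A^{(k)}(t)-\mathrm{diag}(W^{(k)}(t),W_{\mathrm{in}}^{(k)}(t))\prec-\beta I.$$ **Eventual periodicity.** A sequence $M(t)$, $t\in\mathbb{N}_0$, is $(h,q)$-ETP if $M(t+h+zq)=M(t+h)$ for all $t,z\in\mathbb{N}_0$. A realization is $(h,q)$-ETP if all its matrix sequences $A^{(k)},B^{(k)},C^{(k)},D^{(k)}$, $k\in V$, are; a system given by such a realization is called $(h,q)$-ETP. **Balanced realization.** A realization is balanced if there exist $\beta>0$ and uniformly bounded diagonal positive definite matrices $\Sigma^{(k)}(t)\succ\beta I$ (size $n^{(k)}(t)$), $\Sigma^{(ij)}(t)\succ\beta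 I$ (size $n^{(ij)}(t)$), called balanced generalized gramians, such that for all $(t,k)\in\mathbb{N}_0\times V$ $$A^{(k)}(t)\,\mathrm{diag}(\Sigma^{(k)}(t),\Sigma_{\mathrm{in}}^{(k)}(t))A^{(k)}(t)^T-\mathrm{diag}(\Sigma^{(k)}(t+1),\Sigma_{\mathrm{out}}^{(k)}(t+1))+B^{(k)}(t)B^{(k)}(t)^T\prec-\beta I,$$ $$A^{(k)}(t)^T\mathrm{diag}(\Sigma^{(k)}(t+1),\Sigma_{\mathrm{out}}^{(k)}(t+1))A^{(k)}(t)-\mathrm{diag}(\Sigma^{(k)}(t),\Sigma_{\mathrm{in}}^{(k)}(t))+C^{(k)}(t)^TC^{(k)}(t)\prec-\beta I.$$ A balanced realization of a given system $G$ is a balanced realization (with uniformly bounded matrices) obtained from the given realization by a state transformation: for invertible matrices $T^{(k)}(t)$, $T^{(ij)}(t)$, with $T_{\mathrm{pre}}^{(k)}(t)=\mathrm{diag}(T^{(k)}(t),T_{\mathrm{out}}^{(k)}(t))$ and $T_{\mathrm{post}}^{(k)}(t)=\mathrm{diag}(T^{(k)}(t)^{-1},T_{\mathrm{in}}^{(k)}(t)^{-1})$, the new realization is $(T_{\mathrm{pre}}^{(k)}(t+1)A^{(k)}(t)T_{\mathrm{post}}^{(k)}(t),\,T_{\mathrm{pre}}^{(k)}(t+1)B^{(k)}(t),\,C^{(k)}(t)T_{\mathrm{post}}^{(k)}(t),\,D^{(k)}(t))$. The diagonal entries of each gramian are assumed, without loss of generality, ordered in a decreasing fashion. **Balanced truncation.**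 Given a balanced realization and integers $0\le r^{(k)}(t)\le n^{(k)}(t)$ and $0\le r^{(ij)}(t)\le n^{(ij)}(t)$ (the truncation orders), write $\Sigma^{(k)}(t)=\mathrm{diag}(\Gamma^{(k)}(t),\Omega^{(k)}(t))$ and $\Sigma^{(ij)}(t)=\mathrm{diag}(\Gamma^{(ij)}(t),\Omega^{(ij)}(t))$ with $\Gamma^{(k)}(t)$ of size $r^{(k)}(t)$ and $\Gamma^{(ij)}(t)$ of size $r^{(ij)}(t)$ (blocks may have size zero). The reduced order system $G_r$, over the same graph, has temporal states of dimension $r^{(k)}(t)$, spatial states of dimension $r^{(ij)}(t)$, and realization $(A_r^{(k)}(t),B_r^{(k)}(t),C_r^{(k)}(t),D^{(k)}(t))$ obtained from the balanced realization of $G$ by keeping, at each time, only the rows and columns corresponding to the first $r^{(k)}(t)$ components of each $x^{(k)}(t)$ and the first $r^{(ij)}(t)$ components of each $x^{(ij)}(t)$ (rows of $A^{(k)}(t)$, $B^{(k)}(t)$ according to the states at time $t+1$; columns of $A^{(k)}(t)$, $C^{(k)}(t)$ according to the states at time $t$). **Norm.** $\ell_2$ is the space of $w=(w^{(k)}(t))$ with $\|w\|_2=(\sum_{(t,k)}w^{(k)}(t)^Tw^{(k)}(t))^{1/2}<\infty$. For a system mapping $u\in\ell_2$ to $y\in\ell_2$ (from zero initial conditions), $\|G\|=\sup_{0\ne u\in\ell_2}\|y\|_2/\|u\|_2$. $G-G_r$ denotes the error system mapping $u$ to the difference of the outputs of $G$ and $G_r$.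
   Formalization: An (h,q)-ETP realization is taken to have (h,q)-ETP temporal and spatial state dimensions too (otherwise (i) can fail), and the strict norm bound is asserted only when at least one state is truncated (for empty Ω it would read 0 < 0). *)

theory Defs
  imports
    "HOL-Library.Extended_Nonnegative_Real"
    "Jordan_Normal_Form.Matrix"
    "Jordan_Normal_Form.DL_Submatrix"
begin

text \<open>
  Temporal quantities are indexed by a node \<open>k\<close> and a time \<open>t\<close>, spatial quantities by an edge
  \<open>(i, j)\<close> and a time \<open>t\<close>. Only the values at \<open>k \<in> {1..nnodes G}\<close> and \<open>(i, j) \<in> edges G\<close> are
  meaningful. Matrices and vectors may have dimension zero.
\<close>

record dsys =
  nnodes :: nat
  edges :: "(nat \<times> nat) set"
  tdim :: "nat \<Rightarrow> nat \<Rightarrow> nat"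
  sdim :: "nat \<times> nat \<Rightarrow> nat \<Rightarrow> nat"
  udim :: "nat \<Rightarrow> nat \<Rightarrow> nat"
  ydim :: "nat \<Rightarrow> nat \<Rightarrow> nat"
  Amat :: "nat \<Rightarrow> nat \<Rightarrow> real mat"
  Bmat :: "nat \<Rightarrow> nat \<Rightarrow> real mat"
  Cmat :: "nat \<Rightarrow> nat \<Rightarrow> real mat"
  Dmat :: "nat \<Rightarrow> nat \<Rightarrow> real mat"

abbreviation nodes :: "dsys \<Rightarrow> nat set" where
  "nodes G \<equiv> {1..nnodes G}"

definition E_in :: "dsys \<Rightarrow> nat \<Rightarrow> nat list" where
  "E_in G k = sorted_list_of_set {i \<in> nodes G. (i, k) \<in> edges G}"

definition E_out :: "dsys \<Rightarrow> nat \<Rightarrow> nat list" where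
  "E_out G k = sorted_list_of_set {j \<in> nodes G. (k, j) \<in> edges G}"

text \<open>
  For a temporal family \<open>X\<close> and a spatial family \<open>Y\<close>, the items attached to node \<open>k\<close> in the order in
  which they are stacked: the temporal one first, then those of the incoming (outgoing) edges.
\<close>

definition ins :: "dsys \<Rightarrow> (nat \<Rightarrow> nat \<Rightarrow> 'a) \<Rightarrow> (nat \<times> nat \<Rightarrow> nat \<Rightarrow> 'a) \<Rightarrow> nat \<Rightarrow> nat \<Rightarrow> 'a list" where
  "ins G X Y k t = X k t # map (\<lambda>i. Y (i, k) t) (E_in G k)"

definition outs :: "dsys \<Rightarrow> (nat \<Rightarrow> nat \<Rightarrow> 'a) \<Rightarrow> (nat \<times> nat \<Rightarrow> nat \<Rightarrow> 'a) \<Rightarrow> nat \<Rightarrow> nat \<Rightarrow> 'a list" where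
  "outs G X Y k t = X k t # map (\<lambda>j. Y (k, j) t) (E_out G k)"

definition in_dim :: "dsys \<Rightarrow> nat \<Rightarrow> nat \<Rightarrow> nat" where
  "in_dim G k t = sum_list (ins G (tdim G) (sdim G) k t)"

definition out_dim :: "dsys \<Rightarrow> nat \<Rightarrow> nat \<Rightarrow> nat" where
  "out_dim G k t = sum_list (outs G (tdim G) (sdim G) k t)"

definition in_diag :: "dsys \<Rightarrow> (nat \<Rightarrow> nat \<Rightarrow> real mat) \<Rightarrow> (nat \<times> nat \<Rightarrow> nat \<Rightarrow> real mat) \<Rightarrow>
    nat \<Rightarrow> nat \<Rightarrow> real mat" where
  "in_diag G X Y k t = diag_block_mat (ins G X Y k t)"

definition out_diag :: "dsys \<Rightarrow> (nat \<Rightarrow> nat \<Rightarrow> real mat) \<Rightarrow> (nat \<times> nat \<Rightarrow> nat \<Rightarrow> real mat) \<Rightarrow>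
    nat \<Rightarrow> nat \<Rightarrow> real mat" where
  "out_diag G X Y k t = diag_block_mat (outs G X Y k t)"

text \<open>
  Uniform boundedness refers to the operator norm induced by the Euclidean norms; an entrywise bound
  would not suffice because the dimensions may grow with time.
\<close>

definition op_bounded :: "real \<Rightarrow> real mat \<Rightarrow> bool" where
  "op_bounded c M \<longleftrightarrow> (\<forall>v \<in> carrier_vec (dim_col M).
     sqrt ((M *\<^sub>v v) \<bullet> (M *\<^sub>v v)) \<le> c * sqrt (v \<bullet> v))"

definition unif_bounded :: "'i set \<Rightarrow> ('i \<Rightarrow> nat \<Rightarrow> real mat) \<Rightarrow> bool" where
  "unif_bounded I M \<longleftrightarrow> (\<exists>c. \<forall>i\<in>I. \<forall>t. op_bounded c (M i t))"

definition distributed_system :: "dsys \<Rightarrow> bool" where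
  "distributed_system G \<longleftrightarrow>
     edges G \<subseteq> nodes G \<times> nodes G \<and>
     (\<forall>k\<in>nodes G. \<forall>t.
        Amat G k t \<in> carrier_mat (out_dim G k (t + 1)) (in_dim G k t) \<and>
        Bmat G k t \<in> carrier_mat (out_dim G k (t + 1)) (udim G k t) \<and>
        Cmat G k t \<in> carrier_mat (ydim G k t) (in_dim G k t) \<and>
        Dmat G k t \<in> carrier_mat (ydim G k t) (udim G k t)) \<and>
     unif_bounded (nodes G) (Amat G) \<and> unif_bounded (nodes G) (Bmat G) \<and>
     unif_bounded (nodes G) (Cmat G) \<and> unif_bounded (nodes G) (Dmat G)"

subsection \<open>Input-output behaviour and norm\<close>

type_synonym signal = "nat \<Rightarrow> nat \<Rightarrow> real vec"

definition vconcat :: "real vec list \<Rightarrow> real vec" where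
  "vconcat vs = foldr append_vec vs (0\<^sub>v 0)"

definition trajectory ::
  "dsys \<Rightarrow> signal \<Rightarrow> signal \<Rightarrow> (nat \<times> nat \<Rightarrow> nat \<Rightarrow> real vec) \<Rightarrow> signal \<Rightarrow> bool" where
  "trajectory G u x xs y \<longleftrightarrow>
     (\<forall>k\<in>nodes G. \<forall>t. u k t \<in> carrier_vec (udim G k t) \<and> x k t \<in> carrier_vec (tdim G k t)) \<and>
     (\<forall>e\<in>edges G. \<forall>t. xs e t \<in> carrier_vec (sdim G e t)) \<and>
     (\<forall>k\<in>nodes G. x k 0 = 0\<^sub>v (tdim G k 0)) \<and>
     (\<forall>e\<in>edges G. xs e 0 = 0\<^sub>v (sdim G e 0)) \<and>
     (\<forall>k\<in>nodes G. \<forall>t.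
        vconcat (outs G x xs k (t + 1)) =
          Amat G k t *\<^sub>v vconcat (ins G x xs k t) + Bmat G k t *\<^sub>v u k t \<and>
        y k t = Cmat G k t *\<^sub>v vconcat (ins G x xs k t) + Dmat G k t *\<^sub>v u k t)"

text \<open>Systems and error systems are compared as sets of pairs (input, output).\<close>

definition io :: "dsys \<Rightarrow> (signal \<times> signal) set" where
  "io G = {(u, y). \<exists>x xs. trajectory G u x xs y}"

definition error_io :: "dsys \<Rightarrow> dsys \<Rightarrow> (signal \<times> signal) set" where
  "error_io G H = {(u, \<lambda>k t. y k t - y' k t) | u y y'. (u, y) \<in> io G \<and> (u, y') \<in> io H}"

definition l2norm :: "nat set \<Rightarrow> signal \<Rightarrow> ennreal" where
  "l2norm V w = (if summable (\<lambda>t. \<Sum>k\<in>V. w k t \<bullet> w k t)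
     then ennreal (sqrt (\<Sum>t. \<Sum>k\<in>V. w k t \<bullet> w k t)) else \<infinity>)"

text \<open>
  The norm takes values in the extended nonnegative reals. It is \<open>\<infinity>\<close> if some input in \<open>\<ell>\<^sub>2\<close> has an
  output outside \<open>\<ell>\<^sub>2\<close>, so a finite value includes the claim that \<open>\<ell>\<^sub>2\<close> is mapped to \<open>\<ell>\<^sub>2\<close>; it is
  \<open>0\<close> if the only input is zero.
\<close>

definition io_norm :: "nat set \<Rightarrow> (signal \<times> signal) set \<Rightarrow> ennreal" where
  "io_norm V R = (SUP (u, y) \<in> {(u, y) \<in> R. l2norm V u \<noteq> 0 \<and> l2norm V u < \<infinity>}.
     l2norm V y / l2norm V u)"

subsection \<open>Matrix inequalities and strong stability\<close>

definition pos_def :: "real mat \<Rightarrow> bool" where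
  "pos_def M \<longleftrightarrow> square_mat M \<and> M\<^sup>T = M \<and>
     (\<forall>v \<in> carrier_vec (dim_row M). v \<noteq> 0\<^sub>v (dim_row M) \<longrightarrow> v \<bullet> (M *\<^sub>v v) > 0)"

definition mat_gt :: "real mat \<Rightarrow> real \<Rightarrow> bool" where \<comment> \<open>\<open>M \<succ> \<beta> I\<close>\<close>
  "mat_gt M \<beta> \<longleftrightarrow> pos_def (M - \<beta> \<cdot>\<^sub>m 1\<^sub>m (dim_row M))"

definition mat_lt :: "real mat \<Rightarrow> real \<Rightarrow> bool" where \<comment> \<open>\<open>M \<prec> \<beta> I\<close>\<close>
  "mat_lt M \<beta> \<longleftrightarrow> pos_def (\<beta> \<cdot>\<^sub>m 1\<^sub>m (dim_row M) - M)"

definition gramian_family :: "dsys \<Rightarrow> real \<Rightarrow> (nat \<Rightarrow> nat \<Rightarrow> real mat) \<Rightarrow>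
    (nat \<times> nat \<Rightarrow> nat \<Rightarrow> real mat) \<Rightarrow> bool" where
  "gramian_family G \<beta> W Ws \<longleftrightarrow>
     (\<forall>k\<in>nodes G. \<forall>t. W k t \<in> carrier_mat (tdim G k t) (tdim G k t) \<and> mat_gt (W k t) \<beta>) \<and>
     (\<forall>e\<in>edges G. \<forall>t. Ws e t \<in> carrier_mat (sdim G e t) (sdim G e t) \<and> mat_gt (Ws e t) \<beta>) \<and>
     unif_bounded (nodes G) W \<and> unif_bounded (edges G) Ws"

definition strongly_stable :: "dsys \<Rightarrow> bool" where
  "strongly_stable G \<longleftrightarrow> (\<exists>\<beta>>0. \<exists>W Ws. gramian_family G \<beta> W Ws \<and>
     (\<forall>k\<in>nodes G. \<forall>t.
        mat_lt ((Amat G k t)\<^sup>T * out_diag G W Ws k (t + 1) * Amat G k t - in_diag G W Ws k t) (- \<beta>)))"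

subsection \<open>Eventual time-periodicity\<close>

definition etp :: "nat \<Rightarrow> nat \<Rightarrow> (nat \<Rightarrow> 'a) \<Rightarrow> bool" where
  "etp h q M \<longleftrightarrow> (\<forall>t z. M (t + h + z * q) = M (t + h))"

definition etp_family :: "nat \<Rightarrow> nat \<Rightarrow> dsys \<Rightarrow> (nat \<Rightarrow> nat \<Rightarrow> 'a) \<Rightarrow>
    (nat \<times> nat \<Rightarrow> nat \<Rightarrow> 'a) \<Rightarrow> bool" where
  "etp_family h q G X Y \<longleftrightarrow> (\<forall>k\<in>nodes G. etp h q (X k)) \<and> (\<forall>e\<in>edges G. etp h q (Y e))"

text \<open>
  The matrices of a realization are block-partitioned according to the temporal and spatial state
  dimensions. A matrix determines its total size only, hence the periodicity of the partition is
  stated separately.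
\<close>

definition etp_realization :: "nat \<Rightarrow> nat \<Rightarrow> dsys \<Rightarrow> bool" where
  "etp_realization h q G \<longleftrightarrow>
     (\<forall>k\<in>nodes G. etp h q (Amat G k) \<and> etp h q (Bmat G k) \<and> etp h q (Cmat G k) \<and> etp h q (Dmat G k)) \<and>
     etp_family h q G (tdim G) (sdim G)"

subsection \<open>Balanced realizations\<close>

definition diag_decreasing :: "real mat \<Rightarrow> bool" where
  "diag_decreasing M \<longleftrightarrow> diagonal_mat M \<and> sorted_wrt (\<ge>) (diag_mat M)"

definition balanced_gramians :: "dsys \<Rightarrow> (nat \<Rightarrow> nat \<Rightarrow> real mat) \<Rightarrow>
    (nat \<times> nat \<Rightarrow> nat \<Rightarrow> real mat) \<Rightarrow> bool" where
  "balanced_gramians G S Ss \<longleftrightarrow>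
     (\<forall>k\<in>nodes G. \<forall>t. diag_decreasing (S k t)) \<and> (\<forall>e\<in>edges G. \<forall>t. diag_decreasing (Ss e t)) \<and>
     (\<exists>\<beta>>0. gramian_family G \<beta> S Ss \<and>
       (\<forall>k\<in>nodes G. \<forall>t.
          mat_lt (Amat G k t * in_diag G S Ss k t * (Amat G k t)\<^sup>T - out_diag G S Ss k (t + 1)
                  + Bmat G k t * (Bmat G k t)\<^sup>T) (- \<beta>) \<and>
          mat_lt ((Amat G k t)\<^sup>T * out_diag G S Ss k (t + 1) * Amat G k t - in_diag G S Ss k t
                  + (Cmat G k t)\<^sup>T * Cmat G k t) (- \<beta>)))"

text \<open>\<open>Ti\<close> and \<open>Tsi\<close> are the families of inverses of \<open>T\<close> and \<open>Ts\<close>.\<close>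

definition state_transformed :: "dsys \<Rightarrow> dsys \<Rightarrow> bool" where
  "state_transformed G H \<longleftrightarrow>
     nnodes H = nnodes G \<and> edges H = edges G \<and>
     (\<forall>k\<in>nodes G. \<forall>t. tdim H k t = tdim G k t \<and> udim H k t = udim G k t \<and> ydim H k t = ydim G k t) \<and>
     (\<forall>e\<in>edges G. \<forall>t. sdim H e t = sdim G e t) \<and>
     (\<exists>T Ti Ts Tsi.
        (\<forall>k\<in>nodes G. \<forall>t.
           T k t \<in> carrier_mat (tdim G k t) (tdim G k t) \<and>
           Ti k t \<in> carrier_mat (tdim G k t) (tdim G k t) \<and>
           inverts_mat (T k t) (Ti k t) \<and> inverts_mat (Ti k t) (T k t)) \<and>
        (\<forall>e\<in>edges G. \<forall>t.
           Ts e t \<in> carrier_mat (sdim G e t) (sdim G e t) \<and>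
           Tsi e t \<in> carrier_mat (sdim G e t) (sdim G e t) \<and>
           inverts_mat (Ts e t) (Tsi e t) \<and> inverts_mat (Tsi e t) (Ts e t)) \<and>
        (\<forall>k\<in>nodes G. \<forall>t.
           Amat H k t = out_diag G T Ts k (t + 1) * Amat G k t * in_diag G Ti Tsi k t \<and>
           Bmat H k t = out_diag G T Ts k (t + 1) * Bmat G k t \<and>
           Cmat H k t = Cmat G k t * in_diag G Ti Tsi k t \<and>
           Dmat H k t = Dmat G k t))"

definition balanced_realization :: "dsys \<Rightarrow> dsys \<Rightarrow> bool" where
  "balanced_realization G H \<longleftrightarrow>
     distributed_system H \<and> state_transformed G H \<and> (\<exists>S Ss. balanced_gramians H S Ss)"

subsection \<open>Balanced truncation\<close>

text \<open>
  For a list of pairs (block size, number of entries kept), the index set that selects the leading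
  entries of every block of a stacked vector.
\<close>

fun kept :: "(nat \<times> nat) list \<Rightarrow> nat set" where
  "kept [] = {}"
| "kept ((n, r) # bs) = {..<r} \<union> (+) n ` kept bs"

definition truncation :: "dsys \<Rightarrow> (nat \<Rightarrow> nat \<Rightarrow> nat) \<Rightarrow> (nat \<times> nat \<Rightarrow> nat \<Rightarrow> nat) \<Rightarrow> dsys" where
  "truncation G r rs =
     (let R = (\<lambda>k t. kept (zip (outs G (tdim G) (sdim G) k (t + 1)) (outs G r rs k (t + 1))));
          C = (\<lambda>k t. kept (zip (ins G (tdim G) (sdim G) k t) (ins G r rs k t)))
      in G\<lparr>tdim := r, sdim := rs,
           Amat := \<lambda>k t. submatrix (Amat G k t) (R k t) (C k t),
           Bmat := \<lambda>k t. submatrix (Bmat G k t) (R k t) UNIV,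
           Cmat := \<lambda>k t. submatrix (Cmat G k t) UNIV (C k t)\<rparr>)"

definition gramian_partition :: "nat \<Rightarrow> real mat \<Rightarrow> real mat \<Rightarrow> real mat \<Rightarrow> bool" where
  "gramian_partition r S \<Gamma> \<Omega> \<longleftrightarrow> r \<le> dim_row S \<and> \<Gamma> \<in> carrier_mat r r \<and>
     \<Omega> \<in> carrier_mat (dim_row S - r) (dim_row S - r) \<and> S = diag_block_mat [\<Gamma>, \<Omega>]"

text \<open>
  All blocks over the first \<open>T\<close> time instants; blocks of dimension zero do not contribute to
  \<^const>\<open>diag_block_mat\<close>.
\<close>

definition total_diag :: "dsys \<Rightarrow> nat \<Rightarrow> (nat \<Rightarrow> nat \<Rightarrow> real mat) \<Rightarrow>
    (nat \<times> nat \<Rightarrow> nat \<Rightarrow> real mat) \<Rightarrow> real mat" where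
  "total_diag G T \<Omega> \<Omega>s =
     diag_block_mat (concat (map (\<lambda>t. concat (map (\<lambda>k. outs G \<Omega> \<Omega>s k t) [1..<Suc (nnodes G)])) [0..<T]))"

definition zeta :: "real mat \<Rightarrow> real" where
  "zeta M = \<Sum> (set (diag_mat M))"

subsection \<open>Well-posedness\<close>

text \<open>The relation \<^const>\<open>io\<close> is a total function on inputs of the right dimensions.\<close>

lemma vconcat_simps [simp]:
  "vconcat [] = 0\<^sub>v 0" "vconcat (v # vs) = v @\<^sub>v vconcat vs"
  by (simp_all add: vconcat_def)

lemma vconcat_carrier:
  "list_all2 (\<lambda>v n. v \<in> carrier_vec n) vs ns \<Longrightarrow> vconcat vs \<in> carrier_vec (sum_list ns)"
  by (induction rule: list_all2_induct) auto

lemma vconcat_inj: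
  assumes "list_all2 (\<lambda>v n. v \<in> carrier_vec n) vs ns"
    and "list_all2 (\<lambda>v n. v \<in> carrier_vec n) ws ns" and "vconcat vs = vconcat ws"
  shows "vs = ws"
  using assms
proof (induction arbitrary: ws rule: list_all2_induct)
  case (Cons v vs n ns)
  then obtain w ws' where ws: "ws = w # ws'" "w \<in> carrier_vec n"
    "list_all2 (\<lambda>v n. v \<in> carrier_vec n) ws' ns"
    by (auto simp: list_all2_Cons2)
  have "v = w \<and> vconcat vs = vconcat ws'"
    using Cons.prems(2) append_vec_eq[OF Cons.hyps(1) ws(2)] unfolding ws(1) by simp
  with Cons.IH[OF ws(3)] show ?case by (simp add: ws(1))
qed simp

lemma vconcat_split:
  "v \<in> carrier_vec (sum_list ns) \<Longrightarrow>
     \<exists>vs. list_all2 (\<lambda>v n. v \<in> carrier_vec n) vs ns \<and> vconcat vs = v"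
proof (induction ns arbitrary: v)
  case (Cons n ns)
  define w where "w = vec_last v (sum_list ns)"
  have v: "v = vec_first v n @\<^sub>v w"
    using Cons.prems by (simp add: w_def)
  have "w \<in> carrier_vec (sum_list ns)" by (simp add: w_def)
  from Cons.IH[OF this] obtain vs where
    "list_all2 (\<lambda>v n. v \<in> carrier_vec n) vs ns" "vconcat vs = w" by blast
  with v show ?case
    by (intro exI[of _ "vec_first v n # vs"]) auto
qed auto

lemma distinct_map_choice:
  assumes "distinct ks" "length vs = length ks"
  shows "\<exists>f. map f ks = vs"
proof -
  have "map (\<lambda>k. the (map_of (zip ks vs) k)) ks = vs"
    using assms by (intro nth_equalityI) (auto simp: map_of_zip_nth)
  then show ?thesis by blast
qed

context
  fixes G :: dsys
  assumes G: "distributed_system G"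
begin

lemma edges_subset: "edges G \<subseteq> nodes G \<times> nodes G"
  using G by (simp add: distributed_system_def)

lemma set_E_in: "set (E_in G k) = {i. (i, k) \<in> edges G}"
  and set_E_out: "set (E_out G k) = {j. (k, j) \<in> edges G}"
  and distinct_E_out: "distinct (E_out G k)"
  using G by (auto simp: E_in_def E_out_def distributed_system_def)

lemma outs_carrier:
  assumes "x k t \<in> carrier_vec (tdim G k t)" "\<And>e. e \<in> edges G \<Longrightarrow> xs e t \<in> carrier_vec (sdim G e t)"
  shows "list_all2 (\<lambda>v n. v \<in> carrier_vec n) (outs G x xs k t) (outs G (tdim G) (sdim G) k t)"
proof -
  have "(k, E_out G k ! i) \<in> edges G" if "i < length (E_out G k)" for i
    using nth_mem[OF that] by (simp add: set_E_out)
  with assms show ?thesis by (auto simp: outs_def list_all2_conv_all_nth nth_Cons')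
qed

lemma io_total:
  assumes u: "\<And>k t. k \<in> nodes G \<Longrightarrow> u k t \<in> carrier_vec (udim G k t)"
  shows "\<exists>y. (u, y) \<in> io G"
proof -
  define ok :: "nat \<Rightarrow> (nat \<Rightarrow> real vec) \<times> (nat \<times> nat \<Rightarrow> real vec) \<Rightarrow> bool"
    where "ok = (\<lambda>t s. (\<forall>k\<in>nodes G. fst s k \<in> carrier_vec (tdim G k t)) \<and>
    (\<forall>e\<in>edges G. snd s e \<in> carrier_vec (sdim G e t)) \<and>
    (t = 0 \<longrightarrow> (\<forall>k\<in>nodes G. fst s k = 0\<^sub>v (tdim G k 0)) \<and> (\<forall>e\<in>edges G. snd s e = 0\<^sub>v (sdim G e 0))))"
  define nxt where "nxt = (\<lambda>t s s'. \<forall>k\<in>nodes G.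
    vconcat (fst s' k # map (\<lambda>j. snd s' (k, j)) (E_out G k)) =
      Amat G k t *\<^sub>v vconcat (fst s k # map (\<lambda>i. snd s (i, k)) (E_in G k)) + Bmat G k t *\<^sub>v u k t)"
  have "\<exists>f. \<forall>t. ok t (f t) \<and> nxt t (f t) (f (Suc t))"
  proof (rule dependent_nat_choice)
    show "\<exists>s. ok 0 s"
      by (rule exI[of _ "(\<lambda>k. 0\<^sub>v (tdim G k 0), \<lambda>e. 0\<^sub>v (sdim G e 0))"]) (auto simp: ok_def)
  next
    fix s t assume s: "ok t s"
    define z where "z = (\<lambda>k. Amat G k t *\<^sub>v vconcat (fst s k # map (\<lambda>i. snd s (i, k)) (E_in G k)) +
      Bmat G k t *\<^sub>v u k t)"
    define P where "P = (\<lambda>k a f. a \<in> carrier_vec (tdim G k (t + 1)) \<and>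
      (\<forall>j. (k, j) \<in> edges G \<longrightarrow> f j \<in> carrier_vec (sdim G (k, j) (t + 1))) \<and>
      vconcat (a # map f (E_out G k)) = z k)"
    have "\<exists>a f. P k a f" if k: "k \<in> nodes G" for k
    proof -
      have "Amat G k t \<in> carrier_mat (out_dim G k (t + 1)) (in_dim G k t)"
        "Bmat G k t \<in> carrier_mat (out_dim G k (t + 1)) (udim G k t)"
        using G k by (auto simp: distributed_system_def)
      then have "z k \<in> carrier_vec (sum_list (outs G (tdim G) (sdim G) k (t + 1)))"
        by (intro carrier_vecI) (auto simp: z_def out_dim_def)
      from vconcat_split[OF this] obtain vs where
        "list_all2 (\<lambda>v n. v \<in> carrier_vec n) vs (outs G (tdim G) (sdim G) k (t + 1))"
        and z: "vconcat vs = z k" by blast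
      then obtain a ws where vs: "vs = a # ws" "a \<in> carrier_vec (tdim G k (t + 1))"
        and ws: "list_all2 (\<lambda>v n. v \<in> carrier_vec n) ws (map (\<lambda>j. sdim G (k, j) (t + 1)) (E_out G k))"
        by (auto simp: outs_def list_all2_Cons2)
      obtain f where f: "map f (E_out G k) = ws"
        using distinct_map_choice[OF distinct_E_out, of ws] list_all2_lengthD[OF ws] by auto
      have "f j \<in> carrier_vec (sdim G (k, j) (t + 1))" if "(k, j) \<in> edges G" for j
      proof -
        from that obtain i where "i < length (E_out G k)" "E_out G k ! i = j"
          by (metis in_set_conv_nth mem_Collect_eq set_E_out)
        with list_all2_nthD2[OF ws, of i] show ?thesis by (simp add: f[symmetric])
      qed
      with vs z f have "P k a f" by (simp add: P_def)
      then show ?thesis by blast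
    qed
    then obtain a f where *: "\<And>k. k \<in> nodes G \<Longrightarrow> P k (a k) (f k)"
      by metis
    have "(\<lambda>(i, j). f i j) e \<in> carrier_vec (sdim G e (Suc t))" if "e \<in> edges G" for e
      using subsetD[OF edges_subset that] *[of "fst e"] that by (cases e) (simp add: P_def)
    with * have "ok (Suc t) (a, \<lambda>(i, j). f i j)"
      by (simp add: ok_def P_def)
    moreover have "nxt t s (a, \<lambda>(i, j). f i j)"
      using * by (simp add: nxt_def P_def z_def)
    ultimately show "\<exists>s'. ok (Suc t) s' \<and> nxt t s s'" by blast
  qed
  then obtain s where s: "\<And>t. ok t (s t)" "\<And>t. nxt t (s t) (s (Suc t))" by blast
  define x where "x = (\<lambda>k t. fst (s t) k)"
  define xs where "xs = (\<lambda>e t. snd (s t) e)"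
  have "trajectory G u x xs (\<lambda>k t. Cmat G k t *\<^sub>v vconcat (ins G x xs k t) + Dmat G k t *\<^sub>v u k t)"
    using s u unfolding trajectory_def ok_def nxt_def x_def xs_def ins_def outs_def by simp
  then show ?thesis unfolding io_def by blast
qed

lemma io_unique:
  assumes "(u, y) \<in> io G" "(u, y') \<in> io G" "k \<in> nodes G"
  shows "y k t = y' k t"
proof -
  obtain x xs x' xs' where T: "trajectory G u x xs y" and T': "trajectory G u x' xs' y'"
    using assms by (auto simp: io_def)
  have ins: "ins G x xs k t = ins G x' xs' k t"
    if "k \<in> nodes G" "\<forall>k\<in>nodes G. x k t = x' k t" "\<forall>e\<in>edges G. xs e t = xs' e t" for k t
    using that by (auto simp: ins_def set_E_in)
  have eq: "(\<forall>k\<in>nodes G. x k t = x' k t) \<and> (\<forall>e\<in>edges G. xs e t = xs' e t)" for t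
  proof (induction t)
    case 0
    show ?case using T T' by (simp add: trajectory_def)
  next
    case (Suc t)
    have *: "outs G x xs k (Suc t) = outs G x' xs' k (Suc t)" if k: "k \<in> nodes G" for k
    proof (rule vconcat_inj)
      show "list_all2 (\<lambda>v n. v \<in> carrier_vec n) (outs G x xs k (Suc t)) (outs G (tdim G) (sdim G) k (Suc t))"
        "list_all2 (\<lambda>v n. v \<in> carrier_vec n) (outs G x' xs' k (Suc t)) (outs G (tdim G) (sdim G) k (Suc t))"
        using T T' k by (auto simp: trajectory_def intro!: outs_carrier)
      show "vconcat (outs G x xs k (Suc t)) = vconcat (outs G x' xs' k (Suc t))"
        using T T' k ins[of k t] Suc by (simp add: trajectory_def)
    qed
    have "xs e (Suc t) = xs' e (Suc t)" if e_in: "e \<in> edges G" for e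
    proof -
      obtain k j where e: "e = (k, j)" "k \<in> nodes G"
        using subsetD[OF edges_subset e_in] by (metis mem_Times_iff prod.collapse)
      with *[of k] e_in show ?thesis by (auto simp: outs_def set_E_out)
    qed
    moreover have "x k (Suc t) = x' k (Suc t)" if "k \<in> nodes G" for k
      using *[OF that] by (auto simp: outs_def)
    ultimately show ?case by blast
  qed
  with T T' ins[of k t] assms(3) show ?thesis by (simp add: trajectory_def)
qed

end

end

theory Submission
  imports Defs "HOL-Analysis.L2_Norm" "Jordan_Normal_Form.Determinant"
begin

text \<open>
  (i) Averaging a Lyapunov function over many periods keeps the Lyapunov inequality, which is linear
  in \<open>W\<close>, up to an error that vanishes with the number of periods, and so yields a periodic one; on
  the finite initial segment, quickly decreasing multiples of the identity take over. Factorizing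
  \<open>W = T\<^sup>T T\<close> and transforming by \<open>T\<close> makes all state matrices uniform contractions, and then a
  large multiple of the identity satisfies both gramian inequalities.

  (ii) Let \<open>\<sigma>\<close> be one of the finitely many distinct values in \<open>\<Omega>\<close> and remove all states carrying the
  value \<open>\<sigma>\<close>, at all times and all nodes and edges simultaneously. If \<open>x\<close> and \<open>z\<close> are the states before
  and after, padded with zeros, then \<open>(x - z)\<^sup>T \<Sigma> (x - z) + \<sigma>\<^sup>2 (x + z)\<^sup>T \<Sigma>\<^sup>-\<^sup>1 (x + z)\<close> is a storage function
  showing that the energy of the error is at most \<open>4 \<sigma>\<^sup>2 \<rho>\<close> times the energy of the input, where
  \<open>\<rho> < 1\<close> reflects the strictness of the gramian inequalities. Summation over the nodes works because
  every edge leaves one node and enters one node. Removing one value after the other, the triangle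
  inequality gives the bound \<open>2 sqrt(\<rho>) \<zeta>(\<Omega>)\<close>.
\<close>

subsection \<open>Vectors and quadratic forms\<close>

text \<open>In (i) no limit is taken. Averaging over \<open>Z\<close> periods leaves only a boundary
  term, bounded independently of \<open>Z\<close>, at the step where the period wraps around; the
  strict margin \<beta> absorbs it once \<open>Z\<close> is large. Periodicity of \<open>W\<close>
  passes to the realization because the factor \<open>T\<close> is chosen as a function of the
  matrix \<open>W\<close>, not of the time.

  In (ii) the obstacle is that the states with value \<sigma> lie scattered over all times, nodes
  and edges, so that each intermediate system would need re-indexed matrices and gramians of its
  own. Zeroing rows instead of deleting states avoids both: the gramian inequalities are applied to
  the unmasked \<open>H\<close> only, and masking the resulting states can only decrease the storage
  function. Before masking, the difference \<open>x - z\<close> is updated without input and the sum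
  \<open>x + z\<close> with input \<open>2u\<close>, which is the origin of the 4. Periodicity
  enters (ii) through the finiteness of the set of values: every value that is ever truncated
  already occurs before time \<open>h + q\<close>.\<close>

abbreviation sqn :: "real vec \<Rightarrow> real" where
  "sqn v \<equiv> v \<bullet> v"

definition qform :: "real mat \<Rightarrow> real vec \<Rightarrow> real" where
  "qform M v = v \<bullet> (M *\<^sub>v v)"

lemma sqn_sum: "sqn v = (\<Sum>i<dim_vec v. (v $ i)\<^sup>2)"
  by (simp add: scalar_prod_def power2_eq_square lessThan_atLeast0)

lemma sqn_nonneg [simp]: "0 \<le> sqn v"
  by (simp add: sqn_sum sum_nonneg)

lemma sqn_eq_0_iff: "v \<in> carrier_vec n \<Longrightarrow> sqn v = 0 \<longleftrightarrow> v = 0\<^sub>v n"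
  by (auto simp: sqn_sum sum_nonneg_eq_0_iff)

lemma sqn_pos: "v \<in> carrier_vec n \<Longrightarrow> v \<noteq> 0\<^sub>v n \<Longrightarrow> 0 < sqn v"
  using sqn_eq_0_iff[of v n] sqn_nonneg[of v] by linarith

lemma sqn_smult: "sqn (c \<cdot>\<^sub>v v) = c\<^sup>2 * sqn v"
  by (simp add: sqn_sum power_mult_distrib sum_distrib_left)

lemma weighted_young: "0 < c \<Longrightarrow> 2 * (a * b) \<le> c * a\<^sup>2 + b\<^sup>2 / (c :: real)"
proof -
  assume c: "0 < c"
  have "0 \<le> (c * a - b)\<^sup>2 / c" using c by simp
  also have "\<dots> = c * a\<^sup>2 + b\<^sup>2 / c - 2 * (a * b)"
    using c by (simp add: field_simps power2_eq_square)
  finally show ?thesis by simp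
qed

lemma scalar_prod_young:
  fixes v w :: "real vec"
  assumes "dim_vec v = dim_vec w" "0 < c"
  shows "2 * (v \<bullet> w) \<le> c * sqn v + sqn w / c"
proof -
  have "2 * (v \<bullet> w) = (\<Sum>i<dim_vec w. 2 * (v $ i * w $ i))"
    by (simp add: scalar_prod_def sum_distrib_left lessThan_atLeast0)
  also have "\<dots> \<le> (\<Sum>i<dim_vec w. c * (v $ i)\<^sup>2 + (w $ i)\<^sup>2 / c)"
    by (intro sum_mono weighted_young assms)
  also have "\<dots> = c * sqn v + sqn w / c"
    by (simp add: sqn_sum sum.distrib sum_distrib_left sum_divide_distrib assms)
  finally show ?thesis .
qed

subsection \<open>Operator bounds\<close>

text \<open>The constant bounds the square of the operator norm. In this form bounds are linear in
  squared norms, like the quadratic-form inequalities, and roots appear only in the translation to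
  \<open>op_bounded\<close>.\<close>

definition sq_bounded :: "real \<Rightarrow> real mat \<Rightarrow> bool" where
  "sq_bounded c M \<longleftrightarrow> (\<forall>v \<in> carrier_vec (dim_col M). sqn (M *\<^sub>v v) \<le> c * sqn v)"

lemma sq_boundedI:
  assumes "M \<in> carrier_mat m n" "\<And>v. v \<in> carrier_vec n \<Longrightarrow> sqn (M *\<^sub>v v) \<le> c * sqn v"
  shows "sq_bounded c M"
  using assms by (auto simp: sq_bounded_def)

lemma sq_boundedD:
  assumes "sq_bounded c M" "M \<in> carrier_mat m n" "v \<in> carrier_vec n"
  shows "sqn (M *\<^sub>v v) \<le> c * sqn v"
  using assms by (auto simp: sq_bounded_def)

lemma sq_bounded_mono: "sq_bounded c M \<Longrightarrow> c \<le> d \<Longrightarrow> sq_bounded d M"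
  unfolding sq_bounded_def by (meson order_trans mult_right_mono sqn_nonneg)

lemma op_bounded_imp_sq_bounded:
  assumes "op_bounded c M" shows "sq_bounded (c\<^sup>2) M"
  unfolding sq_bounded_def
proof
  fix v :: "real vec" assume "v \<in> carrier_vec (dim_col M)"
  with assms have "sqrt (sqn (M *\<^sub>v v)) \<le> c * sqrt (sqn v)" by (auto simp: op_bounded_def)
  then have "(sqrt (sqn (M *\<^sub>v v)))\<^sup>2 \<le> (c * sqrt (sqn v))\<^sup>2"
    by (rule power_mono) simp
  then show "sqn (M *\<^sub>v v) \<le> c\<^sup>2 * sqn v" by (simp add: power_mult_distrib)
qed

lemma sq_bounded_imp_op_bounded:
  assumes "sq_bounded c M" shows "op_bounded (sqrt c) M"
  unfolding op_bounded_def
  using assms by (auto simp: sq_bounded_def simp flip: real_sqrt_mult)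

lemma unif_boundedE:
  assumes "unif_bounded I M"
  obtains c where "c > 0" "\<And>i t. i \<in> I \<Longrightarrow> sq_bounded c (M i t)"
proof -
  obtain c where c: "\<And>i t. i \<in> I \<Longrightarrow> op_bounded c (M i t)"
    using assms by (auto simp: unif_bounded_def)
  show thesis
  \<comment> \<open>\<open>c\<close> may be zero, or even negative if only the zero vector occurs;
    adding 1 to its square supplies the positive constant by which
    \<open>sq_bounded_transpose\<close> divides.\<close>
  proof (rule that[of "c\<^sup>2 + 1"])
    show "0 < c\<^sup>2 + 1" by (simp add: add_nonneg_pos)
    show "sq_bounded (c\<^sup>2 + 1) (M i t)" if "i \<in> I" for i t
      using op_bounded_imp_sq_bounded[OF c[OF that]] by (rule sq_bounded_mono) simp
  qed
qed

lemma unif_boundedI: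
  "(\<And>i t. i \<in> I \<Longrightarrow> sq_bounded c (M i t)) \<Longrightarrow> unif_bounded I M"
  unfolding unif_bounded_def using sq_bounded_imp_op_bounded by blast

lemma sq_bounded_mult:
  assumes "M \<in> carrier_mat m n" "N \<in> carrier_mat n l" "sq_bounded c M" "sq_bounded d N" "0 \<le> c"
  shows "sq_bounded (c * d) (M * N)"
proof (rule sq_boundedI)
  show "M * N \<in> carrier_mat m l" using assms by simp
  fix v :: "real vec" assume v: "v \<in> carrier_vec l"
  have "sqn ((M * N) *\<^sub>v v) = sqn (M *\<^sub>v (N *\<^sub>v v))" using assms v by simp
  also have "\<dots> \<le> c * sqn (N *\<^sub>v v)" using assms v by (intro sq_boundedD) auto
  also have "\<dots> \<le> c * (d * sqn v)"
    using assms v by (intro mult_left_mono sq_boundedD) auto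
  finally show "sqn ((M * N) *\<^sub>v v) \<le> c * d * sqn v" by simp
qed

lemma transpose_adjoint:
  fixes A :: "real mat"
  assumes "A \<in> carrier_mat m n" "v \<in> carrier_vec m" "w \<in> carrier_vec n"
  shows "v \<bullet> (A *\<^sub>v w) = (A\<^sup>T *\<^sub>v v) \<bullet> w"
  using transpose_vec_mult_scalar[OF assms(1,3,2)] by simp

text \<open>With \<open>w = A\<^sup>T v\<close>, the adjoint identity gives
  \<open>2 |w|^2 = 2 v \<bullet> A w\<close>. Young with weight \<open>c\<close> bounds this by
  \<open>c |v|^2 + |w|^2\<close>, so one copy of \<open>|w|^2\<close> cancels and no singular values
  are involved.\<close>

lemma sq_bounded_transpose:
  assumes A: "A \<in> carrier_mat m n" and b: "sq_bounded c A" and c: "0 < c"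
  shows "sq_bounded c A\<^sup>T"
proof (rule sq_boundedI)
  show "A\<^sup>T \<in> carrier_mat n m" using A by simp
  fix v :: "real vec" assume v: "v \<in> carrier_vec m"
  define w where "w = A\<^sup>T *\<^sub>v v"
  have w: "w \<in> carrier_vec n" using A v by (simp add: w_def)
  have "2 * sqn w = 2 * (v \<bullet> (A *\<^sub>v w))"
    using transpose_adjoint[OF A v w] by (simp add: w_def)
  also have "\<dots> \<le> c * sqn v + sqn (A *\<^sub>v w) / c"
    using A v w c by (intro scalar_prod_young) auto
  also have "\<dots> \<le> c * sqn v + (c * sqn w) / c"
    using c sq_boundedD[OF b A w] by (intro add_left_mono divide_right_mono) auto
  finally show "sqn (A\<^sup>T *\<^sub>v v) \<le> c * sqn v" using c by (simp add: w_def)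
qed

text \<open>Young's inequality in place of Cauchy-Schwarz, which would give \<open>sqrt c\<close>;
  only the existence of a uniform constant matters.\<close>

lemma qform_le_sq_bounded:
  assumes "M \<in> carrier_mat n n" "sq_bounded c M" "0 < c" "v \<in> carrier_vec n"
  shows "qform M v \<le> (c + 1) * sqn v"
proof -
  have "2 * (v \<bullet> (M *\<^sub>v v)) \<le> c * sqn v + sqn (M *\<^sub>v v) / c"
    using assms by (intro scalar_prod_young) auto
  also have "\<dots> \<le> c * sqn v + (c * sqn v) / c"
    using assms sq_boundedD[OF assms(2,1,4)] by (intro add_left_mono divide_right_mono) auto
  also have "\<dots> = (c + 1) * sqn v" using assms(3) by (simp add: algebra_simps)
  moreover have "(c + 1) * sqn v \<ge> 0" using assms by simp
  ultimately show ?thesis by (simp add: qform_def)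
qed

subsection \<open>Matrix inequalities as inequalities between quadratic forms\<close>

lemma scaled_one_mult_vec: "v \<in> carrier_vec n \<Longrightarrow> (c \<cdot>\<^sub>m 1\<^sub>m n) *\<^sub>v v = c \<cdot>\<^sub>v (v :: real vec)"
  by (intro eq_vecI) auto

lemma qform_minus:
  assumes "M \<in> carrier_mat n n" "N \<in> carrier_mat n n" "v \<in> carrier_vec n"
  shows "qform (M - N) v = qform M v - qform N v"
  using assms by (simp add: qform_def minus_mult_distrib_mat_vec scalar_prod_minus_distrib[of _ n])

lemma qform_plus:
  assumes "M \<in> carrier_mat n n" "N \<in> carrier_mat n n" "v \<in> carrier_vec n"
  shows "qform (M + N) v = qform M v + qform N v"
  using assms by (simp add: qform_def add_mult_distrib_mat_vec scalar_prod_add_distrib[of _ n])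

lemma qform_scaled_one: "v \<in> carrier_vec n \<Longrightarrow> qform (c \<cdot>\<^sub>m 1\<^sub>m n) v = c * sqn v"
  by (simp add: qform_def scaled_one_mult_vec)

lemma qform_zero [simp]: "M \<in> carrier_mat n n \<Longrightarrow> qform M (0\<^sub>v n) = 0"
  by (simp add: qform_def scalar_prod_def)

lemma transpose_minus_mat:
  "A \<in> carrier_mat m n \<Longrightarrow> B \<in> carrier_mat m n \<Longrightarrow> (A - B)\<^sup>T = A\<^sup>T - (B\<^sup>T :: real mat)"
  by (intro eq_matI) auto

lemma transpose_smult_mat: "(c \<cdot>\<^sub>m A)\<^sup>T = c \<cdot>\<^sub>m (A\<^sup>T :: real mat)"
  by (intro eq_matI) auto

lemma smult_mult_mat_vec:
  "dim_vec v = dim_col A \<Longrightarrow> (c \<cdot>\<^sub>m A) *\<^sub>v v = c \<cdot>\<^sub>v (A *\<^sub>v v :: real vec)"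
  by (intro eq_vecI) auto

lemma transpose_smult_one: "(c \<cdot>\<^sub>m 1\<^sub>m n :: real mat)\<^sup>T = c \<cdot>\<^sub>m 1\<^sub>m n"
  by (intro eq_matI) auto

lemma mat_gt_iff:
  assumes M: "M \<in> carrier_mat n n"
  shows "mat_gt M \<beta> \<longleftrightarrow>
    M\<^sup>T = M \<and> (\<forall>v\<in>carrier_vec n. v \<noteq> 0\<^sub>v n \<longrightarrow> \<beta> * sqn v < qform M v)"
proof -
  let ?I = "\<beta> \<cdot>\<^sub>m 1\<^sub>m n :: real mat"
  have "(M - ?I)\<^sup>T = M - ?I \<longleftrightarrow> M\<^sup>T = M"
  proof
    assume "(M - ?I)\<^sup>T = M - ?I"
    then have *: "M\<^sup>T - ?I = M - ?I" using M by (simp add: transpose_minus_mat transpose_smult_one)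
    have "M\<^sup>T $$ (i, j) = M $$ (i, j)" if "i < n" "j < n" for i j
      using arg_cong[OF *, of "\<lambda>M. M $$ (i, j)"] M that by simp
    then show "M\<^sup>T = M" using M by (intro eq_matI) auto
  qed (use M in \<open>simp add: transpose_minus_mat transpose_smult_one\<close>)
  moreover have "v \<bullet> ((M - ?I) *\<^sub>v v) = qform M v - \<beta> * sqn v" if "v \<in> carrier_vec n" for v
    using qform_minus[OF M, of ?I v] qform_scaled_one[OF that] that by (simp add: qform_def)
  ultimately show ?thesis using M by (auto simp: mat_gt_def pos_def_def)
qed

text \<open>Symmetry is a hypothesis here and a conclusion in \<open>mat_gt_iff\<close>: the
  matrices to which \<open>mat_lt\<close> is applied are symmetric by construction, whereas for a
  gramian symmetry is part of what \<open>mat_gt\<close> asserts.\<close>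

lemma mat_lt_iff:
  assumes M: "M \<in> carrier_mat n n" and "M\<^sup>T = M"
  shows "mat_lt M \<beta> \<longleftrightarrow> (\<forall>v\<in>carrier_vec n. v \<noteq> 0\<^sub>v n \<longrightarrow> qform M v < \<beta> * sqn v)"
proof -
  let ?I = "\<beta> \<cdot>\<^sub>m 1\<^sub>m n :: real mat"
  have "(?I - M)\<^sup>T = ?I - M" using assms by (simp add: transpose_minus_mat[of _ n n] transpose_smult_one)
  moreover have "v \<bullet> ((?I - M) *\<^sub>v v) = \<beta> * sqn v - qform M v" if "v \<in> carrier_vec n" for v
    using qform_minus[of ?I, OF _ M, of v] qform_scaled_one[OF that] that by (simp add: qform_def)
  ultimately show ?thesis using M by (auto simp: mat_lt_def pos_def_def)
qed

lemma qform_congruence: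
  assumes "A \<in> carrier_mat m n" "S \<in> carrier_mat m m" "v \<in> carrier_vec n"
  shows "qform (A\<^sup>T * S * A) v = qform S (A *\<^sub>v v)"
proof -
  have "(A\<^sup>T * S * A) *\<^sub>v v = A\<^sup>T *\<^sub>v (S *\<^sub>v (A *\<^sub>v v))"
    using assms assoc_mult_mat_vec[of "A\<^sup>T * S" n m A n v] assoc_mult_mat_vec[of "A\<^sup>T" n m S m "A *\<^sub>v v"]
    by auto
  then show ?thesis
    using assms transpose_adjoint[of "A\<^sup>T" n m v "S *\<^sub>v (A *\<^sub>v v)"] by (simp add: qform_def)
qed

lemma transpose_congruence:
  assumes "A \<in> carrier_mat m n" "S \<in> carrier_mat m m" "S\<^sup>T = (S :: real mat)"
  shows "(A\<^sup>T * S * A)\<^sup>T = A\<^sup>T * S * A"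
proof -
  have "(A\<^sup>T * S * A)\<^sup>T = A\<^sup>T * (A\<^sup>T * S)\<^sup>T"
    using assms by (intro transpose_mult[of _ n m]) auto
  also have "(A\<^sup>T * S)\<^sup>T = S * A" using assms by (subst transpose_mult[of _ n m]) auto
  finally show ?thesis using assms by (simp add: assoc_mult_mat[of _ n m])
qed

lemma mat_lt_congruence_iff:
  assumes A: "A \<in> carrier_mat m n" and S: "S \<in> carrier_mat m m" "S\<^sup>T = S"
    and S': "S' \<in> carrier_mat n n" "S'\<^sup>T = S'"
  shows "mat_lt (A\<^sup>T * S * A - S') \<beta> \<longleftrightarrow>
    (\<forall>v\<in>carrier_vec n. v \<noteq> 0\<^sub>v n \<longrightarrow> qform S (A *\<^sub>v v) - qform S' v < \<beta> * sqn v)"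
proof -
  have c: "A\<^sup>T * S * A \<in> carrier_mat n n" using assms by simp
  have s: "(A\<^sup>T * S * A - S')\<^sup>T = A\<^sup>T * S * A - S'"
    using transpose_minus_mat[OF c S'(1)] transpose_congruence[OF A S] S'(2) by simp
  show ?thesis
    using mat_lt_iff[OF minus_carrier_mat[OF S'(1)] s] qform_minus[OF c S'(1)] qform_congruence[OF A S(1)]
    by auto
qed

lemma mat_lt_gramian_iff:
  assumes A: "A \<in> carrier_mat m n" and S: "S \<in> carrier_mat m m" "S\<^sup>T = S"
    and S': "S' \<in> carrier_mat n n" "S'\<^sup>T = S'" and C: "C \<in> carrier_mat l n"
  shows "mat_lt (A\<^sup>T * S * A - S' + C\<^sup>T * C) \<beta> \<longleftrightarrow>
    (\<forall>v\<in>carrier_vec n. v \<noteq> 0\<^sub>v n \<longrightarrow>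
       qform S (A *\<^sub>v v) - qform S' v + sqn (C *\<^sub>v v) < \<beta> * sqn v)"
proof -
  have c: "A\<^sup>T * S * A \<in> carrier_mat n n" "C\<^sup>T * C \<in> carrier_mat n n"
    "A\<^sup>T * S * A - S' \<in> carrier_mat n n" using assms by auto
  have "(C\<^sup>T * C)\<^sup>T = C\<^sup>T * C" using C by (subst transpose_mult[of _ n l]) auto
  then have s: "(A\<^sup>T * S * A - S' + C\<^sup>T * C)\<^sup>T = A\<^sup>T * S * A - S' + C\<^sup>T * C"
    using transpose_minus_mat[OF c(1) S'(1)] transpose_congruence[OF A S] S'(2)
      transpose_add[OF c(3,2)] by simp
  have "qform (C\<^sup>T * C) v = sqn (C *\<^sub>v v)" if "v \<in> carrier_vec n" for v
    using C that transpose_adjoint[of "C\<^sup>T" n l v "C *\<^sub>v v"]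
    by (simp add: qform_def assoc_mult_mat_vec[of _ n l])
  then have "qform (A\<^sup>T * S * A - S' + C\<^sup>T * C) v =
      qform S (A *\<^sub>v v) - qform S' v + sqn (C *\<^sub>v v)" if "v \<in> carrier_vec n" for v
    using that qform_plus[OF c(3,2) that] qform_minus[OF c(1) S'(1) that]
      qform_congruence[OF A S(1) that] by simp
  moreover have "A\<^sup>T * S * A - S' + C\<^sup>T * C \<in> carrier_mat n n" using c by simp
  ultimately show ?thesis using mat_lt_iff[OF _ s] by auto
qed

lemma mat_lt_gramian_dual_iff:
  assumes "A \<in> carrier_mat m n" "S \<in> carrier_mat n n" "S\<^sup>T = S"
    and "S' \<in> carrier_mat m m" "S'\<^sup>T = S'" "B \<in> carrier_mat m l"
  shows "mat_lt (A * S * A\<^sup>T - S' + B * B\<^sup>T) \<beta> \<longleftrightarrow>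
    (\<forall>v\<in>carrier_vec m. v \<noteq> 0\<^sub>v m \<longrightarrow>
       qform S (A\<^sup>T *\<^sub>v v) - qform S' v + sqn (B\<^sup>T *\<^sub>v v) < \<beta> * sqn v)"
  using mat_lt_gramian_iff[of "A\<^sup>T" n m S S' "B\<^sup>T" l \<beta>] assms by simp

subsection \<open>Cholesky factorization\<close>

lemma mult_mat_vec_zero: "A \<in> carrier_mat m n \<Longrightarrow> A *\<^sub>v 0\<^sub>v n = (0\<^sub>v m :: real vec)"
  by (intro eq_vecI) auto

text \<open>Induction on the size: after splitting off the first row and column, the Schur
  complement \<open>S\<close> of the corner entry is again positive definite, and a factor of
  \<open>S\<close> completes to the factor \<open>U\<close> of \<open>W\<close>.\<close>

lemma cholesky:
  assumes "W \<in> carrier_mat n n" "W\<^sup>T = W"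
    and "\<And>v. v \<in> carrier_vec n \<Longrightarrow> v \<noteq> 0\<^sub>v n \<Longrightarrow> 0 < qform W v"
  shows "\<exists>T. T \<in> carrier_mat n n \<and> T\<^sup>T * T = W"
  using assms
proof (induction n arbitrary: W)
  case 0
  then show ?case by (intro exI[of _ "0\<^sub>m 0 0"]) auto
next
  case (Suc n)
  define a where "a = W $$ (0, 0)"
  define b where "b = mat 1 n (\<lambda>(i, j). W $$ (0, Suc j))"
  define D where "D = mat n n (\<lambda>(i, j). W $$ (Suc i, Suc j))"
  have [simp]: "b \<in> carrier_mat 1 n" "b \<in> carrier_mat (Suc 0) n" "D \<in> carrier_mat n n" by (auto simp: b_def D_def)
  have dims [simp]: "dim_row b = 1" "dim_col b = n" "dim_row D = n" "dim_col D = n"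
    by (auto simp: b_def D_def)
  have sym: "W $$ (i, j) = W $$ (j, i)" if "i < Suc n" "j < Suc n" for i j
    using arg_cong[OF Suc.prems(2), of "\<lambda>M. M $$ (j, i)"] that Suc.prems(1) by simp
  have W: "W = four_block_mat (a \<cdot>\<^sub>m 1\<^sub>m 1) b b\<^sup>T D"
    using Suc.prems(1) sym by (intro eq_matI) (auto simp: a_def b_def D_def less_Suc_eq_0_disj)
  have split: "qform W (vec 1 (\<lambda>_. x) @\<^sub>v v) = a * x\<^sup>2 + 2 * x * (b *\<^sub>v v) $ 0 + qform D v"
    if v: "v \<in> carrier_vec n" for x v
  proof -
    let ?x = "vec 1 (\<lambda>_. x) :: real vec"
    have e: "W *\<^sub>v (?x @\<^sub>v v) =
      ((a \<cdot>\<^sub>m 1\<^sub>m 1) *\<^sub>v ?x + b *\<^sub>v v) @\<^sub>v (b\<^sup>T *\<^sub>v ?x + D *\<^sub>v v)"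
      unfolding W by (rule four_block_mat_mult_vec[of _ 1 1 _ n _ n]) (auto simp: v)
    have "qform W (?x @\<^sub>v v) =
      ?x \<bullet> ((a \<cdot>\<^sub>m 1\<^sub>m 1) *\<^sub>v ?x + b *\<^sub>v v) + v \<bullet> (b\<^sup>T *\<^sub>v ?x + D *\<^sub>v v)"
      unfolding qform_def e by (rule scalar_prod_append[of _ 1 _ n]) (simp_all add: carrier_dim_vec carrier_vecD[OF v])
    also have "v \<bullet> (b\<^sup>T *\<^sub>v ?x + D *\<^sub>v v) = (b *\<^sub>v v) \<bullet> ?x + qform D v"
    proof -
      have "b\<^sup>T *\<^sub>v ?x \<in> carrier_vec n" "D *\<^sub>v v \<in> carrier_vec n"
        by (simp_all add: carrier_dim_vec)
      then have "v \<bullet> (b\<^sup>T *\<^sub>v ?x + D *\<^sub>v v) = v \<bullet> (b\<^sup>T *\<^sub>v ?x) + v \<bullet> (D *\<^sub>v v)"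
        by (rule scalar_prod_add_distrib[OF v])
      also have "v \<bullet> (b\<^sup>T *\<^sub>v ?x) = (b\<^sup>T\<^sup>T *\<^sub>v v) \<bullet> ?x"
        by (rule transpose_adjoint[OF _ v]) simp_all
      finally show ?thesis by (simp only: qform_def transpose_transpose)
    qed
    also have "(a \<cdot>\<^sub>m 1\<^sub>m 1) *\<^sub>v ?x = a \<cdot>\<^sub>v ?x" by (simp add: scaled_one_mult_vec)
    also have "?x \<bullet> (a \<cdot>\<^sub>v ?x + b *\<^sub>v v) = x * (a * x + (b *\<^sub>v v) $ 0)"
      by (simp add: scalar_prod_def del: index_mult_mat_vec)
    also have "(b *\<^sub>v v) \<bullet> ?x = (b *\<^sub>v v) $ 0 * x"
      by (simp add: scalar_prod_def del: index_mult_mat_vec)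
    finally show ?thesis by (simp add: power2_eq_square distrib_left)
  qed
  have a: "a > 0"
  proof -
    have "vec 1 (\<lambda>_. 1) @\<^sub>v 0\<^sub>v n \<noteq> (0\<^sub>v (Suc n) :: real vec)"
    proof
      assume *: "vec 1 (\<lambda>_. 1) @\<^sub>v 0\<^sub>v n = (0\<^sub>v (Suc n) :: real vec)"
      show False using arg_cong[OF *, of "\<lambda>v. v $ 0"] by simp
    qed
    from Suc.prems(3)[OF _ this] split[of "0\<^sub>v n" 1] show ?thesis
      by (simp add: mult_mat_vec_zero[of b 1] carrier_dim_vec)
  qed
  define S where "S = D - (1 / a) \<cdot>\<^sub>m (b\<^sup>T * b)"
  have S [simp]: "S \<in> carrier_mat n n" unfolding S_def by (rule carrier_matI) simp_all
  have "S\<^sup>T = S"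
    using sym by (intro eq_matI) (auto simp: S_def D_def b_def scalar_prod_def)
  moreover have "0 < qform S v" if v: "v \<in> carrier_vec n" "v \<noteq> 0\<^sub>v n" for v
  proof -
    \<comment> \<open>The minimizer of \<open>a x^2 + 2 x (b v)\<close>: with this first coordinate
      the form of \<open>W\<close> equals the form of the Schur complement at
      \<open>v\<close>.\<close>
    define x where "x = - ((b *\<^sub>v v) $ 0) / a"
    have "qform (b\<^sup>T * b) v = v \<bullet> (b\<^sup>T *\<^sub>v (b *\<^sub>v v))"
      unfolding qform_def by (subst assoc_mult_mat_vec[OF _ _ v(1)]) auto
    also have "\<dots> = (b\<^sup>T\<^sup>T *\<^sub>v v) \<bullet> (b *\<^sub>v v)"
      by (rule transpose_adjoint[OF _ v(1)]) (simp_all add: carrier_dim_vec)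
    also have "\<dots> = ((b *\<^sub>v v) $ 0)\<^sup>2" by (simp add: sqn_sum)
    finally have bb: "qform ((1 / a) \<cdot>\<^sub>m (b\<^sup>T * b)) v = ((b *\<^sub>v v) $ 0)\<^sup>2 / a"
      by (simp add: qform_def smult_mult_mat_vec carrier_vecD[OF v(1)])
    have "vec 1 (\<lambda>_. x) @\<^sub>v v \<noteq> 0\<^sub>v (Suc n)"
    proof
      assume *: "vec 1 (\<lambda>_. x) @\<^sub>v v = 0\<^sub>v (Suc n)"
      have "v = 0\<^sub>v n"
      proof (rule eq_vecI)
        fix i assume "i < dim_vec (0\<^sub>v n)"
        then show "v $ i = 0\<^sub>v n $ i"
          using arg_cong[OF *, of "\<lambda>w. w $ Suc i"] carrier_vecD[OF v(1)] by simp
      qed (simp add: carrier_vecD[OF v(1)])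
      with v(2) show False by simp
    qed
    from Suc.prems(3)[OF _ this] have "0 < qform W (vec 1 (\<lambda>_. x) @\<^sub>v v)"
      by (simp add: carrier_dim_vec carrier_vecD[OF v(1)])
    also have "\<dots> = qform S v"
    proof -
      have "qform S v = qform D v - ((b *\<^sub>v v) $ 0)\<^sup>2 / a"
        unfolding S_def bb[symmetric] by (rule qform_minus[OF _ _ v(1)]) (auto intro!: carrier_matI)
      moreover have "a * x\<^sup>2 + 2 * x * y = - (y\<^sup>2 / a)" if "x = - y / a" for y
        unfolding that using a by (simp add: field_simps power2_eq_square)
      ultimately show ?thesis unfolding split[OF v(1)] using x_def by simp
    qed
    finally show ?thesis .
  qed
  ultimately obtain T where T: "T \<in> carrier_mat n n" "T\<^sup>T * T = S"
    using Suc.IH[OF S] by blast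
  define U where "U = four_block_mat (sqrt a \<cdot>\<^sub>m 1\<^sub>m 1) ((1 / sqrt a) \<cdot>\<^sub>m b) (0\<^sub>m n 1) T"
  have U: "U \<in> carrier_mat (Suc n) (Suc n)"
    using T four_block_carrier_mat[of "sqrt a \<cdot>\<^sub>m 1\<^sub>m 1" 1 1 T n n] by (simp add: U_def)
  have Ut: "U\<^sup>T = four_block_mat (sqrt a \<cdot>\<^sub>m 1\<^sub>m 1) (0\<^sub>m 1 n) ((1 / sqrt a) \<cdot>\<^sub>m b\<^sup>T) T\<^sup>T"
    unfolding U_def by (subst transpose_four_block_mat[of _ 1 1 _ n _ n])
      (auto simp: T transpose_smult_one transpose_smult_mat)
  have "U\<^sup>T * U = four_block_mat
      ((sqrt a \<cdot>\<^sub>m 1\<^sub>m 1) * (sqrt a \<cdot>\<^sub>m 1\<^sub>m 1) + 0\<^sub>m 1 n * 0\<^sub>m n 1)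
      ((sqrt a \<cdot>\<^sub>m 1\<^sub>m 1) * ((1 / sqrt a) \<cdot>\<^sub>m b) + 0\<^sub>m 1 n * T)
      (((1 / sqrt a) \<cdot>\<^sub>m b\<^sup>T) * (sqrt a \<cdot>\<^sub>m 1\<^sub>m 1) + T\<^sup>T * 0\<^sub>m n 1)
      (((1 / sqrt a) \<cdot>\<^sub>m b\<^sup>T) * ((1 / sqrt a) \<cdot>\<^sub>m b) + T\<^sup>T * T)"
    unfolding Ut unfolding U_def by (rule mult_four_block_mat[of _ 1 1 _ n _ n _ _ 1 _ n]) (auto simp: T)
  also have "\<dots> = W"
    unfolding W
  proof (rule cong_four_block_mat)
    show "(sqrt a \<cdot>\<^sub>m 1\<^sub>m 1) * (sqrt a \<cdot>\<^sub>m 1\<^sub>m 1) + 0\<^sub>m 1 n * 0\<^sub>m n 1 = a \<cdot>\<^sub>m 1\<^sub>m 1"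
      using a by (intro eq_matI) (auto simp: scalar_prod_def)
    show "(sqrt a \<cdot>\<^sub>m 1\<^sub>m 1) * ((1 / sqrt a) \<cdot>\<^sub>m b) + 0\<^sub>m 1 n * T = b"
      using a T by (intro eq_matI) (auto simp: scalar_prod_def b_def)
    show "((1 / sqrt a) \<cdot>\<^sub>m b\<^sup>T) * (sqrt a \<cdot>\<^sub>m 1\<^sub>m 1) + T\<^sup>T * 0\<^sub>m n 1 = b\<^sup>T"
      using a T by (intro eq_matI) (auto simp: scalar_prod_def b_def)
    show "((1 / sqrt a) \<cdot>\<^sub>m b\<^sup>T) * ((1 / sqrt a) \<cdot>\<^sub>m b) + T\<^sup>T * T = D"
      unfolding T(2) S_def using a
      by (intro eq_matI) (auto simp: scalar_prod_def b_def D_def)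
  qed
  finally show ?case using U by blast
qed

text \<open>A normal form for positive definiteness with uniform bounds. It is non-strict, so the
  zero vector is no exception, and it passes to block diagonal matrices and to averages with the
  same constants.\<close>

definition form_bounds :: "real \<Rightarrow> real \<Rightarrow> nat \<Rightarrow> real mat \<Rightarrow> bool" where
  "form_bounds \<beta> b n M \<longleftrightarrow> M \<in> carrier_mat n n \<and> M\<^sup>T = M \<and>
     (\<forall>v\<in>carrier_vec n. \<beta> * sqn v \<le> qform M v \<and> qform M v \<le> b * sqn v)"

lemma form_bounds_scaled_one: "form_bounds c c n (c \<cdot>\<^sub>m 1\<^sub>m n)"
  by (simp add: form_bounds_def transpose_smult_one qform_scaled_one)

lemma cholesky_inverse:
  assumes "form_bounds \<beta> b n W" "0 < \<beta>"
  shows "\<exists>T Ti. T \<in> carrier_mat n n \<and> Ti \<in> carrier_mat n n \<and> T * Ti = 1\<^sub>m n \<and> Ti * T = 1\<^sub>m n \<and>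
    (\<forall>v\<in>carrier_vec n. sqn (T *\<^sub>v v) = qform W v)"
proof -
  have W: "W \<in> carrier_mat n n" using assms by (simp add: form_bounds_def)
  have pos: "0 < qform W v" if "v \<in> carrier_vec n" "v \<noteq> 0\<^sub>v n" for v
    using mult_pos_pos[OF assms(2) sqn_pos[OF that]] assms(1) that(1)
    by (auto simp: form_bounds_def intro: less_le_trans)
  obtain T where T: "T \<in> carrier_mat n n" "T\<^sup>T * T = W"
    using cholesky[OF W _ pos] assms(1) by (auto simp: form_bounds_def)
  have TW: "sqn (T *\<^sub>v v) = qform W v" if v: "v \<in> carrier_vec n" for v
    using T v transpose_adjoint[of "T\<^sup>T" n n v "T *\<^sub>v v"]
    by (simp add: qform_def flip: T(2))
  have "det T \<noteq> 0"
  proof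
    assume "det T = 0"
    then obtain v where v: "v \<in> carrier_vec n" "v \<noteq> 0\<^sub>v n" "T *\<^sub>v v = 0\<^sub>v n"
      using det_0_iff_vec_prod_zero_field[OF T(1)] by blast
    with TW[OF v(1)] pos[OF v(1,2)] show False by simp
  qed
  from det_non_zero_imp_unit[OF T(1) this, of "()"]
  obtain Ti where "Ti \<in> carrier_mat n n" "T * Ti = 1\<^sub>m n" "Ti * T = 1\<^sub>m n"
    unfolding Units_def by (auto simp: ring_mat_def)
  with T TW show ?thesis by blast
qed

subsection \<open>Stacked vectors and block diagonal matrices\<close>

lemma vconcat_map_carrier:
  assumes "\<forall>c\<in>set l. f c \<in> carrier_vec (n c)"
  shows "vconcat (map f l) \<in> carrier_vec (\<Sum>c\<leftarrow>l. n c)"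
  using assms by (intro vconcat_carrier) (simp add: list.rel_map list.rel_refl_strong)

lemma scalar_prod_vconcat:
  assumes "\<forall>c\<in>set l. f c \<in> carrier_vec (n c)" "\<forall>c\<in>set l. g c \<in> carrier_vec (n c)"
  shows "vconcat (map f l) \<bullet> vconcat (map g l) = (\<Sum>c\<leftarrow>l. f c \<bullet> g c)"
  using assms
proof (induction l)
  case (Cons a l)
  have "vconcat (map f l) \<in> carrier_vec (\<Sum>c\<leftarrow>l. n c)" "vconcat (map g l) \<in> carrier_vec (\<Sum>c\<leftarrow>l. n c)"
    using Cons.prems by (auto intro!: vconcat_map_carrier)
  with Cons show ?case
    by (simp add: scalar_prod_append[of "f a" "n a" _ "\<Sum>c\<leftarrow>l. n c" "g a"])
qed (simp add: scalar_prod_def)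

lemma diag_block_mat_carrier:
  assumes "\<forall>c\<in>set l. M c \<in> carrier_mat (n c) (n c)"
  shows "diag_block_mat (map M l) \<in> carrier_mat (\<Sum>c\<leftarrow>l. n c) (\<Sum>c\<leftarrow>l. n c)"
proof -
  have "map dim_row (map M l) = map n l" "map dim_col (map M l) = map n l"
    using assms by auto
  then show ?thesis by (intro carrier_matI) (simp_all only: dim_diag_block_mat)
qed

lemma diag_block_mat_mult_vconcat:
  assumes "\<forall>c\<in>set l. M c \<in> carrier_mat (n c) (n c)"
    and "\<forall>c\<in>set l. f c \<in> carrier_vec (n c)"
  shows "diag_block_mat (map M l) *\<^sub>v vconcat (map f l) = vconcat (map (\<lambda>c. M c *\<^sub>v f c) l)"
  using assms
proof (induction l)
  case (Cons a l)
  let ?N = "\<Sum>c\<leftarrow>l. n c"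
  have c: "diag_block_mat (map M l) \<in> carrier_mat ?N ?N" "vconcat (map f l) \<in> carrier_vec ?N"
    "M a \<in> carrier_mat (n a) (n a)" "f a \<in> carrier_vec (n a)"
    using Cons.prems by (auto intro!: vconcat_map_carrier diag_block_mat_carrier)
  have "diag_block_mat (map M (a # l)) =
    four_block_mat (M a) (0\<^sub>m (n a) ?N) (0\<^sub>m ?N (n a)) (diag_block_mat (map M l))"
    using carrier_matD[OF c(1)] carrier_matD[OF c(3)] by (simp add: Let_def)
  then have "diag_block_mat (map M (a # l)) *\<^sub>v vconcat (map f (a # l)) =
    M a *\<^sub>v f a @\<^sub>v diag_block_mat (map M l) *\<^sub>v vconcat (map f l)"
    using mult_mat_vec_split[OF c(3,1,4,2)] by (simp only: list.map vconcat_simps)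
  also have "diag_block_mat (map M l) *\<^sub>v vconcat (map f l) = vconcat (map (\<lambda>c. M c *\<^sub>v f c) l)"
    using Cons.prems by (intro Cons.IH) auto
  finally show ?case by (simp only: list.map vconcat_simps)
qed (auto intro!: eq_vecI)

text \<open>Turns a stacked vector back into a family over the items, so that statements about block
  matrices can be checked item by item. Distinctness makes the blocks a function of the
  item.\<close>

lemma vconcat_decompose:
  assumes "v \<in> carrier_vec (\<Sum>c\<leftarrow>l. n c)" "distinct l"
  obtains f where "\<forall>c\<in>set l. f c \<in> carrier_vec (n c)" "v = vconcat (map f l)"
proof -
  obtain vs where vs: "list_all2 (\<lambda>v n. v \<in> carrier_vec n) vs (map n l)" "vconcat vs = v"
    using vconcat_split[OF assms(1)] by blast
  obtain f where f: "map f l = vs"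
    using distinct_map_choice[OF assms(2), of vs] list_all2_lengthD[OF vs(1)] by auto
  have "f c \<in> carrier_vec (n c)" if "c \<in> set l" for c
  proof -
    from that have "\<exists>i<length l. l ! i = c" by (simp add: in_set_conv_nth)
    then obtain i where "i < length l" "l ! i = c" by blast
    with list_all2_nthD2[OF vs(1), of i] show ?thesis by (simp add: f[symmetric])
  qed
  with that f vs(2) show thesis by blast
qed

lemma qform_diag_block_mat:
  assumes "\<forall>c\<in>set l. M c \<in> carrier_mat (n c) (n c)"
    and "\<forall>c\<in>set l. f c \<in> carrier_vec (n c)"
  shows "qform (diag_block_mat (map M l)) (vconcat (map f l)) = (\<Sum>c\<leftarrow>l. qform (M c) (f c))"
proof -
  have "qform (diag_block_mat (map M l)) (vconcat (map f l)) =
    vconcat (map f l) \<bullet> vconcat (map (\<lambda>c. M c *\<^sub>v f c) l)"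
    unfolding qform_def using diag_block_mat_mult_vconcat[OF assms] by simp
  also have "\<dots> = (\<Sum>c\<leftarrow>l. f c \<bullet> (M c *\<^sub>v f c))"
    by (rule scalar_prod_vconcat) (use assms in \<open>auto intro: mult_mat_vec_carrier\<close>)
  finally show ?thesis by (simp only: qform_def)
qed

lemma transpose_diag_block_mat:
  "(diag_block_mat Ms)\<^sup>T = diag_block_mat (map transpose_mat Ms)"
proof (induction Ms)
  case (Cons M Ms)
  then show ?case
    by (simp add: Let_def transpose_four_block_mat[OF carrier_matI[OF refl refl]
          zero_carrier_mat zero_carrier_mat carrier_matI[OF refl refl]] flip: Cons)
qed (auto intro: eq_matI)

lemma transpose_diag_block_mat_id:
  "(\<forall>c\<in>set l. (M c)\<^sup>T = M c) \<Longrightarrow> (diag_block_mat (map M l))\<^sup>T = diag_block_mat (map M l)"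
  by (simp add: transpose_diag_block_mat cong: map_cong)

lemma diag_block_mat_one: "diag_block_mat (map (\<lambda>c. 1\<^sub>m (n c)) l) = 1\<^sub>m (\<Sum>c\<leftarrow>l. n c)"
  by (induction l) (auto simp: Let_def)

text \<open>Formulated on vectors, where a block diagonal matrix acts item by item and no product of
  block matrices has to be computed.\<close>

lemma diag_block_mat_inverse:
  assumes M: "\<forall>c\<in>set l. M c \<in> carrier_mat (n c) (n c)"
    and N: "\<forall>c\<in>set l. N c \<in> carrier_mat (n c) (n c)"
    and e: "\<forall>c\<in>set l. M c * N c = 1\<^sub>m (n c)" and l: "distinct l"
    and v: "v \<in> carrier_vec (\<Sum>c\<leftarrow>l. n c)"
  shows "diag_block_mat (map M l) *\<^sub>v (diag_block_mat (map N l) *\<^sub>v v) = (v :: real vec)"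
proof -
  obtain f where f: "\<forall>c\<in>set l. f c \<in> carrier_vec (n c)" "v = vconcat (map f l)"
    using vconcat_decompose[OF v l] by blast
  have "M c *\<^sub>v (N c *\<^sub>v f c) = f c" if "c \<in> set l" for c
    using that assoc_mult_mat_vec[of "M c" "n c" "n c" "N c" "n c" "f c"] M N e f(1) by simp
  moreover have "\<forall>c\<in>set l. N c *\<^sub>v f c \<in> carrier_vec (n c)"
    using N f(1) by (auto intro: mult_mat_vec_carrier)
  ultimately show ?thesis
    unfolding f(2) using diag_block_mat_mult_vconcat[OF N f(1)]
      diag_block_mat_mult_vconcat[OF M, of "\<lambda>c. N c *\<^sub>v f c"] by (simp cong: map_cong)
qed

subsection \<open>Diagonal matrices\<close>

lemma diagonal_transpose:
  "diagonal_mat S \<Longrightarrow> S \<in> carrier_mat n n \<Longrightarrow> S\<^sup>T = (S :: real mat)"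
  unfolding diagonal_mat_def by (rule eq_matI) (auto, metis)

lemma diagonal_mult_vec:
  assumes "diagonal_mat S" "S \<in> carrier_mat n n" "v \<in> carrier_vec n" "i < n"
  shows "(S *\<^sub>v v) $ i = S $$ (i, i) * (v $ i :: real)"
proof -
  have "(S *\<^sub>v v) $ i = (\<Sum>j<n. S $$ (i, j) * v $ j)"
    using assms(2-4) by (simp add: scalar_prod_def lessThan_atLeast0)
  also have "\<dots> = (\<Sum>j<n. if j = i then S $$ (i, i) * v $ i else 0)"
    using assms by (intro sum.cong) (auto simp: diagonal_mat_def)
  finally show ?thesis using assms(4) by simp
qed

lemma qform_diagonal:
  assumes "diagonal_mat S" "S \<in> carrier_mat n n" "v \<in> carrier_vec n"
  shows "qform S v = (\<Sum>i<n. S $$ (i, i) * (v $ i)\<^sup>2)"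
  using assms diagonal_mult_vec[OF assms]
  by (auto simp: qform_def scalar_prod_def lessThan_atLeast0 power2_eq_square intro!: sum.cong)

lemma diagonal_four_block_mat:
  assumes "A \<in> carrier_mat m m" "D \<in> carrier_mat n n" "diagonal_mat A" "diagonal_mat D"
  shows "diagonal_mat (four_block_mat A (0\<^sub>m m n) (0\<^sub>m n m) D)"
  using assms unfolding diagonal_mat_def by auto

lemma diagonal_diag_block_mat:
  assumes "\<forall>c\<in>set l. M c \<in> carrier_mat (n c) (n c)"
    and "\<forall>c\<in>set l. diagonal_mat (M c)"
  shows "diagonal_mat (diag_block_mat (map M l))"
  using assms
proof (induction l)
  case (Cons a l)
  have c: "diag_block_mat (map M l) \<in> carrier_mat (\<Sum>c\<leftarrow>l. n c) (\<Sum>c\<leftarrow>l. n c)"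
    using Cons.prems by (intro diag_block_mat_carrier) simp
  have a: "M a \<in> carrier_mat (n a) (n a)" "diagonal_mat (M a)" using Cons.prems by simp_all
  have d: "diagonal_mat (diag_block_mat (map M l))"
    by (rule Cons.IH) (use Cons.prems in simp_all)
  show ?case
    using diagonal_four_block_mat[OF a(1) c a(2) d]
    by (simp only: list.map diag_block_mat.simps Let_def carrier_matD[OF c] carrier_matD[OF a(1)])
qed (simp add: diagonal_mat_def)

lemma diag_mat_diag_block_mat:
  assumes "\<forall>M\<in>set Ms. square_mat M"
  shows "diag_mat (diag_block_mat Ms) = concat (map diag_mat Ms)"
  using assms
proof (induction Ms)
  case (Cons M Ms)
  have "square_mat (diag_block_mat Ms)"
    by (rule diag_block_mat_square) (use Cons.prems in simp)
  then have c: "diag_block_mat Ms \<in> carrier_mat (dim_row (diag_block_mat Ms)) (dim_row (diag_block_mat Ms))"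
    by (intro carrier_matI) simp_all
  have a: "M \<in> carrier_mat (dim_row M) (dim_row M)"
    using Cons.prems by (intro carrier_matI) simp_all
  have "diag_mat (diag_block_mat Ms) = concat (map diag_mat Ms)"
    by (rule Cons.IH) (use Cons.prems in simp)
  then show ?case
    unfolding diag_block_mat.simps Let_def diag_four_block_mat[OF a c] by simp
qed (simp add: diag_mat_def)

lemma diag_mat_nth: "i < dim_row M \<Longrightarrow> M $$ (i, i) = diag_mat M ! i"
  by (simp add: diag_mat_def)

lemma set_diag_mat: "set (diag_mat M) = (\<lambda>i. M $$ (i, i)) ` {..<dim_row M}"
  by (auto simp: diag_mat_def)

subsection \<open>Submatrices as compressions\<close>

text \<open>Together with its adjoint \<open>emb\<close>, which spreads the entries out again and
  fills with zeros, this presents \<open>submatrix\<close> as a compression: embed, multiply,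
  select.\<close>

definition sel :: "nat set \<Rightarrow> real vec \<Rightarrow> real vec" where
  "sel C v = vec (card {i. i < dim_vec v \<and> i \<in> C}) (\<lambda>j. v $ pick C j)"

text \<open>\<open>card {a \<in> C. a < i}\<close> is the rank of \<open>i\<close> in
  \<open>C\<close>, the inverse of \<open>pick C\<close>.\<close>

definition emb :: "nat set \<Rightarrow> nat \<Rightarrow> real vec \<Rightarrow> real vec" where
  "emb C n z = vec n (\<lambda>i. if i \<in> C then z $ card {a \<in> C. a < i} else 0)"

lemma dim_sel [simp]: "dim_vec (sel C v) = card {i. i < dim_vec v \<and> i \<in> C}"
  by (simp add: sel_def)

lemma dim_emb [simp]: "dim_vec (emb C n z) = n"
  by (simp add: emb_def)

lemma emb_carrier [simp]: "emb C n z \<in> carrier_vec n"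
  by (rule carrier_vecI) simp

lemma pick_bounded:
  assumes "j < card {i. i < n \<and> i \<in> C}"
  shows "pick C j \<in> C" "pick C j < n" "card {a \<in> C. a < pick C j} = j"
proof -
  \<comment> \<open>An infinite \<open>C\<close>, in particular \<open>UNIV\<close>, has
    \<open>card C = 0\<close> and is therefore a case of its own.\<close>
  have "j < card C \<or> infinite C"
    using assms card_mono[of C "{i. i < n \<and> i \<in> C}"] by fastforce
  then show "pick C j \<in> C" "card {a \<in> C. a < pick C j} = j"
    using pick_in_set card_pick by blast+
  show "pick C j < n" by (rule pick_le[OF assms])
qed

lemma card_below_less:
  assumes "i < (n :: nat)" "i \<in> C"
  shows "card {a \<in> C. a < i} < card {i. i < n \<and> i \<in> C}"
proof (rule psubset_card_mono)
  have "i \<in> {i. i < n \<and> i \<in> C}" "i \<notin> {a \<in> C. a < i}" using assms by simp_all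
  moreover have "{a \<in> C. a < i} \<subseteq> {i. i < n \<and> i \<in> C}" using assms(1) by auto
  ultimately show "{a \<in> C. a < i} \<subset> {i. i < n \<and> i \<in> C}" by (metis psubsetI)
qed simp

lemma sum_pick:
  fixes f :: "nat \<Rightarrow> nat \<Rightarrow> real"
  shows "(\<Sum>j<card {i. i < n \<and> i \<in> C}. f (pick C j) j) =
    (\<Sum>i<n. if i \<in> C then f i (card {a \<in> C. a < i}) else 0)"
proof -
  have "(\<Sum>j<card {i. i < n \<and> i \<in> C}. f (pick C j) j) =
    (\<Sum>i | i < n \<and> i \<in> C. f i (card {a \<in> C. a < i}))"
    by (rule sum.reindex_bij_witness[where i = "\<lambda>i. card {a \<in> C. a < i}" and j = "pick C"])
      (auto simp: pick_bounded pick_card_in_set card_below_less)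
  also have "\<dots> = (\<Sum>i<n. if i \<in> C then f i (card {a \<in> C. a < i}) else 0)"
    by (rule sum.mono_neutral_cong_left) auto
  finally show ?thesis .
qed

lemma sel_emb_adjoint:
  assumes "dim_vec v = n" "dim_vec z = card {i. i < n \<and> i \<in> C}"
  shows "sel C v \<bullet> z = v \<bullet> emb C n z"
proof -
  have "sel C v \<bullet> z = (\<Sum>j<card {i. i < n \<and> i \<in> C}. v $ pick C j * z $ j)"
    using assms by (simp add: scalar_prod_def sel_def lessThan_atLeast0)
  also have "\<dots> = (\<Sum>i<n. if i \<in> C then v $ i * z $ card {a \<in> C. a < i} else 0)"
    by (rule sum_pick)
  also have "\<dots> = v \<bullet> emb C n z"
    by (auto simp: scalar_prod_def emb_def lessThan_atLeast0 intro!: sum.cong)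
  finally show ?thesis .
qed

lemma sel_emb:
  assumes "dim_vec z = card {i. i < n \<and> i \<in> C}"
  shows "sel C (emb C n z) = z"
  using assms by (intro eq_vecI) (auto simp: sel_def emb_def pick_bounded)

lemma sqn_emb:
  assumes "dim_vec z = card {i. i < n \<and> i \<in> C}"
  shows "sqn (emb C n z) = sqn z"
  using sel_emb_adjoint[of "emb C n z" n z C] sel_emb[OF assms] assms by simp

lemma emb_sel: "i < dim_vec v \<Longrightarrow> emb C (dim_vec v) (sel C v) $ i = (if i \<in> C then v $ i else 0)"
  by (auto simp: emb_def sel_def card_below_less pick_card_in_set)

lemma sqn_sel_le: "sqn (sel C v) \<le> sqn v"
proof -
  have "sqn (sel C v) = sqn (emb C (dim_vec v) (sel C v))"
    by (rule sqn_emb[symmetric]) simp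
  also have "\<dots> = (\<Sum>i<dim_vec v. (if i \<in> C then v $ i else 0)\<^sup>2)"
    unfolding sqn_sum by (intro sum.cong) (simp_all add: emb_sel)
  also have "\<dots> \<le> sqn v" unfolding sqn_sum by (intro sum_mono) auto
  finally show ?thesis .
qed

lemma submatrix_mult_vec:
  assumes "dim_vec z = card {j. j < dim_col A \<and> j \<in> C}"
  shows "submatrix A R C *\<^sub>v z = sel R (A *\<^sub>v emb C (dim_col A) z)"
proof (rule eq_vecI)
  fix i assume "i < dim_vec (sel R (A *\<^sub>v emb C (dim_col A) z))"
  then have i: "i < card {i. i < dim_row A \<and> i \<in> R}" by simp
  have "(submatrix A R C *\<^sub>v z) $ i =
    (\<Sum>j<card {j. j < dim_col A \<and> j \<in> C}. A $$ (pick R i, pick C j) * z $ j)"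
    using i assms by (simp add: dim_submatrix scalar_prod_def submatrix_index lessThan_atLeast0)
  also have "\<dots> = (\<Sum>j<dim_col A. if j \<in> C then A $$ (pick R i, j) * z $ card {a \<in> C. a < j} else 0)"
    by (rule sum_pick)
  also have "\<dots> = sel R (A *\<^sub>v emb C (dim_col A) z) $ i"
    using i pick_bounded[OF i]
    by (auto simp: sel_def scalar_prod_def emb_def lessThan_atLeast0 intro!: sum.cong)
  finally show "(submatrix A R C *\<^sub>v z) $ i = sel R (A *\<^sub>v emb C (dim_col A) z) $ i" .
qed (simp add: dim_submatrix)

lemma transpose_submatrix: "(submatrix A R C)\<^sup>T = submatrix A\<^sup>T C R"
  by (intro eq_matI) (auto simp: dim_submatrix submatrix_index pick_bounded)

lemma sel_UNIV [simp]: "sel UNIV v = v"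
  by (intro eq_vecI) (auto simp: sel_def pick_UNIV)

lemma emb_UNIV: "dim_vec z = n \<Longrightarrow> emb UNIV n z = z"
  by (intro eq_vecI) (auto simp: emb_def)

section \<open>Zero padding and the leading entries of stacked blocks\<close>

definition pad :: "nat \<Rightarrow> real vec \<Rightarrow> real vec" where
  "pad n z = z @\<^sub>v 0\<^sub>v (n - dim_vec z)"

lemma pad_carrier: "dim_vec z \<le> n \<Longrightarrow> pad n z \<in> carrier_vec n"
  by (rule carrier_vecI) (simp add: pad_def)

text \<open>All kept indices of the first block lie below \<open>r \<le> n \<le> i\<close>, so the
  condition \<open>a < i\<close> restricts only the shifted remainder.\<close>

lemma kept_Cons_below:
  assumes "r \<le> n" "n \<le> i"
  shows "{a \<in> kept ((n, r) # bs). a < i} = {..<r} \<union> (+) n ` {a \<in> kept bs. a < i - n}"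
  using assms by auto

lemma card_kept_Cons_below:
  assumes "r \<le> n" "n \<le> i"
  shows "card {a \<in> kept ((n, r) # bs). a < i} = r + card {a \<in> kept bs. a < i - n}"
  unfolding kept_Cons_below[OF assms] using assms
  by (subst card_Un_disjoint) (auto simp: card_image)

lemma card_kept:
  assumes "\<forall>c\<in>set l. r c \<le> n c"
  shows "card {i. i < (\<Sum>c\<leftarrow>l. n c) \<and> i \<in> kept (map (\<lambda>c. (n c, r c)) l)} = (\<Sum>c\<leftarrow>l. r c)"
  using assms
proof (induction l)
  case (Cons a l)
  have "{i. i < (\<Sum>c\<leftarrow>a # l. n c) \<and> i \<in> kept (map (\<lambda>c. (n c, r c)) (a # l))} =
    {i \<in> kept (map (\<lambda>c. (n c, r c)) (a # l)). i < (\<Sum>c\<leftarrow>a # l. n c)}" by blast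
  with Cons card_kept_Cons_below[of "r a" "n a" "\<Sum>c\<leftarrow>a # l. n c" "map (\<lambda>c. (n c, r c)) l"]
  show ?case by (simp add: conj_commute)
qed simp

text \<open>Identifies the index set of the truncation with zero padding of each block, which is how
  a reduced state is compared with a full one.\<close>

lemma emb_kept_vconcat:
  assumes "\<forall>c\<in>set l. r c \<le> n c" "\<forall>c\<in>set l. z c \<in> carrier_vec (r c)"
  shows "emb (kept (map (\<lambda>c. (n c, r c)) l)) (\<Sum>c\<leftarrow>l. n c) (vconcat (map z l)) =
    vconcat (map (\<lambda>c. pad (n c) (z c)) l)"
  using assms
proof (induction l)
  case (Cons a l)
  let ?K = "kept (map (\<lambda>c. (n c, r c)) l)" and ?N = "\<Sum>c\<leftarrow>l. n c" and ?w = "vconcat (map z l)"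
  have ra: "r a \<le> n a" and za: "dim_vec (z a) = r a" using Cons.prems by auto
  have "emb (kept ((n a, r a) # map (\<lambda>c. (n c, r c)) l)) (n a + ?N) (z a @\<^sub>v ?w) =
    pad (n a) (z a) @\<^sub>v emb ?K ?N ?w"
  proof (rule eq_vecI)
    fix i assume i: "i < dim_vec (pad (n a) (z a) @\<^sub>v emb ?K ?N ?w)"
    then have iN: "i < n a + ?N" using ra za by (simp add: pad_def)
    show "emb (kept ((n a, r a) # map (\<lambda>c. (n c, r c)) l)) (n a + ?N) (z a @\<^sub>v ?w) $ i =
      (pad (n a) (z a) @\<^sub>v emb ?K ?N ?w) $ i"
    proof (cases "i < n a")
      case True
      have "i < r a \<Longrightarrow> {x \<in> kept ((n a, r a) # map (\<lambda>c. (n c, r c)) l). x < i} = {..<i}"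
        using True by auto
      moreover have "i \<in> kept ((n a, r a) # map (\<lambda>c. (n c, r c)) l) \<longleftrightarrow> i < r a"
        using True by auto
      ultimately show ?thesis using True iN ra za
        by (simp add: emb_def pad_def del: kept.simps)
    next
      case False
      have "dim_vec ?w = (\<Sum>c\<leftarrow>l. r c)"
        using Cons.prems by (intro carrier_vecD vconcat_map_carrier) auto
      moreover have "i \<in> kept ((n a, r a) # map (\<lambda>c. (n c, r c)) l) \<longleftrightarrow> i - n a \<in> ?K"
        using False ra by (auto intro!: image_eqI[of _ _ "i - n a"])
      moreover have "i - n a \<in> ?K \<Longrightarrow> card {x \<in> ?K. x < i - n a} < (\<Sum>c\<leftarrow>l. r c)"
        using card_below_less[of "i - n a" ?N ?K] card_kept[of l r n] iN False Cons.prems by auto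
      ultimately show ?thesis
        using False iN ra za card_kept_Cons_below[OF ra, of i]
        by (simp add: emb_def pad_def del: kept.simps)
    qed
  qed (use ra za in \<open>simp add: pad_def\<close>)
  with Cons show ?case by (simp del: kept.simps)
qed (auto simp: emb_def)

subsection \<open>Items of a graph\<close>

text \<open>Temporal and spatial states are treated uniformly: \<open>Inl k\<close> stands for the temporal state of
  node \<open>k\<close> and \<open>Inr e\<close> for the spatial state of edge \<open>e\<close>, so that a pair of families \<open>X\<close>, \<open>Y\<close>
  becomes \<open>case_sum X Y\<close>.\<close>

type_synonym item = "nat + nat \<times> nat"

definition in_items :: "dsys \<Rightarrow> nat \<Rightarrow> item list" where
  "in_items G k = Inl k # map (\<lambda>i. Inr (i, k)) (E_in G k)"

definition out_items :: "dsys \<Rightarrow> nat \<Rightarrow> item list" where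
  "out_items G k = Inl k # map (\<lambda>j. Inr (k, j)) (E_out G k)"

definition items :: "dsys \<Rightarrow> item set" where
  "items G = Inl ` nodes G \<union> Inr ` edges G"

definition dims :: "dsys \<Rightarrow> item \<Rightarrow> nat \<Rightarrow> nat" where
  "dims G = case_sum (tdim G) (sdim G)"

abbreviation ldim :: "dsys \<Rightarrow> item list \<Rightarrow> nat \<Rightarrow> nat" where
  "ldim G l t \<equiv> \<Sum>c\<leftarrow>l. dims G c t"

abbreviation bdiag :: "(item \<Rightarrow> nat \<Rightarrow> real mat) \<Rightarrow> item list \<Rightarrow> nat \<Rightarrow> real mat" where
  "bdiag Z l t \<equiv> diag_block_mat (map (\<lambda>c. Z c t) l)"

abbreviation idim :: "dsys \<Rightarrow> nat \<Rightarrow> nat \<Rightarrow> nat" where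
  "idim G k t \<equiv> ldim G (in_items G k) t"

text \<open>The rows of \<open>Amat G k t\<close> belong to the states at time \<open>t + 1\<close>.
  This shift is built into \<open>odim\<close> and \<open>obdiag\<close>, but not into
  \<open>ldim\<close>, \<open>bdiag\<close> and \<open>stack\<close>.\<close>

abbreviation odim :: "dsys \<Rightarrow> nat \<Rightarrow> nat \<Rightarrow> nat" where
  "odim G k t \<equiv> ldim G (out_items G k) (t + 1)"

abbreviation ibdiag :: "(item \<Rightarrow> nat \<Rightarrow> real mat) \<Rightarrow> dsys \<Rightarrow> nat \<Rightarrow> nat \<Rightarrow> real mat" where
  "ibdiag Z G k t \<equiv> bdiag Z (in_items G k) t"

abbreviation obdiag :: "(item \<Rightarrow> nat \<Rightarrow> real mat) \<Rightarrow> dsys \<Rightarrow> nat \<Rightarrow> nat \<Rightarrow> real mat" where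
  "obdiag Z G k t \<equiv> bdiag Z (out_items G k) (t + 1)"

abbreviation stack :: "(item \<Rightarrow> nat \<Rightarrow> real vec) \<Rightarrow> item list \<Rightarrow> nat \<Rightarrow> real vec" where
  "stack Z l t \<equiv> vconcat (map (\<lambda>c. Z c t) l)"

lemma ins_eq: "ins G X Y k t = map (\<lambda>c. case_sum X Y c t) (in_items G k)"
  by (simp add: ins_def in_items_def)

lemma outs_eq: "outs G X Y k t = map (\<lambda>c. case_sum X Y c t) (out_items G k)"
  by (simp add: outs_def out_items_def)

lemma in_dim_eq: "in_dim G k t = idim G k t"
  by (simp add: in_dim_def ins_eq dims_def)

lemma out_dim_eq: "out_dim G k t = ldim G (out_items G k) t"
  by (simp add: out_dim_def outs_eq dims_def)

lemma in_diag_eq: "in_diag G X Y k t = ibdiag (case_sum X Y) G k t"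
  by (simp add: in_diag_def ins_eq)

lemma out_diag_eq: "out_diag G X Y k t = bdiag (case_sum X Y) (out_items G k) t"
  by (simp add: out_diag_def outs_eq)

lemma case_sum_Inl_Inr [simp]: "case_sum (\<lambda>k. Z (Inl k)) (\<lambda>e. Z (Inr e)) = Z"
  by (rule ext) (simp split: sum.split)

lemma items_ball: "(\<forall>c\<in>items G. P c) \<longleftrightarrow> (\<forall>k\<in>nodes G. P (Inl k)) \<and> (\<forall>e\<in>edges G. P (Inr e))"
  by (auto simp: items_def)

lemma items_cong:
  assumes "nnodes H = nnodes G" "edges H = edges G"
  shows "in_items H k = in_items G k" "out_items H k = out_items G k" "items H = items G"
  using assms by (simp_all add: in_items_def out_items_def items_def E_in_def E_out_def)

context
  fixes G :: dsys
  assumes G: "distributed_system G"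
begin

lemma set_in_items: "set (in_items G k) = insert (Inl k) (Inr ` {e \<in> edges G. snd e = k})"
  by (force simp: in_items_def set_E_in[OF G])

lemma set_out_items: "set (out_items G k) = insert (Inl k) (Inr ` {e \<in> edges G. fst e = k})"
  by (force simp: out_items_def set_E_out[OF G])

lemma distinct_in_items: "distinct (in_items G k)"
  by (auto simp: in_items_def distinct_map E_in_def intro!: inj_onI)

lemma distinct_out_items: "distinct (out_items G k)"
  by (auto simp: out_items_def distinct_map E_out_def intro!: inj_onI)

lemma in_items_subset: "k \<in> nodes G \<Longrightarrow> set (in_items G k) \<subseteq> items G"
  by (auto simp: set_in_items items_def)

lemma out_items_subset: "k \<in> nodes G \<Longrightarrow> set (out_items G k) \<subseteq> items G"
  by (auto simp: set_out_items items_def)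

lemma finite_edges: "finite (edges G)"
  using edges_subset[OF G] by (rule finite_subset) simp

text \<open>Every edge enters exactly one node and leaves exactly one node.\<close>

lemma sum_in_items: "(\<Sum>k\<in>nodes G. \<Sum>c\<leftarrow>in_items G k. f c) = (\<Sum>c\<in>items G. f c :: real)"
proof -
  have "(\<Sum>k\<in>nodes G. \<Sum>c\<leftarrow>in_items G k. f c) = (\<Sum>k\<in>nodes G. \<Sum>c\<in>set (in_items G k). f c)"
    by (simp add: sum_list_distinct_conv_sum_set[OF distinct_in_items])
  also have "\<dots> = (\<Sum>c\<in>(\<Union>k\<in>nodes G. set (in_items G k)). f c)"
    by (rule sum.UNION_disjoint[symmetric]) (auto simp: set_in_items finite_edges)
  also have "(\<Union>k\<in>nodes G. set (in_items G k)) = items G"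
    using edges_subset[OF G] by (auto simp: set_in_items items_def)
  finally show ?thesis .
qed

lemma sum_out_items: "(\<Sum>k\<in>nodes G. \<Sum>c\<leftarrow>out_items G k. f c) = (\<Sum>c\<in>items G. f c :: real)"
proof -
  have "(\<Sum>k\<in>nodes G. \<Sum>c\<leftarrow>out_items G k. f c) = (\<Sum>k\<in>nodes G. \<Sum>c\<in>set (out_items G k). f c)"
    by (simp add: sum_list_distinct_conv_sum_set[OF distinct_out_items])
  also have "\<dots> = (\<Sum>c\<in>(\<Union>k\<in>nodes G. set (out_items G k)). f c)"
    by (rule sum.UNION_disjoint[symmetric]) (auto simp: set_out_items finite_edges)
  also have "(\<Union>k\<in>nodes G. set (out_items G k)) = items G"
    using edges_subset[OF G] by (auto simp: set_out_items items_def)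
  finally show ?thesis .
qed

lemma Amat_carrier: "k \<in> nodes G \<Longrightarrow>
    Amat G k t \<in> carrier_mat (odim G k t) (idim G k t)"
  and Bmat_carrier: "k \<in> nodes G \<Longrightarrow>
    Bmat G k t \<in> carrier_mat (odim G k t) (udim G k t)"
  and Cmat_carrier: "k \<in> nodes G \<Longrightarrow>
    Cmat G k t \<in> carrier_mat (ydim G k t) (idim G k t)"
  and Dmat_carrier: "k \<in> nodes G \<Longrightarrow> Dmat G k t \<in> carrier_mat (ydim G k t) (udim G k t)"
  using G by (simp_all add: distributed_system_def in_dim_eq out_dim_eq)

end

lemma unif_bounded_items:
  "unif_bounded (items G) (case_sum W Ws) \<longleftrightarrow> unif_bounded (nodes G) W \<and> unif_bounded (edges G) Ws"
proof
  assume *: "unif_bounded (nodes G) W \<and> unif_bounded (edges G) Ws"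
  obtain b where b: "b > 0" "\<And>i t. i \<in> nodes G \<Longrightarrow> sq_bounded b (W i t)"
    using unif_boundedE[OF conjunct1[OF *]] by blast
  obtain b' where b': "b' > 0" "\<And>i t. i \<in> edges G \<Longrightarrow> sq_bounded b' (Ws i t)"
    using unif_boundedE[OF conjunct2[OF *]] by blast
  have "\<forall>c\<in>items G. \<forall>t. sq_bounded (b + b') (case_sum W Ws c t)"
    unfolding items_ball
    using sq_bounded_mono[OF b(2), of _ "b + b'"] sq_bounded_mono[OF b'(2), of _ "b + b'"] b(1) b'(1)
    by simp
  then show "unif_bounded (items G) (case_sum W Ws)" by (intro unif_boundedI) blast
next
  assume "unif_bounded (items G) (case_sum W Ws)"
  then obtain b where "\<forall>c\<in>items G. \<forall>t. op_bounded b (case_sum W Ws c t)"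
    unfolding unif_bounded_def by blast
  then show "unif_bounded (nodes G) W \<and> unif_bounded (edges G) Ws"
    unfolding items_ball unif_bounded_def by auto
qed

lemma gramian_family_iff:
  "gramian_family G \<beta> W Ws \<longleftrightarrow>
    (\<forall>c\<in>items G. \<forall>t. case_sum W Ws c t \<in> carrier_mat (dims G c t) (dims G c t) \<and>
       mat_gt (case_sum W Ws c t) \<beta>) \<and> unif_bounded (items G) (case_sum W Ws)"
  unfolding gramian_family_def items_ball unif_bounded_items by (auto simp: dims_def)

lemma form_bounds_bdiag:
  assumes "\<forall>c\<in>set l. form_bounds \<beta> b (n c) (M c)" "distinct l"
  shows "form_bounds \<beta> b (\<Sum>c\<leftarrow>l. n c) (diag_block_mat (map M l))"
proof -
  have M: "\<forall>c\<in>set l. M c \<in> carrier_mat (n c) (n c)" and "\<And>c. c \<in> set l \<Longrightarrow> (M c)\<^sup>T = M c"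
    using assms(1) by (auto simp: form_bounds_def)
  moreover have "\<beta> * sqn v \<le> qform (diag_block_mat (map M l)) v \<and>
      qform (diag_block_mat (map M l)) v \<le> b * sqn v"
    if v: "v \<in> carrier_vec (\<Sum>c\<leftarrow>l. n c)" for v
  proof -
    obtain f where f: "\<forall>c\<in>set l. f c \<in> carrier_vec (n c)" "v = vconcat (map f l)"
      using vconcat_decompose[OF v assms(2)] by blast
    have "(\<Sum>c\<leftarrow>l. \<beta> * sqn (f c)) \<le> (\<Sum>c\<leftarrow>l. qform (M c) (f c))"
      "(\<Sum>c\<leftarrow>l. qform (M c) (f c)) \<le> (\<Sum>c\<leftarrow>l. b * sqn (f c))"
      using assms(1) f(1) by (auto simp: form_bounds_def intro!: sum_list_mono)
    then show ?thesis
      unfolding f(2) qform_diag_block_mat[OF M f(1)] scalar_prod_vconcat[OF f(1) f(1)]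
      by (simp add: sum_list_const_mult)
  qed
  ultimately show ?thesis
    unfolding form_bounds_def using diag_block_mat_carrier[OF M] transpose_diag_block_mat_id[of l M]
    by blast
qed

lemma gramian_family_form_bounds:
  assumes "gramian_family G \<beta> W Ws"
  obtains b where "b > 0" "\<And>c t. c \<in> items G \<Longrightarrow> form_bounds \<beta> b (dims G c t) (case_sum W Ws c t)"
proof -
  obtain b where b: "b > 0" "\<And>c t. c \<in> items G \<Longrightarrow> sq_bounded b (case_sum W Ws c t)"
    using assms unif_boundedE unfolding gramian_family_iff by metis
  have "form_bounds \<beta> (b + 1) (dims G c t) (case_sum W Ws c t)" if c: "c \<in> items G" for c t
  proof -
    have W: "case_sum W Ws c t \<in> carrier_mat (dims G c t) (dims G c t)"
      and gt: "mat_gt (case_sum W Ws c t) \<beta>"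
      using assms c unfolding gramian_family_iff by blast+
    have "\<beta> * sqn v \<le> qform (case_sum W Ws c t) v" if "v \<in> carrier_vec (dims G c t)" for v
      using gt that W unfolding mat_gt_iff[OF W]
      by (cases "v = 0\<^sub>v (dims G c t)") (auto intro: less_imp_le)
    then show ?thesis
      using W gt qform_le_sq_bounded[OF W b(2)[OF c] b(1)] unfolding form_bounds_def mat_gt_iff[OF W]
      by blast
  qed
  with b(1) that[of "b + 1"] show thesis by simp
qed

subsection \<open>Eventually periodic sequences\<close>

lemma etp_shift: "etp h q M \<Longrightarrow> h \<le> t \<Longrightarrow> M (t + z * q) = M t"
  unfolding etp_def by (metis le_add_diff_inverse2)

lemma etpI: "(\<And>t z. h \<le> t \<Longrightarrow> M (t + z * q) = M t) \<Longrightarrow> etp h q M"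
  by (simp add: etp_def)

lemma etp_Suc: "etp h q M \<Longrightarrow> etp h q (\<lambda>t. M (t + 1))"
  by (rule etpI) (metis add.assoc add.commute etp_shift trans_le_add1)

lemma etp_comp: "etp h q M \<Longrightarrow> etp h q (\<lambda>t. f (M t))"
  by (simp add: etp_def)

lemma etp_comp2: "etp h q M \<Longrightarrow> etp h q N \<Longrightarrow> etp h q (\<lambda>t. f (M t) (N t))"
  by (simp add: etp_def)

lemma etp_map: "\<forall>c\<in>set l. etp h q (Z c) \<Longrightarrow> etp h q (\<lambda>t. map (\<lambda>c. Z c t) l)"
  by (simp add: etp_def)

lemma etp_reduce: "etp h q M \<Longrightarrow> h \<le> t \<Longrightarrow> M t = M (h + (t - h) mod q)"
  using etp_shift[of h q M "h + (t - h) mod q" "(t - h) div q"] by (simp add: add.assoc)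

lemma etp_family_iff: "etp_family h q G X Y \<longleftrightarrow> (\<forall>c\<in>items G. etp h q (case_sum X Y c))"
  unfolding etp_family_def items_ball by simp

subsection \<open>A periodic Lyapunov function\<close>

definition avg_mat :: "nat \<Rightarrow> nat \<Rightarrow> (nat \<Rightarrow> real mat) \<Rightarrow> real mat" where
  "avg_mat Z n M = mat n n (\<lambda>(i, j). (\<Sum>z<Z. M z $$ (i, j)) / real Z)"

lemma avg_mat_carrier [simp]: "avg_mat Z n M \<in> carrier_mat n n"
  by (simp add: avg_mat_def)

lemma qform_sum:
  assumes "M \<in> carrier_mat n n" "v \<in> carrier_vec n"
  shows "qform M v = (\<Sum>i<n. \<Sum>j<n. v $ i * v $ j * M $$ (i, j))"
  using assms by (auto simp: qform_def scalar_prod_def lessThan_atLeast0 sum_distrib_left algebra_simps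
      intro!: sum.cong)

lemma qform_avg_mat:
  assumes "\<And>z. M z \<in> carrier_mat n n" "v \<in> carrier_vec n"
  shows "qform (avg_mat Z n M) v = (\<Sum>z<Z. qform (M z) v) / real Z"
proof -
  have "qform (avg_mat Z n M) v = (\<Sum>i<n. \<Sum>j<n. \<Sum>z<Z. v $ i * v $ j * M z $$ (i, j)) / real Z"
    unfolding qform_sum[OF avg_mat_carrier assms(2)] sum_divide_distrib
    by (intro sum.cong refl)
      (simp add: avg_mat_def sum_distrib_left sum_divide_distrib)
  also have "(\<Sum>i<n. \<Sum>j<n. \<Sum>z<Z. v $ i * v $ j * M z $$ (i, j)) =
    (\<Sum>i<n. \<Sum>z<Z. \<Sum>j<n. v $ i * v $ j * M z $$ (i, j))"
    by (intro sum.cong refl sum.swap)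
  also have "\<dots> = (\<Sum>z<Z. \<Sum>i<n. \<Sum>j<n. v $ i * v $ j * M z $$ (i, j))"
    by (rule sum.swap)
  finally show ?thesis by (simp add: qform_sum[OF assms])
qed

lemma form_bounds_avg_mat:
  assumes "\<And>z. form_bounds \<beta> b n (M z)" "0 < Z"
  shows "form_bounds \<beta> b n (avg_mat Z n M)"
proof -
  have M: "M z \<in> carrier_mat n n" for z using assms(1) by (simp add: form_bounds_def)
  have sym: "M z $$ (i, j) = M z $$ (j, i)" if "i < n" "j < n" for z i j
  proof -
    have "(M z)\<^sup>T $$ (j, i) = M z $$ (j, i)" using assms(1) by (simp add: form_bounds_def)
    then show ?thesis using M[of z] that by simp
  qed
  have "\<beta> * sqn v \<le> qform (avg_mat Z n M) v \<and> qform (avg_mat Z n M) v \<le> b * sqn v"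
    if v: "v \<in> carrier_vec n" for v
  proof -
    have "(\<Sum>z<Z. \<beta> * sqn v) \<le> (\<Sum>z<Z. qform (M z) v)" "(\<Sum>z<Z. qform (M z) v) \<le> (\<Sum>z<Z. b * sqn v)"
      by (intro sum_mono; use assms(1) v in \<open>simp add: form_bounds_def\<close>)+
    then show ?thesis
      unfolding qform_avg_mat[OF M v] using assms(2) by (simp add: field_simps)
  qed
  moreover have "(avg_mat Z n M)\<^sup>T = avg_mat Z n M"
    by (rule eq_matI) (auto simp: avg_mat_def sym)
  ultimately show ?thesis by (simp add: form_bounds_def)
qed

text \<open>Quadratic forms are linear in the matrix, so averaging commutes with the assembly into
  blocks; this lifts the averages of the single items to the stacked inequalities of a node.\<close>

lemma qform_bdiag_avg_mat:
  assumes M: "\<And>z. \<forall>c\<in>set l. M c z \<in> carrier_mat (n c) (n c)" and l: "distinct l"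
    and v: "v \<in> carrier_vec (\<Sum>c\<leftarrow>l. n c)"
  shows "qform (diag_block_mat (map (\<lambda>c. avg_mat Z (n c) (M c)) l)) v =
    (\<Sum>z<Z. qform (diag_block_mat (map (\<lambda>c. M c z) l)) v) / real Z"
proof -
  obtain f where f: "\<forall>c\<in>set l. f c \<in> carrier_vec (n c)" "v = vconcat (map f l)"
    using vconcat_decompose[OF v l] by blast
  have a: "\<forall>c\<in>set l. avg_mat Z (n c) (M c) \<in> carrier_mat (n c) (n c)" by simp
  have "qform (diag_block_mat (map (\<lambda>c. avg_mat Z (n c) (M c)) l)) v =
    (\<Sum>c\<in>set l. \<Sum>z<Z. qform (M c z) (f c)) / real Z"
    unfolding f(2) qform_diag_block_mat[OF a f(1)] sum_list_distinct_conv_sum_set[OF l] sum_divide_distrib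
    using M f(1) by (intro sum.cong refl) (simp add: qform_avg_mat sum_divide_distrib)
  also have "(\<Sum>c\<in>set l. \<Sum>z<Z. qform (M c z) (f c)) = (\<Sum>z<Z. \<Sum>c\<in>set l. qform (M c z) (f c))"
    by (rule sum.swap)
  also have "\<dots> = (\<Sum>z<Z. qform (diag_block_mat (map (\<lambda>c. M c z) l)) v)"
    unfolding f(2) qform_diag_block_mat[OF M f(1)] sum_list_distinct_conv_sum_set[OF l] ..
  finally show ?thesis .
qed

lemma strongly_stableE:
  assumes G: "distributed_system G" and "strongly_stable G"
  obtains \<beta> b W where "\<beta> > 0" "b > 0"
    "\<And>c t. c \<in> items G \<Longrightarrow> form_bounds \<beta> b (dims G c t) (W c t)"
    "\<And>k t v. k \<in> nodes G \<Longrightarrow> v \<in> carrier_vec (idim G k t) \<Longrightarrow>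
       qform (obdiag W G k t) (Amat G k t *\<^sub>v v) + \<beta> * sqn v
         \<le> qform (ibdiag W G k t) v"
proof -
  obtain \<beta> W Ws where \<beta>: "\<beta> > 0" and fam: "gramian_family G \<beta> W Ws"
    and lt: "\<And>k t. k \<in> nodes G \<Longrightarrow> mat_lt ((Amat G k t)\<^sup>T * obdiag (case_sum W Ws) G k t
        * Amat G k t - ibdiag (case_sum W Ws) G k t) (- \<beta>)"
    using assms(2) unfolding strongly_stable_def in_diag_eq out_diag_eq by blast
  obtain b where b: "b > 0" "\<And>c t. c \<in> items G \<Longrightarrow> form_bounds \<beta> b (dims G c t) (case_sum W Ws c t)"
    using gramian_family_form_bounds[OF fam] by blast
  have "qform (obdiag (case_sum W Ws) G k t) (Amat G k t *\<^sub>v v) + \<beta> * sqn v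
         \<le> qform (ibdiag (case_sum W Ws) G k t) v"
    if k: "k \<in> nodes G" and v: "v \<in> carrier_vec (idim G k t)" for k t v
  proof -
    let ?n = "idim G k t"
    have fb: "form_bounds \<beta> b (odim G k t) (obdiag (case_sum W Ws) G k t)"
      "form_bounds \<beta> b ?n (ibdiag (case_sum W Ws) G k t)"
      by (rule form_bounds_bdiag;
          use b(2) in_items_subset[OF G k] out_items_subset[OF G k] distinct_in_items[OF G]
            distinct_out_items[OF G] in blast)+
    have A: "Amat G k t \<in> carrier_mat (odim G k t) ?n"
      by (rule Amat_carrier[OF G k])
    have "v \<noteq> 0\<^sub>v ?n \<longrightarrow> qform (obdiag (case_sum W Ws) G k t) (Amat G k t *\<^sub>v v) -
        qform (ibdiag (case_sum W Ws) G k t) v < - \<beta> * sqn v"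
      using lt[OF k, of t] fb v unfolding form_bounds_def
      by (subst (asm) mat_lt_congruence_iff[OF A]) blast+
    moreover have "qform (obdiag (case_sum W Ws) G k t) (Amat G k t *\<^sub>v 0\<^sub>v ?n) = 0"
      "qform (ibdiag (case_sum W Ws) G k t) (0\<^sub>v ?n) = 0"
      using fb by (simp_all add: mult_mat_vec_zero[OF A] form_bounds_def)
    ultimately show ?thesis by (cases "v = 0\<^sub>v ?n") auto
  qed
  with \<beta> b show thesis by (intro that)
qed

lemma etp_realization_dims: "etp_realization h q G \<Longrightarrow> c \<in> items G \<Longrightarrow> etp h q (dims G c)"
  by (auto simp: etp_realization_def etp_family_iff dims_def)

text \<open>From time \<open>h\<close> on, \<open>P\<close> averages \<open>W\<close> over
  \<open>Z\<close> times in the residue class of \<open>t\<close>. Where the residue advances by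
  one, the averaged inequalities for \<open>W\<close> are the inequality for \<open>P\<close>. Where
  it wraps from \<open>h + q - 1\<close> to \<open>h\<close>, the two sums differ by the end terms
  of one chain, hence by at most \<open>b |A v|^2 \<le> b a |v|^2\<close>; divided by
  \<open>Z\<close>, this costs less than half of \<beta>. Before \<open>h\<close> periodicity is no
  constraint, and \<open>P\<close> only has to decrease fast enough.\<close>

lemma periodic_lyapunov:
  assumes q: "q > 0" and G: "distributed_system G" "strongly_stable G" "etp_realization h q G"
  obtains \<beta> b W where "\<beta> > 0" "b > 0"
    "\<And>c t. c \<in> items G \<Longrightarrow> form_bounds \<beta> b (dims G c t) (W c t)"
    "\<And>k t v. k \<in> nodes G \<Longrightarrow> v \<in> carrier_vec (idim G k t) \<Longrightarrow>
       qform (obdiag W G k t) (Amat G k t *\<^sub>v v) + \<beta> * sqn v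
         \<le> qform (ibdiag W G k t) v"
    "\<And>c. c \<in> items G \<Longrightarrow> etp h q (W c)"
proof -
  obtain \<beta> b W where \<beta>: "\<beta> > 0" and b: "b > 0"
    and W: "\<And>c t. c \<in> items G \<Longrightarrow> form_bounds \<beta> b (dims G c t) (W c t)"
    and dec: "\<And>k t v. k \<in> nodes G \<Longrightarrow> v \<in> carrier_vec (idim G k t) \<Longrightarrow>
       qform (obdiag W G k t) (Amat G k t *\<^sub>v v) + \<beta> * sqn v
         \<le> qform (ibdiag W G k t) v"
    using strongly_stableE[OF G(1,2)] by blast
  have "unif_bounded (nodes G) (Amat G)" using G(1) by (simp add: distributed_system_def)
  then obtain a where a: "a > 0" "\<And>k t. k \<in> nodes G \<Longrightarrow> sq_bounded a (Amat G k t)"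
    using unif_boundedE by blast
  \<comment> \<open>Makes the boundary term \<open>b a / Z\<close> less than
    \<open>\<beta> / 2\<close>.\<close>
  obtain Z :: nat where Z: "real Z > 2 * b * a / \<beta>" using reals_Archimedean2 by blast
  moreover have "0 < 2 * b * a / \<beta>" using a(1) b \<beta> by simp
  ultimately have Z0: "Z > 0" by (cases Z) auto
  \<comment> \<open>\<open>L t = (a + 1) L (t + 1)\<close> pays for the growth of the state by
    \<open>a\<close> and leaves \<open>L (t + 1) |v|^2\<close> as decrease.
    \<open>L h = b + \<beta>\<close> dominates the upper bound \<open>b\<close> of the averages,
    which the step from \<open>h - 1\<close> to \<open>h\<close> meets.\<close>
  define L where "L = (\<lambda>t. (b + \<beta>) * (a + 1) ^ (h - t))"
  \<comment> \<open>The representative of \<open>t \<ge> h\<close> in \<open>{h..<h + q}\<close>.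
    The averaging window starts here and not at \<open>t\<close>, which makes \<open>P\<close>
    exactly periodic.\<close>
  define cano where "cano = (\<lambda>t. h + (t - h) mod q)"
  define P where "P = (\<lambda>c t. if t < h then L t \<cdot>\<^sub>m 1\<^sub>m (dims G c t)
    else avg_mat Z (dims G c t) (\<lambda>z. W c (cano t + z * q)))"
  have dims: "dims G c (cano t + z * q) = dims G c t" if "c \<in> items G" "h \<le> t" for c t z
    using etp_reduce[OF etp_realization_dims[OF G(3) that(1)] that(2)]
      etp_shift[OF etp_realization_dims[OF G(3) that(1)], of "cano t" z] by (simp add: cano_def)
  have L: "b + \<beta> \<le> L t" "L t \<le> L 0" for t
  proof -
    have "(a + 1) ^ 0 \<le> (a + 1) ^ (h - t)" "(a + 1) ^ (h - t) \<le> (a + 1) ^ h"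
      by (rule power_increasing; use a(1) in simp)+
    then show "b + \<beta> \<le> L t" "L t \<le> L 0" using b \<beta> by (simp_all add: L_def)
  qed
  have Wz: "form_bounds \<beta> b (dims G c t) (W c (cano t + z * q))" if "c \<in> items G" "h \<le> t" for c t z
    using W[OF that(1), of "cano t + z * q"] dims[OF that] by simp
  have P: "form_bounds (\<beta> / 2) (L t) (dims G c t) (P c t)" if c: "c \<in> items G" for c t
  proof (cases "t < h")
    case True
    have "\<beta> / 2 \<le> L t" using L(1)[of t] b \<beta> by linarith
    then show ?thesis
      using True form_bounds_scaled_one[of "L t" "dims G c t"]
      by (auto simp: P_def form_bounds_def intro: order_trans[OF mult_right_mono])
  next
    case False
    have "form_bounds \<beta> b (dims G c t) (P c t)"
      using form_bounds_avg_mat[OF Wz[OF c, of t] Z0] False by (simp add: P_def)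
    moreover have "\<beta> / 2 * sqn v \<le> \<beta> * sqn v" "b * sqn v \<le> L t * sqn v" for v
      by (rule mult_right_mono; use \<beta> L(1)[of t] in simp)+
    ultimately show ?thesis unfolding form_bounds_def by (meson order_trans)
  qed
  have avg: "qform (bdiag P l t) v = (\<Sum>z<Z. qform (bdiag W l (cano t + z * q)) v) / real Z"
    if "set l \<subseteq> items G" "distinct l" "h \<le> t" "v \<in> carrier_vec (ldim G l t)" for l t v
  proof -
    have "\<forall>c\<in>set l. W c (cano t + z * q) \<in> carrier_mat (dims G c t) (dims G c t)" for z
      using Wz that(1,3) unfolding form_bounds_def by blast
    from qform_bdiag_avg_mat[OF this that(2,4), of Z] show ?thesis using that(3) by (simp add: P_def)
  qed
  have "qform (obdiag P G k t) (Amat G k t *\<^sub>v v) + \<beta> / 2 * sqn v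
         \<le> qform (ibdiag P G k t) v"
    if k: "k \<in> nodes G" and v: "v \<in> carrier_vec (idim G k t)" for k t v
  proof -
    define u where "u = Amat G k t *\<^sub>v v"
    note i = in_items_subset[OF G(1) k] distinct_in_items[OF G(1), of k]
    note o = out_items_subset[OF G(1) k] distinct_out_items[OF G(1), of k]
    have A: "Amat G k s \<in> carrier_mat (ldim G (out_items G k) (s + 1)) (ldim G (in_items G k) s)" for s
      by (rule Amat_carrier[OF G(1) k])
    have u: "u \<in> carrier_vec (odim G k t)"
      unfolding u_def using A v by (rule mult_mat_vec_carrier)
    have ua: "sqn u \<le> a * sqn v" unfolding u_def by (rule sq_boundedD[OF a(2)[OF k] A v])
    show ?thesis
    proof (cases "t < h")
      case True
      have "form_bounds (\<beta> / 2) (L (t + 1)) (odim G k t) (obdiag P G k t)"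
        using P o by (intro form_bounds_bdiag) auto
      then have "qform (obdiag P G k t) u \<le> L (t + 1) * sqn u"
        using u by (simp add: form_bounds_def)
      also have "\<dots> \<le> L (t + 1) * (a * sqn v)"
        using ua L(1)[of "t + 1"] b \<beta> by (intro mult_left_mono) auto
      finally have 1: "qform (obdiag P G k t) u \<le> L (t + 1) * (a * sqn v)" .
      have "form_bounds (L t) (L t) (idim G k t) (ibdiag P G k t)"
        using True form_bounds_scaled_one i by (intro form_bounds_bdiag) (auto simp: P_def)
      then have 2: "L t * sqn v \<le> qform (ibdiag P G k t) v"
        using v by (simp add: form_bounds_def)
      have "h - t = Suc (h - (t + 1))" using True by simp
      then have "L t = L (t + 1) * (a + 1)" by (simp add: L_def)
      then have 3: "L t * sqn v = L (t + 1) * (a * sqn v) + L (t + 1) * sqn v"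
        by (simp add: algebra_simps)
      have "\<beta> / 2 * sqn v \<le> L (t + 1) * sqn v"
        using L(1)[of "t + 1"] b \<beta> by (intro mult_right_mono) auto
      with 1 2 3 show ?thesis by (simp add: u_def)
    next
      case False
      then have t: "h \<le> t" by simp
      define s where "s = cano t"
      define g where "g = (\<lambda>r. qform (bdiag W (out_items G k) r) u)"
      have As: "Amat G k (s + z * q) = Amat G k t" for z
      proof -
        have "etp h q (Amat G k)" using G(3) k by (simp add: etp_realization_def)
        then show ?thesis
          using etp_reduce[of h q "Amat G k" t] etp_shift[of h q "Amat G k" s z] t by (simp add: s_def cano_def)
      qed
      have n: "ldim G (in_items G k) (s + z * q) = idim G k t" for z
        using dims t i(1) by (intro arg_cong[where f = sum_list] map_cong refl) (auto simp: s_def)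
      have step: "g (s + 1 + z * q) + \<beta> * sqn v \<le> qform (bdiag W (in_items G k) (s + z * q)) v" for z
      proof -
        have "s + 1 + z * q = s + z * q + 1" by simp
        then show ?thesis
          using dec[OF k, of v "s + z * q"] v unfolding n As g_def u_def by (simp only:)
      qed
      have gb: "0 \<le> g r" "g r \<le> b * sqn u" if "\<And>c. c \<in> items G \<Longrightarrow> dims G c r = dims G c (t + 1)" for r
      proof -
        have "\<forall>c\<in>set (out_items G k). form_bounds \<beta> b (dims G c (t + 1)) (W c r)"
          using W o(1) that by (metis subsetD)
        then have "form_bounds \<beta> b (odim G k t) (bdiag W (out_items G k) r)"
          using o(2) by (rule form_bounds_bdiag)
        with u have "\<beta> * sqn u \<le> g r" "g r \<le> b * sqn u" by (auto simp: form_bounds_def g_def)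
        moreover have "0 \<le> \<beta> * sqn u" using \<beta> by simp
        ultimately show "0 \<le> g r" "g r \<le> b * sqn u" by linarith+
      qed
      have "(\<Sum>z<Z. g (cano (t + 1) + z * q)) \<le> (\<Sum>z<Z. g (s + 1 + z * q)) + b * sqn u"
      proof (cases "Suc ((t - h) mod q) = q")
        \<comment> \<open>The wrap: \<open>s + 1 = h + q\<close>, so the two sums run over the same
          sequence shifted by one period and differ by its terms at \<open>h\<close> and
          \<open>h + Z * q\<close>.\<close>
        case True
        have "Suc (t - h) mod q = 0" using True by (simp add: mod_Suc)
        then have c: "cano (t + 1) = h" using t by (simp add: cano_def Suc_diff_le)
        have s1: "s + 1 + z * q = h + Suc z * q" for z using True by (simp add: s_def cano_def)
        have d: "dims G c (h + z * q) = dims G c (t + 1)" if "c \<in> items G" for c z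
          using dims[OF that, of "t + 1" z, unfolded c] t by simp
        have "(\<Sum>z<Z. g (h + z * q)) + g (h + Z * q) = g h + (\<Sum>z<Z. g (h + Suc z * q))"
          using sum.lessThan_Suc_shift[of "\<lambda>z. g (h + z * q)" Z] by simp
        moreover have "g h \<le> b * sqn u" using gb(2)[of h] d[of _ 0] by simp
        moreover have "0 \<le> g (h + Z * q)" using gb(1) d by blast
        ultimately show ?thesis unfolding c s1 by linarith
      next
        case False
        have "Suc (t - h) mod q = Suc ((t - h) mod q)" using False by (simp add: mod_Suc)
        then have "cano (t + 1) = s + 1" using t by (simp add: cano_def s_def Suc_diff_le)
        moreover have "0 \<le> b * sqn u" using b by simp
        ultimately show ?thesis by simp
      qed
      also have "(\<Sum>z<Z. g (s + 1 + z * q)) \<le> (\<Sum>z<Z. qform (bdiag W (in_items G k) (s + z * q)) v - \<beta> * sqn v)"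
        using step by (intro sum_mono) (simp add: algebra_simps)
      also have "b * sqn u \<le> b * (a * sqn v)" using ua b by (intro mult_left_mono) auto
      also have "b * (a * sqn v) \<le> real Z * (\<beta> / 2) * sqn v"
        using mult_right_mono[of "b * a" "real Z * (\<beta> / 2)" "sqn v"] Z \<beta> by (simp add: field_simps)
      finally have "(\<Sum>z<Z. g (cano (t + 1) + z * q)) + real Z * (\<beta> / 2) * sqn v \<le>
        (\<Sum>z<Z. qform (bdiag W (in_items G k) (s + z * q)) v)"
        by (simp add: sum_subtractf algebra_simps)
      then have "((\<Sum>z<Z. g (cano (t + 1) + z * q)) + real Z * (\<beta> / 2) * sqn v) / real Z \<le>
        (\<Sum>z<Z. qform (bdiag W (in_items G k) (s + z * q)) v) / real Z"
        by (rule divide_right_mono) simp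
      then have "(\<Sum>z<Z. g (cano (t + 1) + z * q)) / real Z + \<beta> / 2 * sqn v \<le>
        (\<Sum>z<Z. qform (bdiag W (in_items G k) (s + z * q)) v) / real Z"
        using Z0 by (simp add: add_divide_distrib)
      then show ?thesis
        using avg[OF o, of "t + 1" u] avg[OF i t v] t u by (simp add: g_def s_def u_def)
    qed
  qed
  moreover have "form_bounds (\<beta> / 2) (L 0) (dims G c t) (P c t)" if "c \<in> items G" for c t
  proof -
    have "L t * sqn v \<le> L 0 * sqn v" for v using L(2)[of t] by (intro mult_right_mono) auto
    with P[OF that, of t] show ?thesis unfolding form_bounds_def by (meson order_trans)
  qed
  moreover have "etp h q (P c)" if c: "c \<in> items G" for c
  proof (rule etpI)
    fix t z assume t: "h \<le> t"
    then have "t + z * q - h = t - h + z * q" by simp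
    then have "cano (t + z * q) = cano t" by (simp add: cano_def)
    moreover have "dims G c (t + z * q) = dims G c t"
      by (rule etp_shift[OF etp_realization_dims[OF G(3) c] t])
    ultimately show "P c (t + z * q) = P c t" using t by (simp add: P_def)
  qed
  moreover have "0 < L 0" using L(1)[of 0] b \<beta> by linarith
  ultimately show thesis using that[of "\<beta> / 2" "L 0" P] \<beta> by simp
qed

subsection \<open>Existence of a periodic balanced realization\<close>

lemma sqn_bdiag_factor:
  assumes "\<forall>c\<in>set l. T c \<in> carrier_mat (n c) (n c)" "\<forall>c\<in>set l. W c \<in> carrier_mat (n c) (n c)"
    and "\<forall>c\<in>set l. \<forall>v\<in>carrier_vec (n c). sqn (T c *\<^sub>v v) = qform (W c) v"
    and "distinct l" "v \<in> carrier_vec (\<Sum>c\<leftarrow>l. n c)"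
  shows "sqn (diag_block_mat (map T l) *\<^sub>v v) = qform (diag_block_mat (map W l)) v"
proof -
  obtain f where f: "\<forall>c\<in>set l. f c \<in> carrier_vec (n c)" "v = vconcat (map f l)"
    using vconcat_decompose[OF assms(5,4)] by blast
  have Tf: "\<forall>c\<in>set l. T c *\<^sub>v f c \<in> carrier_vec (n c)"
    using assms(1) f(1) by (auto intro: mult_mat_vec_carrier)
  show ?thesis
    unfolding f(2) diag_block_mat_mult_vconcat[OF assms(1) f(1)] qform_diag_block_mat[OF assms(2) f(1)]
      scalar_prod_vconcat[OF Tf Tf]
    using assms(3) f(1) by (intro arg_cong[where f = sum_list] map_cong refl) blast
qed

lemma mult_mat_vec_assoc3:
  assumes "A \<in> carrier_mat m l" "B \<in> carrier_mat l r" "C \<in> carrier_mat r n" "v \<in> carrier_vec n"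
  shows "(A * B * C) *\<^sub>v v = A *\<^sub>v (B *\<^sub>v (C *\<^sub>v (v :: real vec)))"
  using assms assoc_mult_mat_vec[of "A * B" m r C n v] assoc_mult_mat_vec[of A m l B r "C *\<^sub>v v"]
  by (simp add: mult_mat_vec_carrier[of C r n])

lemma etp_bdiag: "\<forall>c\<in>set l. etp h q (Z c) \<Longrightarrow> etp h q (bdiag Z l)"
  by (rule etp_comp[OF etp_map])

lemma sq_bounded_inverse_factor:
  assumes "form_bounds \<beta> b n W" "0 < \<beta>" "T \<in> carrier_mat n n" "Ti \<in> carrier_mat n n"
    and "\<And>v. v \<in> carrier_vec n \<Longrightarrow> sqn (T *\<^sub>v v) = qform W v"
    and "\<And>v. v \<in> carrier_vec n \<Longrightarrow> T *\<^sub>v (Ti *\<^sub>v v) = v"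
  shows "sq_bounded (1 / \<beta>) Ti"
proof (rule sq_boundedI[OF assms(4)])
  fix v :: "real vec" assume v: "v \<in> carrier_vec n"
  then have w: "Ti *\<^sub>v v \<in> carrier_vec n" using assms(4) by (intro mult_mat_vec_carrier)
  then have "\<beta> * sqn (Ti *\<^sub>v v) \<le> qform W (Ti *\<^sub>v v)" using assms(1) by (simp add: form_bounds_def)
  also have "\<dots> = sqn v" using assms(5)[OF w] assms(6)[OF v] by simp
  finally show "sqn (Ti *\<^sub>v v) \<le> 1 / \<beta> * sqn v" using assms(2) by (simp add: field_simps)
qed

lemma sq_bounded_factor:
  assumes "form_bounds \<beta> b n W" "T \<in> carrier_mat n n"
    and "\<And>v. v \<in> carrier_vec n \<Longrightarrow> sqn (T *\<^sub>v v) = qform W v"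
  shows "sq_bounded b T"
  using assms by (intro sq_boundedI[OF assms(2)]) (simp add: form_bounds_def)

text \<open>In the coordinates that turn the Lyapunov function into the Euclidean norm, the state
  matrices are uniform contractions, so that large multiples of the identity are gramians.\<close>

lemma contraction_balanced:
  assumes H: "distributed_system H" and \<rho>: "0 < \<rho>" "\<rho> < 1"
    and A: "\<And>k t. k \<in> nodes H \<Longrightarrow> sq_bounded \<rho> (Amat H k t)"
  obtains c where "balanced_gramians H (\<lambda>k t. c \<cdot>\<^sub>m 1\<^sub>m (tdim H k t)) (\<lambda>e t. c \<cdot>\<^sub>m 1\<^sub>m (sdim H e t))"
proof -
  obtain b where b: "b > 0" "\<And>k t. k \<in> nodes H \<Longrightarrow> sq_bounded b (Bmat H k t)"
    using H unif_boundedE[of "nodes H" "Bmat H"] unfolding distributed_system_def by blast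
  obtain d where d: "d > 0" "\<And>k t. k \<in> nodes H \<Longrightarrow> sq_bounded d (Cmat H k t)"
    using H unif_boundedE[of "nodes H" "Cmat H"] unfolding distributed_system_def by blast
  \<comment> \<open>Contraction by \<rho> leaves \<open>c (1 - \<rho>) |v|^2\<close> to spend:
    \<open>b\<close> or \<open>d\<close> of it covers the input or output term, and the remaining 2
    exceeds the required margin 1.\<close>
  define c where "c = (b + d + 2) / (1 - \<rho>)"
  have "c * (1 - \<rho>) = b + d + 2" using \<rho> by (simp add: c_def)
  then have c: "c - c * \<rho> = b + d + 2" by (simp add: algebra_simps)
  have c1: "1 < c"
  proof -
    have "0 \<le> c * \<rho>" using b(1) d(1) \<rho> by (simp add: c_def)
    with c show ?thesis using b(1) d(1) by linarith
  qed
  define S where "S = (\<lambda>i t. c \<cdot>\<^sub>m 1\<^sub>m (dims H i t) :: real mat)"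
  have cs: "case_sum (\<lambda>k t. c \<cdot>\<^sub>m 1\<^sub>m (tdim H k t)) (\<lambda>e t. c \<cdot>\<^sub>m 1\<^sub>m (sdim H e t)) = S"
    by (rule ext) (simp add: S_def dims_def split: sum.split)
  have Sb: "form_bounds c c (\<Sum>i\<leftarrow>l. dims H i t) (bdiag S l t)" if "distinct l" for l t
    using that by (intro form_bounds_bdiag) (auto simp: S_def form_bounds_scaled_one)
  have "gramian_family H 1 (\<lambda>k t. c \<cdot>\<^sub>m 1\<^sub>m (tdim H k t)) (\<lambda>e t. c \<cdot>\<^sub>m 1\<^sub>m (sdim H e t))"
    unfolding gramian_family_iff cs
  proof (intro conjI ballI allI)
    fix i t
    show S: "S i t \<in> carrier_mat (dims H i t) (dims H i t)" by (simp add: S_def)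
    show "mat_gt (S i t) 1"
      unfolding mat_gt_iff[OF S] using c1 sqn_pos
      by (auto simp: S_def transpose_smult_one qform_scaled_one)
    show "unif_bounded (items H) S"
      by (intro unif_boundedI[of _ "c\<^sup>2"] sq_boundedI[of _ "dims H _ _" "dims H _ _"])
        (auto simp: S_def scaled_one_mult_vec sqn_smult)
  qed
  moreover have "mat_lt (Amat H k t * ibdiag S H k t * (Amat H k t)\<^sup>T -
      obdiag S H k t + Bmat H k t * (Bmat H k t)\<^sup>T) (- 1) \<and>
    mat_lt ((Amat H k t)\<^sup>T * obdiag S H k t * Amat H k t -
      ibdiag S H k t + (Cmat H k t)\<^sup>T * Cmat H k t) (- 1)"
    if k: "k \<in> nodes H" for k t
  proof
    note i = Sb[OF distinct_in_items[OF H, of k], of t, unfolded form_bounds_def]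
    note o = Sb[OF distinct_out_items[OF H, of k], of "t + 1", unfolded form_bounds_def]
    note AH = Amat_carrier[OF H k, of t] and BH = Bmat_carrier[OF H k, of t] and CH = Cmat_carrier[OF H k, of t]
    let ?n = "\<Sum>i\<leftarrow>in_items H k. dims H i t" and ?m = "\<Sum>i\<leftarrow>out_items H k. dims H i (t + 1)"
    \<comment> \<open>Serves both gramian inequalities: \<open>x\<close> is the energy of the
      transformed state, and \<open>y\<close> the input term in the first and the output term in the
      second.\<close>
    have key: "c * x - c * s + y < - 1 * s" if "x \<le> \<rho> * s" "y \<le> b * s \<or> y \<le> d * s" "0 < s" for x y s
    proof -
      have "c * x \<le> c * (\<rho> * s)" using that(1) c1 by (intro mult_left_mono) auto
      moreover have "c * s - c * (\<rho> * s) = b * s + d * s + 2 * s"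
        using arg_cong[OF c, of "\<lambda>x. x * s"] by (simp add: algebra_simps)
      moreover have "0 < b * s" "0 < d * s" using b(1) d(1) that(3) by simp_all
      ultimately show ?thesis using that(2,3) by linarith
    qed
    show "mat_lt (Amat H k t * ibdiag S H k t * (Amat H k t)\<^sup>T -
      obdiag S H k t + Bmat H k t * (Bmat H k t)\<^sup>T) (- 1)"
      unfolding mat_lt_gramian_dual_iff[OF AH conjunct1[OF i] conjunct1[OF conjunct2[OF i]]
          conjunct1[OF o] conjunct1[OF conjunct2[OF o]] BH]
    proof (intro ballI impI)
      fix v :: "real vec" assume v: "v \<in> carrier_vec ?m" "v \<noteq> 0\<^sub>v ?m"
      have "(Amat H k t)\<^sup>T *\<^sub>v v \<in> carrier_vec ?n" using AH v(1) by (intro mult_mat_vec_carrier[of _ _ ?m]) simp_all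
      then have "qform (ibdiag S H k t) ((Amat H k t)\<^sup>T *\<^sub>v v) = c * sqn ((Amat H k t)\<^sup>T *\<^sub>v v)"
        using i by (intro antisym) blast+
      moreover have "qform (obdiag S H k t) v = c * sqn v"
        using o v(1) by (intro antisym) blast+
      moreover have "sqn ((Amat H k t)\<^sup>T *\<^sub>v v) \<le> \<rho> * sqn v"
        using sq_bounded_transpose[OF AH A[OF k] \<rho>(1)] AH v(1) by (intro sq_boundedD) simp_all
      moreover have "sqn ((Bmat H k t)\<^sup>T *\<^sub>v v) \<le> b * sqn v"
        using sq_bounded_transpose[OF BH b(2)[OF k] b(1)] BH v(1) by (intro sq_boundedD) simp_all
      ultimately show "qform (ibdiag S H k t) ((Amat H k t)\<^sup>T *\<^sub>v v) -
          qform (obdiag S H k t) v + sqn ((Bmat H k t)\<^sup>T *\<^sub>v v) < - 1 * sqn v"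
        using key sqn_pos[OF v] by metis
    qed
    show "mat_lt ((Amat H k t)\<^sup>T * obdiag S H k t * Amat H k t -
      ibdiag S H k t + (Cmat H k t)\<^sup>T * Cmat H k t) (- 1)"
      unfolding mat_lt_gramian_iff[OF AH conjunct1[OF o] conjunct1[OF conjunct2[OF o]]
          conjunct1[OF i] conjunct1[OF conjunct2[OF i]] CH]
    proof (intro ballI impI)
      fix v :: "real vec" assume v: "v \<in> carrier_vec ?n" "v \<noteq> 0\<^sub>v ?n"
      have "Amat H k t *\<^sub>v v \<in> carrier_vec ?m" using AH v(1) by (rule mult_mat_vec_carrier)
      then have "qform (obdiag S H k t) (Amat H k t *\<^sub>v v) = c * sqn (Amat H k t *\<^sub>v v)"
        using o by (intro antisym) blast+
      moreover have "qform (ibdiag S H k t) v = c * sqn v"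
        using i v(1) by (intro antisym) blast+
      moreover have "sqn (Amat H k t *\<^sub>v v) \<le> \<rho> * sqn v"
        by (rule sq_boundedD[OF A[OF k] AH v(1)])
      moreover have "sqn (Cmat H k t *\<^sub>v v) \<le> d * sqn v"
        by (rule sq_boundedD[OF d(2)[OF k] CH v(1)])
      ultimately show "qform (obdiag S H k t) (Amat H k t *\<^sub>v v) -
          qform (ibdiag S H k t) v + sqn (Cmat H k t *\<^sub>v v) < - 1 * sqn v"
        using key sqn_pos[OF v] by metis
    qed
  qed
  moreover have "diag_decreasing (c \<cdot>\<^sub>m 1\<^sub>m n)" for n
    by (auto simp: diag_decreasing_def diagonal_mat_def diag_mat_def sorted_wrt_iff_nth_less)
  ultimately have "balanced_gramians H (\<lambda>k t. c \<cdot>\<^sub>m 1\<^sub>m (tdim H k t)) (\<lambda>e t. c \<cdot>\<^sub>m 1\<^sub>m (sdim H e t))"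
    unfolding balanced_gramians_def in_diag_eq out_diag_eq cs
    by (intro conjI exI[of _ 1]) simp_all
  then show thesis by (rule that)
qed

lemma etp_balanced_realization_exists:
  assumes q: "q > 0" and G: "distributed_system G" "strongly_stable G" "etp_realization h q G"
  shows "\<exists>H \<Sigma> \<Sigma>s. balanced_realization G H \<and> etp_realization h q H \<and>
    balanced_gramians H \<Sigma> \<Sigma>s \<and> etp_family h q G \<Sigma> \<Sigma>s"
proof -
  obtain \<beta> b W where \<beta>: "\<beta> > 0" and b: "b > 0"
    and W: "\<And>c t. c \<in> items G \<Longrightarrow> form_bounds \<beta> b (dims G c t) (W c t)"
    and dec: "\<And>k t v. k \<in> nodes G \<Longrightarrow> v \<in> carrier_vec (idim G k t) \<Longrightarrow>
       qform (obdiag W G k t) (Amat G k t *\<^sub>v v) + \<beta> * sqn v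
         \<le> qform (ibdiag W G k t) v"
    and Wetp: "\<And>c. c \<in> items G \<Longrightarrow> etp h q (W c)"
    using periodic_lyapunov[OF q G] by blast
  \<comment> \<open>The choice assigns factors to matrices and not to pairs of item and time. Equal
    values of \<open>W\<close> thus get equal factors, and \<open>T\<close> and \<open>Ti\<close>
    inherit the periodicity of \<open>W\<close>.\<close>
  have "\<forall>M. \<exists>N. form_bounds \<beta> b (dim_row M) M \<longrightarrow>
    fst N \<in> carrier_mat (dim_row M) (dim_row M) \<and> snd N \<in> carrier_mat (dim_row M) (dim_row M) \<and>
    fst N * snd N = 1\<^sub>m (dim_row M) \<and> snd N * fst N = 1\<^sub>m (dim_row M) \<and>
    (\<forall>v\<in>carrier_vec (dim_row M). sqn (fst N *\<^sub>v v) = qform M v)"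
    using cholesky_inverse[OF _ \<beta>] by (metis fst_conv snd_conv)
  then obtain F where F: "\<And>M. form_bounds \<beta> b (dim_row M) M \<Longrightarrow>
    fst (F M) \<in> carrier_mat (dim_row M) (dim_row M) \<and> snd (F M) \<in> carrier_mat (dim_row M) (dim_row M) \<and>
    fst (F M) * snd (F M) = 1\<^sub>m (dim_row M) \<and> snd (F M) * fst (F M) = 1\<^sub>m (dim_row M) \<and>
    (\<forall>v\<in>carrier_vec (dim_row M). sqn (fst (F M) *\<^sub>v v) = qform M v)"
    by metis
  define T where "T = (\<lambda>c t. fst (F (W c t)))"
  define Ti where "Ti = (\<lambda>c t. snd (F (W c t)))"
  have WD: "W c t \<in> carrier_mat (dims G c t) (dims G c t)" "dim_row (W c t) = dims G c t"
    if "c \<in> items G" for c t using W[OF that] by (auto simp: form_bounds_def)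
  have T: "T c t \<in> carrier_mat (dims G c t) (dims G c t)" "Ti c t \<in> carrier_mat (dims G c t) (dims G c t)"
    "T c t * Ti c t = 1\<^sub>m (dims G c t)" "Ti c t * T c t = 1\<^sub>m (dims G c t)"
    "\<forall>v\<in>carrier_vec (dims G c t). sqn (T c t *\<^sub>v v) = qform (W c t) v"
    if "c \<in> items G" for c t
    using F[of "W c t"] W[OF that, of t] unfolding WD(2)[OF that] T_def Ti_def by blast+
  define H where "H = G\<lparr>
    Amat := \<lambda>k t. obdiag T G k t * Amat G k t * ibdiag Ti G k t,
    Bmat := \<lambda>k t. obdiag T G k t * Bmat G k t,
    Cmat := \<lambda>k t. Cmat G k t * ibdiag Ti G k t\<rparr>"
  have Hs [simp]: "nnodes H = nnodes G" "edges H = edges G" "tdim H = tdim G" "sdim H = sdim G"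
    "udim H = udim G" "ydim H = ydim G" "Dmat H = Dmat G" "dims H = dims G"
    by (simp_all add: H_def dims_def)
  have Hi [simp]: "in_items H k = in_items G k" "out_items H k = out_items G k" "items H = items G" for k
    by (rule items_cong; simp)+
  have mats: "Amat H k t = obdiag T G k t * Amat G k t * ibdiag Ti G k t"
    "Bmat H k t = obdiag T G k t * Bmat G k t"
    "Cmat H k t = Cmat G k t * ibdiag Ti G k t" for k t
    by (simp_all add: H_def)
  have block: "bdiag T l t \<in> carrier_mat (ldim G l t) (ldim G l t)"
    "bdiag Ti l t \<in> carrier_mat (ldim G l t) (ldim G l t)"
    "form_bounds \<beta> b (ldim G l t) (bdiag W l t)"
    "\<And>v. v \<in> carrier_vec (ldim G l t) \<Longrightarrow> sqn (bdiag T l t *\<^sub>v v) = qform (bdiag W l t) v"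
    "\<And>v. v \<in> carrier_vec (ldim G l t) \<Longrightarrow> bdiag T l t *\<^sub>v (bdiag Ti l t *\<^sub>v v) = v"
    if l: "set l \<subseteq> items G" "distinct l" for l t
  proof -
    have *: "\<forall>c\<in>set l. T c t \<in> carrier_mat (dims G c t) (dims G c t)"
      "\<forall>c\<in>set l. Ti c t \<in> carrier_mat (dims G c t) (dims G c t)"
      "\<forall>c\<in>set l. T c t * Ti c t = 1\<^sub>m (dims G c t)"
      "\<forall>c\<in>set l. W c t \<in> carrier_mat (dims G c t) (dims G c t)"
      "\<forall>c\<in>set l. form_bounds \<beta> b (dims G c t) (W c t)"
      "\<forall>c\<in>set l. \<forall>v\<in>carrier_vec (dims G c t). sqn (T c t *\<^sub>v v) = qform (W c t) v"
      using l(1) T WD(1) W by blast+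
    show "bdiag T l t \<in> carrier_mat (ldim G l t) (ldim G l t)"
      "bdiag Ti l t \<in> carrier_mat (ldim G l t) (ldim G l t)"
      "form_bounds \<beta> b (ldim G l t) (bdiag W l t)"
      by (rule diag_block_mat_carrier[OF *(1)] diag_block_mat_carrier[OF *(2)] form_bounds_bdiag[OF *(5) l(2)])+
    show "sqn (bdiag T l t *\<^sub>v v) = qform (bdiag W l t) v"
      "bdiag T l t *\<^sub>v (bdiag Ti l t *\<^sub>v v) = v" if "v \<in> carrier_vec (ldim G l t)" for v
      by (rule sqn_bdiag_factor[OF *(1,4,6) l(2) that] diag_block_mat_inverse[OF *(1-3) l(2) that])+
  qed
  note inb = block[OF in_items_subset[OF G(1)] distinct_in_items[OF G(1)]]
  note outb = block[OF out_items_subset[OF G(1)] distinct_out_items[OF G(1)]]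
  \<comment> \<open>The facts at hand do not give \<open>\<beta> < b\<close>, so
    \<open>1 - \<beta> / b\<close> might fail to be positive; the larger denominator keeps \<rho>
    strictly between 0 and 1.\<close>
  define \<rho> where "\<rho> = 1 - \<beta> / (b + \<beta>)"
  have \<rho>: "0 < \<rho>" "\<rho> < 1" using b \<beta> by (simp_all add: \<rho>_def field_simps)
  have A\<rho>: "sq_bounded \<rho> (Amat H k t)" if k: "k \<in> nodes G" for k t
  proof -
    note A = Amat_carrier[OF G(1) k, of t]
    let ?n = "idim G k t"
    show ?thesis
    proof (rule sq_boundedI)
      show "Amat H k t \<in> carrier_mat (odim G k t) ?n"
        unfolding mats using A inb(2)[OF k] outb(1)[OF k] by (intro mult_carrier_mat)
      fix u :: "real vec" assume u: "u \<in> carrier_vec ?n"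
      define w where "w = ibdiag Ti G k t *\<^sub>v u"
      have w: "w \<in> carrier_vec ?n" unfolding w_def using inb(2)[OF k] u by (rule mult_mat_vec_carrier)
      have Aw: "Amat G k t *\<^sub>v w \<in> carrier_vec (odim G k t)"
        using A w by (rule mult_mat_vec_carrier)
      have uw: "sqn u = qform (ibdiag W G k t) w"
        using inb(4)[OF k w] inb(5)[OF k u] by (simp add: w_def)
      have "Amat H k t *\<^sub>v u = obdiag T G k t *\<^sub>v (Amat G k t *\<^sub>v w)"
        unfolding mats w_def by (rule mult_mat_vec_assoc3[OF outb(1)[OF k] A inb(2)[OF k] u])
      then have "sqn (Amat H k t *\<^sub>v u) = qform (obdiag W G k t) (Amat G k t *\<^sub>v w)"
        using outb(4)[OF k Aw] by simp
      also have "\<dots> \<le> sqn u - \<beta> * sqn w" using dec[OF k w] uw by simp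
      also have "\<dots> \<le> \<rho> * sqn u"
      proof -
        have "sqn u \<le> b * sqn w" using inb(3)[OF k, of t] w uw by (simp add: form_bounds_def)
        moreover have "0 \<le> \<beta> * sqn w" using \<beta> by simp
        ultimately have "sqn u \<le> (b + \<beta>) * sqn w" by (simp only: distrib_right)
        then have "\<beta> * sqn u \<le> \<beta> * ((b + \<beta>) * sqn w)" using \<beta> by (intro mult_left_mono) auto
        then have "\<beta> * sqn u / (b + \<beta>) \<le> \<beta> * sqn w" using b \<beta> by (simp add: divide_le_eq ac_simps)
        then show ?thesis by (simp add: \<rho>_def left_diff_distrib)
      qed
      finally show "sqn (Amat H k t *\<^sub>v u) \<le> \<rho> * sqn u" .
    qed
  qed
  have H: "distributed_system H"
  proof -
    have "unif_bounded (nodes G) (Amat H)" using A\<rho> by (rule unif_boundedI)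
    moreover obtain b' where b': "b' > 0" "\<And>k t. k \<in> nodes G \<Longrightarrow> sq_bounded b' (Bmat G k t)"
      using G(1) unif_boundedE[of "nodes G" "Bmat G"] unfolding distributed_system_def by blast
    have "unif_bounded (nodes G) (Bmat H)"
    proof (rule unif_boundedI)
      fix k t assume k: "k \<in> nodes G"
      show "sq_bounded (b * b') (Bmat H k t)" unfolding mats
        by (rule sq_bounded_mult[OF outb(1)[OF k] Bmat_carrier[OF G(1) k]
              sq_bounded_factor[OF outb(3)[OF k] outb(1)[OF k] outb(4)[OF k]] b'(2)[OF k] less_imp_le[OF b]])
    qed
    moreover obtain d where d: "d > 0" "\<And>k t. k \<in> nodes G \<Longrightarrow> sq_bounded d (Cmat G k t)"
      using G(1) unif_boundedE[of "nodes G" "Cmat G"] unfolding distributed_system_def by blast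
    have "unif_bounded (nodes G) (Cmat H)"
    proof (rule unif_boundedI)
      fix k t assume k: "k \<in> nodes G"
      show "sq_bounded (d * (1 / \<beta>)) (Cmat H k t)" unfolding mats
        by (rule sq_bounded_mult[OF Cmat_carrier[OF G(1) k] inb(2)[OF k] d(2)[OF k]
              sq_bounded_inverse_factor[OF inb(3)[OF k] \<beta> inb(1)[OF k] inb(2)[OF k] inb(4)[OF k] inb(5)[OF k]]
              less_imp_le[OF d(1)]])
    qed
    ultimately show ?thesis
      using G(1) inb(2) outb(1) Amat_carrier[OF G(1)] Bmat_carrier[OF G(1)] Cmat_carrier[OF G(1)]
      unfolding distributed_system_def in_dim_eq out_dim_eq Hs Hi mats
      by (blast intro: mult_carrier_mat)
  qed
  have inv: "\<forall>c\<in>items G. \<forall>t. T c t \<in> carrier_mat (dims G c t) (dims G c t) \<and>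
      Ti c t \<in> carrier_mat (dims G c t) (dims G c t) \<and>
      inverts_mat (T c t) (Ti c t) \<and> inverts_mat (Ti c t) (T c t)"
    using T(1-4) by (metis carrier_matD(1) inverts_mat_def)
  have "state_transformed G H"
    unfolding state_transformed_def in_diag_eq out_diag_eq
    by (intro conjI ballI allI exI[of _ "\<lambda>k. T (Inl k)"] exI[of _ "\<lambda>k. Ti (Inl k)"]
        exI[of _ "\<lambda>e. T (Inr e)"] exI[of _ "\<lambda>e. Ti (Inr e)"];
      use inv[unfolded items_ball dims_def sum.case] in \<open>simp add: mats\<close>)
  moreover have "etp_realization h q H"
  proof -
    have Tetp: "etp h q (T c)" "etp h q (Ti c)" if "c \<in> items G" for c
      unfolding T_def Ti_def by (rule etp_comp[OF Wetp[OF that]])+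
    have "etp h q (Amat H k) \<and> etp h q (Bmat H k) \<and> etp h q (Cmat H k)" if k: "k \<in> nodes G" for k
    proof -
      have "etp h q (Amat G k)" "etp h q (Bmat G k)" "etp h q (Cmat G k)"
        using G(3) k by (auto simp: etp_realization_def)
      moreover have "etp h q (bdiag T (out_items G k))" "etp h q (bdiag Ti (in_items G k))"
        by (rule etp_bdiag; use Tetp in_items_subset[OF G(1) k] out_items_subset[OF G(1) k] in blast)+
      moreover have "etp h q (\<lambda>t. obdiag T G k t)"
        by (rule etp_Suc) fact
      ultimately show ?thesis unfolding etp_def mats by simp
    qed
    then show ?thesis using G(3) by (auto simp: etp_realization_def etp_family_def)
  qed
  moreover obtain c where "balanced_gramians H (\<lambda>k t. c \<cdot>\<^sub>m 1\<^sub>m (tdim H k t)) (\<lambda>e t. c \<cdot>\<^sub>m 1\<^sub>m (sdim H e t))"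
    using contraction_balanced[OF H \<rho>] A\<rho> by auto
  moreover have "etp_family h q G (\<lambda>k t. c \<cdot>\<^sub>m 1\<^sub>m (tdim H k t)) (\<lambda>e t. c \<cdot>\<^sub>m 1\<^sub>m (sdim H e t))"
    using G(3) by (auto simp: etp_realization_def etp_family_def intro: etp_comp)
  ultimately show ?thesis using H unfolding balanced_realization_def by blast
qed

subsection \<open>Balanced truncation preserves balancedness\<close>

lemma sqn_pad: "sqn (pad n z) = sqn z"
  unfolding pad_def by (subst scalar_prod_append[of _ "dim_vec z" _ "n - dim_vec z"]) auto

section \<open>Partitioned gramians and their compression\<close>

lemma gramian_partitionD:
  assumes "gramian_partition r S \<Gamma> \<Omega>"
  shows "r \<le> dim_row S" "\<Gamma> \<in> carrier_mat r r" "\<Omega> \<in> carrier_mat (dim_row S - r) (dim_row S - r)"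
    "S = diag_block_mat [\<Gamma>, \<Omega>]"
  using assms unfolding gramian_partition_def by blast+

lemma gramian_partition_four_block:
  assumes "gramian_partition r S \<Gamma> \<Omega>"
  shows "S = four_block_mat \<Gamma> (0\<^sub>m r (dim_row S - r)) (0\<^sub>m (dim_row S - r) r) \<Omega>"
proof -
  note c = gramian_partitionD(2-)[OF assms]
  have "diag_block_mat [\<Gamma>, \<Omega>] = four_block_mat \<Gamma> (0\<^sub>m (dim_row \<Gamma>) (dim_col \<Omega>)) (0\<^sub>m (dim_row \<Omega>) (dim_col \<Gamma>)) \<Omega>"
    by (simp only: diag_block_mat.simps(2)[of \<Gamma>] diag_block_mat_singleton Let_def)
  with c(3) show ?thesis unfolding carrier_matD[OF c(1)] carrier_matD[OF c(2)] by (simp only:)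
qed

lemma gramian_partition_mult_pad:
  assumes p: "gramian_partition r S \<Gamma> \<Omega>" and S: "S \<in> carrier_mat n n" and z: "z \<in> carrier_vec r"
  shows "S *\<^sub>v pad n z = pad n (\<Gamma> *\<^sub>v z)"
proof -
  have n: "dim_row S = n" using S by simp
  have c: "\<Gamma> \<in> carrier_mat r r" "\<Omega> \<in> carrier_mat (n - r) (n - r)"
    using gramian_partitionD(2,3)[OF p] unfolding n by blast+
  have e: "pad n z = z @\<^sub>v 0\<^sub>v (n - r)" "pad n (\<Gamma> *\<^sub>v z) = \<Gamma> *\<^sub>v z @\<^sub>v 0\<^sub>v (n - r)"
    using z c by (simp_all add: pad_def)
  show ?thesis
    unfolding e gramian_partition_four_block[OF p, unfolded n] mult_mat_vec_split[OF c z zero_carrier_vec]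
      mult_mat_vec_zero[OF c(2)] ..
qed

lemma gramian_partition_qform:
  assumes p: "gramian_partition r S \<Gamma> \<Omega>" and S: "S \<in> carrier_mat n n" and z: "z \<in> carrier_vec r"
  shows "qform S (pad n z) = qform \<Gamma> z"
proof -
  have \<Gamma>: "\<Gamma> \<in> carrier_mat r r" by (rule gramian_partitionD[OF p])
  have \<Gamma>z: "\<Gamma> *\<^sub>v z \<in> carrier_vec r" using \<Gamma> z by (rule mult_mat_vec_carrier)
  have "qform S (pad n z) = (z @\<^sub>v 0\<^sub>v (n - r)) \<bullet> (\<Gamma> *\<^sub>v z @\<^sub>v 0\<^sub>v (n - r))"
    unfolding qform_def gramian_partition_mult_pad[OF p S z]
    by (simp only: pad_def carrier_vecD[OF z] carrier_vecD[OF \<Gamma>z])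
  also have "\<dots> = z \<bullet> (\<Gamma> *\<^sub>v z) + 0\<^sub>v (n - r) \<bullet> 0\<^sub>v (n - r)"
    by (rule scalar_prod_append[OF z zero_carrier_vec \<Gamma>z zero_carrier_vec])
  finally show ?thesis by (simp add: qform_def)
qed

lemma gramian_partition_diag_mat:
  assumes p: "gramian_partition r S \<Gamma> \<Omega>"
  shows "diag_mat S = diag_mat \<Gamma> @ diag_mat \<Omega>"
proof -
  note c = gramian_partitionD(2,3)[OF p]
  show ?thesis
    by (subst gramian_partition_four_block[OF p]) (rule diag_four_block_mat[OF c])
qed

lemma gramian_partition_entry:
  assumes p: "gramian_partition r S \<Gamma> \<Omega>" and "i < r" "j < r"
  shows "S $$ (i, j) = \<Gamma> $$ (i, j)"
proof -
  have "dim_row \<Gamma> = r" "dim_col \<Gamma> = r" using gramian_partitionD(2)[OF p] by simp_all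
  then show ?thesis using assms(2,3) by (subst gramian_partition_four_block[OF p]) simp
qed

lemma gramian_partition_diag_decreasing:
  assumes p: "gramian_partition r S \<Gamma> \<Omega>" and S: "S \<in> carrier_mat n n" "diag_decreasing S"
  shows "diag_decreasing \<Gamma>"
proof -
  have r: "r \<le> n" "dim_row \<Gamma> = r" "dim_col \<Gamma> = r"
    using gramian_partitionD(1,2)[OF p] S(1) by auto
  have "\<Gamma> $$ (i, j) = 0" if "i < r" "j < r" "i \<noteq> j" for i j
  proof -
    have "S $$ (i, j) = 0"
      using S r(1) that unfolding diag_decreasing_def diagonal_mat_def by auto
    then show ?thesis using gramian_partition_entry[OF p that(1,2)] by simp
  qed
  moreover have "sorted_wrt (\<ge>) (diag_mat \<Gamma>)"
    using S(2) gramian_partition_diag_mat[OF p] by (simp add: diag_decreasing_def sorted_wrt_append)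
  ultimately show ?thesis by (simp add: diag_decreasing_def diagonal_mat_def r)
qed

lemma qform_emb_kept:
  assumes p: "\<forall>c\<in>set l. gramian_partition (r c) (S c) (\<Gamma> c) (\<Omega> c)"
    and S: "\<forall>c\<in>set l. S c \<in> carrier_mat (n c) (n c)" and l: "distinct l"
    and z: "z \<in> carrier_vec (\<Sum>c\<leftarrow>l. r c)"
  shows "qform (diag_block_mat (map S l)) (emb (kept (map (\<lambda>c. (n c, r c)) l)) (\<Sum>c\<leftarrow>l. n c) z) =
    qform (diag_block_mat (map \<Gamma> l)) z"
proof -
  obtain f where f: "\<forall>c\<in>set l. f c \<in> carrier_vec (r c)" "z = vconcat (map f l)"
    using vconcat_decompose[OF z l] by blast
  have r: "\<forall>c\<in>set l. r c \<le> n c" using p S gramian_partitionD(1) by (metis carrier_matD(1))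
  have \<Gamma>: "\<forall>c\<in>set l. \<Gamma> c \<in> carrier_mat (r c) (r c)" using p gramian_partitionD(2) by blast
  have pf: "\<forall>c\<in>set l. pad (n c) (f c) \<in> carrier_vec (n c)"
    using f(1) r by (metis carrier_vecD pad_carrier)
  show ?thesis
    unfolding f(2) emb_kept_vconcat[OF r f(1)] qform_diag_block_mat[OF S pf] qform_diag_block_mat[OF \<Gamma> f(1)]
    using p S f(1) by (intro arg_cong[where f = sum_list] map_cong refl gramian_partition_qform) blast+
qed

text \<open>Diagonality of the gramians enters here: zeroing coordinates deletes nonnegative terms.
  For a general positive definite matrix it can increase the form.\<close>

lemma qform_emb_sel_le:
  assumes S: "diagonal_mat S" "S \<in> carrier_mat n n" and pos: "\<And>i. i < n \<Longrightarrow> 0 \<le> S $$ (i, i)"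
    and v: "v \<in> carrier_vec n"
  shows "qform S (emb C n (sel C v)) \<le> qform S v"
proof -
  have n: "n = dim_vec v" using v by simp
  show ?thesis
    unfolding qform_diagonal[OF S v] qform_diagonal[OF S emb_carrier]
    using pos v emb_sel[of _ v C] by (intro sum_mono) (auto simp flip: n)
qed

section \<open>Realization and gramians of the truncated system\<close>

lemma zip_map_same: "zip (map f l) (map g l) = map (\<lambda>c. (f c, g c)) l"
  by (induction l) auto

abbreviation keep :: "dsys \<Rightarrow> (item \<Rightarrow> nat \<Rightarrow> nat) \<Rightarrow> item list \<Rightarrow> nat \<Rightarrow> nat set" where
  "keep H r l t \<equiv> kept (map (\<lambda>c. (dims H c t, r c t)) l)"

lemma truncation_simps:
  "nnodes (truncation H r rs) = nnodes H" "edges (truncation H r rs) = edges H"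
  "tdim (truncation H r rs) = r" "sdim (truncation H r rs) = rs"
  "udim (truncation H r rs) = udim H" "ydim (truncation H r rs) = ydim H"
  "Dmat (truncation H r rs) = Dmat H" "dims (truncation H r rs) = case_sum r rs"
  "Amat (truncation H r rs) k t =
     submatrix (Amat H k t) (keep H (case_sum r rs) (out_items H k) (t + 1)) (keep H (case_sum r rs) (in_items H k) t)"
  "Bmat (truncation H r rs) k t =
     submatrix (Bmat H k t) (keep H (case_sum r rs) (out_items H k) (t + 1)) UNIV"
  "Cmat (truncation H r rs) k t =
     submatrix (Cmat H k t) UNIV (keep H (case_sum r rs) (in_items H k) t)"
  by (simp_all add: truncation_def Let_def outs_eq ins_eq zip_map_same dims_def)

lemma truncation_items:
  "in_items (truncation H r rs) k = in_items H k" "out_items (truncation H r rs) k = out_items H k"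
  "items (truncation H r rs) = items H"
  by (rule items_cong; simp add: truncation_simps)+

lemma balanced_gramiansE:
  assumes H: "distributed_system H" and g: "balanced_gramians H \<Sigma> \<Sigma>s"
  obtains \<beta> b where "\<beta> > 0" "\<beta> < b" "gramian_family H \<beta> \<Sigma> \<Sigma>s"
    "\<And>c t. c \<in> items H \<Longrightarrow> diag_decreasing (case_sum \<Sigma> \<Sigma>s c t)"
    "\<And>c t. c \<in> items H \<Longrightarrow> form_bounds \<beta> b (dims H c t) (case_sum \<Sigma> \<Sigma>s c t)"
    "\<And>k t v. k \<in> nodes H \<Longrightarrow> v \<in> carrier_vec (odim H k t) \<Longrightarrow>
       v \<noteq> 0\<^sub>v (odim H k t) \<Longrightarrow>
       qform (ibdiag (case_sum \<Sigma> \<Sigma>s) H k t) ((Amat H k t)\<^sup>T *\<^sub>v v) -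
       qform (obdiag (case_sum \<Sigma> \<Sigma>s) H k t) v + sqn ((Bmat H k t)\<^sup>T *\<^sub>v v) < - \<beta> * sqn v"
    "\<And>k t v. k \<in> nodes H \<Longrightarrow> v \<in> carrier_vec (idim H k t) \<Longrightarrow>
       v \<noteq> 0\<^sub>v (idim H k t) \<Longrightarrow>
       qform (obdiag (case_sum \<Sigma> \<Sigma>s) H k t) (Amat H k t *\<^sub>v v) -
       qform (ibdiag (case_sum \<Sigma> \<Sigma>s) H k t) v + sqn (Cmat H k t *\<^sub>v v) < - \<beta> * sqn v"
proof -
  let ?S = "case_sum \<Sigma> \<Sigma>s"
  have dec: "\<forall>c\<in>items H. \<forall>t. diag_decreasing (?S c t)"
    using g unfolding balanced_gramians_def items_ball sum.case by blast
  obtain \<beta> where \<beta>: "\<beta> > 0" and fam: "gramian_family H \<beta> \<Sigma> \<Sigma>s"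
    and lt: "\<And>k t. k \<in> nodes H \<Longrightarrow> mat_lt (Amat H k t * ibdiag ?S H k t * (Amat H k t)\<^sup>T -
      obdiag ?S H k t + Bmat H k t * (Bmat H k t)\<^sup>T) (- \<beta>)"
    "\<And>k t. k \<in> nodes H \<Longrightarrow> mat_lt ((Amat H k t)\<^sup>T * obdiag ?S H k t * Amat H k t -
      ibdiag ?S H k t + (Cmat H k t)\<^sup>T * Cmat H k t) (- \<beta>)"
    using g unfolding balanced_gramians_def in_diag_eq out_diag_eq by blast
  obtain b where b: "b > 0" "\<And>c t. c \<in> items H \<Longrightarrow> form_bounds \<beta> b (dims H c t) (?S c t)"
    using gramian_family_form_bounds[OF fam] by blast
  \<comment> \<open>Enlarging the upper bound by \<beta> gives \<open>\<beta> < b\<close>, so that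
    \<open>1 - \<beta> / b\<close> is positive in the error bound.\<close>
  have fb: "form_bounds \<beta> (b + \<beta>) (dims H c t) (?S c t)" if "c \<in> items H" for c t
  proof -
    have "b * sqn v \<le> (b + \<beta>) * sqn v" for v using \<beta> by (intro mult_right_mono) auto
    with b(2)[OF that, of t] show ?thesis unfolding form_bounds_def by (meson order_trans)
  qed
  have bl: "bdiag ?S l s \<in> carrier_mat (ldim H l s) (ldim H l s)" "(bdiag ?S l s)\<^sup>T = bdiag ?S l s"
    if "set l \<subseteq> items H" "distinct l" for l s
  proof -
    have "form_bounds \<beta> b (ldim H l s) (bdiag ?S l s)"
      by (rule form_bounds_bdiag) (use b(2) that in blast)+
    then show "bdiag ?S l s \<in> carrier_mat (ldim H l s) (ldim H l s)" "(bdiag ?S l s)\<^sup>T = bdiag ?S l s"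
      unfolding form_bounds_def by blast+
  qed
  note bin = bl[OF in_items_subset[OF H] distinct_in_items[OF H]]
    and bout = bl[OF out_items_subset[OF H] distinct_out_items[OF H]]
  show thesis
  proof (rule that[OF \<beta> _ fam])
    show "\<beta> < b + \<beta>" using b(1) by simp
    show "diag_decreasing (?S c t)" if "c \<in> items H" for c t using dec that by blast
    show "form_bounds \<beta> (b + \<beta>) (dims H c t) (?S c t)" if "c \<in> items H" for c t by (rule fb[OF that])
    fix k t v assume k: "k \<in> nodes H"
    show "v \<in> carrier_vec (odim H k t) \<Longrightarrow>
       v \<noteq> 0\<^sub>v (odim H k t) \<Longrightarrow>
       qform (ibdiag ?S H k t) ((Amat H k t)\<^sup>T *\<^sub>v v) -
       qform (obdiag ?S H k t) v + sqn ((Bmat H k t)\<^sup>T *\<^sub>v v) < - \<beta> * sqn v"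
      using lt(1)[OF k, of t] mat_lt_gramian_dual_iff[OF Amat_carrier[OF H k] bin[OF k] bout[OF k]
          Bmat_carrier[OF H k]] by blast
    show "v \<in> carrier_vec (idim H k t) \<Longrightarrow>
       v \<noteq> 0\<^sub>v (idim H k t) \<Longrightarrow>
       qform (obdiag ?S H k t) (Amat H k t *\<^sub>v v) -
       qform (ibdiag ?S H k t) v + sqn (Cmat H k t *\<^sub>v v) < - \<beta> * sqn v"
      using lt(2)[OF k, of t] mat_lt_gramian_iff[OF Amat_carrier[OF H k] bout[OF k] bin[OF k]
          Cmat_carrier[OF H k]] by blast
  qed
qed

lemma sq_bounded_submatrix:
  assumes A: "A \<in> carrier_mat m n" and b: "sq_bounded b A"
  shows "sq_bounded b (submatrix A R C)"
proof (rule sq_boundedI)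
  show "submatrix A R C \<in> carrier_mat (card {i. i < m \<and> i \<in> R}) (card {j. j < n \<and> j \<in> C})"
    using A by (intro carrier_matI) (simp_all add: dim_submatrix)
  fix z :: "real vec" assume "z \<in> carrier_vec (card {j. j < n \<and> j \<in> C})"
  then have z: "dim_vec z = card {j. j < n \<and> j \<in> C}" by simp
  have "sqn (submatrix A R C *\<^sub>v z) = sqn (sel R (A *\<^sub>v emb C n z))"
    using submatrix_mult_vec[of z A C R] A z by simp
  also have "\<dots> \<le> sqn (A *\<^sub>v emb C n z)" by (rule sqn_sel_le)
  also have "\<dots> \<le> b * sqn (emb C n z)" by (rule sq_boundedD[OF b A emb_carrier])
  finally show "sqn (submatrix A R C *\<^sub>v z) \<le> b * sqn z" by (simp add: sqn_emb[OF z])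
qed

context
  fixes H :: dsys and \<Sigma> \<Sigma>s r rs \<Gamma> \<Gamma>s \<Omega> \<Omega>s
  assumes H: "distributed_system H" and gram: "balanced_gramians H \<Sigma> \<Sigma>s"
    and partition: "\<forall>c\<in>items H. \<forall>t. gramian_partition (case_sum r rs c t) (case_sum \<Sigma> \<Sigma>s c t)
      (case_sum \<Gamma> \<Gamma>s c t) (case_sum \<Omega> \<Omega>s c t)"
begin

lemma item_partition: "c \<in> items H \<Longrightarrow> gramian_partition (case_sum r rs c t) (case_sum \<Sigma> \<Sigma>s c t)
    (case_sum \<Gamma> \<Gamma>s c t) (case_sum \<Omega> \<Omega>s c t)"
  using partition by blast

lemma gramian_carrier: "c \<in> items H \<Longrightarrow> case_sum \<Sigma> \<Sigma>s c t \<in> carrier_mat (dims H c t) (dims H c t)"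
  using balanced_gramiansE[OF H gram] unfolding gramian_family_iff by metis

lemma order_le: "c \<in> items H \<Longrightarrow> case_sum r rs c t \<le> dims H c t"
  using gramian_partitionD(1)[OF item_partition, of c t] carrier_matD(1)[OF gramian_carrier, of c t] by simp

lemma card_keep:
  "set l \<subseteq> items H \<Longrightarrow> card {i. i < ldim H l t \<and> i \<in> keep H (case_sum r rs) l t} =
     (\<Sum>c\<leftarrow>l. case_sum r rs c t)"
  by (rule card_kept) (use order_le in blast)

lemma truncation_distributed_system: "distributed_system (truncation H r rs)"
proof -
  let ?K = "truncation H r rs"
  have c: "Amat ?K k t \<in> carrier_mat (\<Sum>c\<leftarrow>out_items H k. case_sum r rs c (t + 1)) (\<Sum>c\<leftarrow>in_items H k. case_sum r rs c t)"
    "Bmat ?K k t \<in> carrier_mat (\<Sum>c\<leftarrow>out_items H k. case_sum r rs c (t + 1)) (udim H k t)"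
    "Cmat ?K k t \<in> carrier_mat (ydim H k t) (\<Sum>c\<leftarrow>in_items H k. case_sum r rs c t)"
    if k: "k \<in> nodes H" for k t
    unfolding truncation_simps
    using Amat_carrier[OF H k, of t] Bmat_carrier[OF H k, of t] Cmat_carrier[OF H k, of t]
      card_keep[OF out_items_subset[OF H k], of "t + 1"] card_keep[OF in_items_subset[OF H k], of t]
    by (auto intro!: carrier_matI simp: dim_submatrix)
  have ub: "unif_bounded (nodes H) (Amat ?K)" "unif_bounded (nodes H) (Bmat ?K)" "unif_bounded (nodes H) (Cmat ?K)"
  proof -
    have *: "unif_bounded (nodes H) (Amat H)" "unif_bounded (nodes H) (Bmat H)" "unif_bounded (nodes H) (Cmat H)"
      using H unfolding distributed_system_def by blast+
    obtain a where a: "\<And>k t. k \<in> nodes H \<Longrightarrow> sq_bounded a (Amat H k t)"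
      using unif_boundedE[OF *(1)] by blast
    obtain b where b: "\<And>k t. k \<in> nodes H \<Longrightarrow> sq_bounded b (Bmat H k t)"
      using unif_boundedE[OF *(2)] by blast
    obtain d where d: "\<And>k t. k \<in> nodes H \<Longrightarrow> sq_bounded d (Cmat H k t)"
      using unif_boundedE[OF *(3)] by blast
    show "unif_bounded (nodes H) (Amat ?K)"
      by (rule unif_boundedI, unfold truncation_simps) (rule sq_bounded_submatrix[OF Amat_carrier[OF H] a])
    show "unif_bounded (nodes H) (Bmat ?K)"
      by (rule unif_boundedI, unfold truncation_simps) (rule sq_bounded_submatrix[OF Bmat_carrier[OF H] b])
    show "unif_bounded (nodes H) (Cmat ?K)"
      by (rule unif_boundedI, unfold truncation_simps) (rule sq_bounded_submatrix[OF Cmat_carrier[OF H] d])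
  qed
  show ?thesis
    using H c ub unfolding distributed_system_def in_dim_eq out_dim_eq truncation_items truncation_simps(1-8)
    by blast
qed

text \<open>A reduced vector, embedded with zeros, satisfies the strict inequality of
  \<open>H\<close>. Embedding preserves its norm and the subtracted form, and the form at the image
  only shrinks when the truncated coordinates are dropped, so both inequalities survive with the
  same \<beta>. The first one is treated like the second because the transpose of a submatrix is a
  submatrix of the transpose.\<close>

lemma truncation_balanced_gramians: "balanced_gramians (truncation H r rs) \<Gamma> \<Gamma>s"
proof -
  let ?K = "truncation H r rs" and ?S = "case_sum \<Sigma> \<Sigma>s" and ?\<Gamma> = "case_sum \<Gamma> \<Gamma>s" and ?r = "case_sum r rs"
  obtain \<beta> b where \<beta>: "\<beta> > 0" and "\<beta> < b" and fam: "gramian_family H \<beta> \<Sigma> \<Sigma>s"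
    and dec: "\<And>c t. c \<in> items H \<Longrightarrow> diag_decreasing (?S c t)"
    and fb: "\<And>c t. c \<in> items H \<Longrightarrow> form_bounds \<beta> b (dims H c t) (?S c t)"
    and lc: "\<And>k t v. k \<in> nodes H \<Longrightarrow> v \<in> carrier_vec (odim H k t) \<Longrightarrow>
       v \<noteq> 0\<^sub>v (odim H k t) \<Longrightarrow>
       qform (ibdiag ?S H k t) ((Amat H k t)\<^sup>T *\<^sub>v v) -
       qform (obdiag ?S H k t) v + sqn ((Bmat H k t)\<^sup>T *\<^sub>v v) < - \<beta> * sqn v"
    and lo: "\<And>k t v. k \<in> nodes H \<Longrightarrow> v \<in> carrier_vec (idim H k t) \<Longrightarrow>
       v \<noteq> 0\<^sub>v (idim H k t) \<Longrightarrow>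
       qform (obdiag ?S H k t) (Amat H k t *\<^sub>v v) -
       qform (ibdiag ?S H k t) v + sqn (Cmat H k t *\<^sub>v v) < - \<beta> * sqn v"
    by (rule balanced_gramiansE[OF H gram]) (rule that)
  have S: "?S c t \<in> carrier_mat (dims H c t) (dims H c t)" if "c \<in> items H" for c t
    by (rule gramian_carrier[OF that])
  have \<Gamma>: "?\<Gamma> c t \<in> carrier_mat (?r c t) (?r c t)" if "c \<in> items H" for c t
    by (rule gramian_partitionD(2)[OF item_partition[OF that]])
  have \<Gamma>dec: "diag_decreasing (?\<Gamma> c t)" if "c \<in> items H" for c t
    by (rule gramian_partition_diag_decreasing[OF item_partition[OF that] S[OF that] dec[OF that]])
  have \<Gamma>sym: "(?\<Gamma> c t)\<^sup>T = ?\<Gamma> c t" if "c \<in> items H" for c t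
    using \<Gamma>dec[OF that] \<Gamma>[OF that] by (intro diagonal_transpose) (auto simp: diag_decreasing_def)
  have "gramian_family ?K \<beta> \<Gamma> \<Gamma>s"
    unfolding gramian_family_iff truncation_items truncation_simps
  proof (intro conjI ballI allI)
    fix c t assume c: "c \<in> items H"
    show "?\<Gamma> c t \<in> carrier_mat (?r c t) (?r c t)" by (rule \<Gamma>[OF c])
    show "mat_gt (?\<Gamma> c t) \<beta>"
      unfolding mat_gt_iff[OF \<Gamma>[OF c]]
    proof (intro conjI ballI impI)
      fix v :: "real vec" assume v: "v \<in> carrier_vec (?r c t)" "v \<noteq> 0\<^sub>v (?r c t)"
      have p: "pad (dims H c t) v \<in> carrier_vec (dims H c t)"
        by (rule pad_carrier) (use v(1) order_le[OF c, of t] in simp)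
      have "pad (dims H c t) v \<noteq> 0\<^sub>v (dims H c t)"
        using sqn_pos[OF v] sqn_pad[of "dims H c t" v] sqn_eq_0_iff[OF p] by auto
      then have "\<beta> * sqn (pad (dims H c t) v) < qform (?S c t) (pad (dims H c t) v)"
        using fam p c mat_gt_iff[OF S[OF c]] unfolding gramian_family_iff by blast
      then show "\<beta> * sqn v < qform (?\<Gamma> c t) v"
        by (simp only: sqn_pad gramian_partition_qform[OF item_partition[OF c] S[OF c] v(1)])
    qed (rule \<Gamma>sym[OF c])
  next
    obtain d where d: "\<And>c t. c \<in> items H \<Longrightarrow> sq_bounded d (?S c t)"
      using fam unif_boundedE unfolding gramian_family_iff by metis
    show "unif_bounded (items H) ?\<Gamma>"
    proof (rule unif_boundedI, rule sq_boundedI[OF \<Gamma>])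
      fix c t and v :: "real vec" assume c: "c \<in> items H" and v: "v \<in> carrier_vec (?r c t)"
      have p: "pad (dims H c t) v \<in> carrier_vec (dims H c t)"
        by (rule pad_carrier) (use v(1) order_le[OF c, of t] in simp)
      from sq_boundedD[OF d[OF c] S[OF c] p] show "sqn (?\<Gamma> c t *\<^sub>v v) \<le> d * sqn v"
        by (simp only: gramian_partition_mult_pad[OF item_partition[OF c] S[OF c] v] sqn_pad)
    qed
  qed
  moreover have "mat_lt (Amat ?K k t * ibdiag ?\<Gamma> H k t * (Amat ?K k t)\<^sup>T -
      obdiag ?\<Gamma> H k t + Bmat ?K k t * (Bmat ?K k t)\<^sup>T) (- \<beta>) \<and>
    mat_lt ((Amat ?K k t)\<^sup>T * obdiag ?\<Gamma> H k t * Amat ?K k t -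
      ibdiag ?\<Gamma> H k t + (Cmat ?K k t)\<^sup>T * Cmat ?K k t) (- \<beta>)"
    if k: "k \<in> nodes H" for k t
  proof
    let ?i = "in_items H k" and ?o = "out_items H k"
    let ?n = "idim H k t" and ?m = "odim H k t"
    let ?n' = "\<Sum>c\<leftarrow>?i. ?r c t" and ?m' = "\<Sum>c\<leftarrow>?o. ?r c (t + 1)"
    let ?C = "keep H ?r ?i t" and ?R = "keep H ?r ?o (t + 1)"
    note i = in_items_subset[OF H k] and o = out_items_subset[OF H k]
    note din = distinct_in_items[OF H, of k] and dout = distinct_out_items[OF H, of k]
    have kK: "k \<in> nodes ?K" using k by (simp only: truncation_simps)
    have A: "Amat H k t \<in> carrier_mat ?m ?n" and B: "Bmat H k t \<in> carrier_mat ?m (udim H k t)"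
      and C: "Cmat H k t \<in> carrier_mat (ydim H k t) ?n"
      by (rule Amat_carrier[OF H k] Bmat_carrier[OF H k] Cmat_carrier[OF H k])+
    have AK: "Amat ?K k t \<in> carrier_mat ?m' ?n'" and BK: "Bmat ?K k t \<in> carrier_mat ?m' (udim H k t)"
      and CK: "Cmat ?K k t \<in> carrier_mat (ydim H k t) ?n'"
      using Amat_carrier[OF truncation_distributed_system kK, of t]
        Bmat_carrier[OF truncation_distributed_system kK, of t]
        Cmat_carrier[OF truncation_distributed_system kK, of t]
      by (simp_all only: truncation_items truncation_simps(1-8))
    have \<Gamma>i: "bdiag ?\<Gamma> ?i t \<in> carrier_mat ?n' ?n'" "(bdiag ?\<Gamma> ?i t)\<^sup>T = bdiag ?\<Gamma> ?i t"
      using \<Gamma> \<Gamma>sym i by (blast intro: diag_block_mat_carrier transpose_diag_block_mat_id)+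
    have \<Gamma>o: "bdiag ?\<Gamma> ?o (t + 1) \<in> carrier_mat ?m' ?m'" "(bdiag ?\<Gamma> ?o (t + 1))\<^sup>T = bdiag ?\<Gamma> ?o (t + 1)"
      using \<Gamma> \<Gamma>sym o by (blast intro: diag_block_mat_carrier transpose_diag_block_mat_id)+
    have ci: "card {j. j < ?n \<and> j \<in> ?C} = ?n'" by (rule card_keep[OF i])
    have co: "card {j. j < ?m \<and> j \<in> ?R} = ?m'" by (rule card_keep[OF o])
    have emb: "qform (bdiag ?S l s) (emb (keep H ?r l s) (ldim H l s) z) = qform (bdiag ?\<Gamma> l s) z"
      if "set l \<subseteq> items H" "distinct l" "z \<in> carrier_vec (\<Sum>c\<leftarrow>l. ?r c s)" for l s z
    proof -
      have "\<forall>c\<in>set l. gramian_partition (?r c s) (?S c s) (?\<Gamma> c s) (case_sum \<Omega> \<Omega>s c s)"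
        "\<forall>c\<in>set l. ?S c s \<in> carrier_mat (dims H c s) (dims H c s)"
        using item_partition S that(1) by blast+
      then show ?thesis by (rule qform_emb_kept) (use that(2,3) in simp_all)
    qed
    have qi: "qform (bdiag ?S ?i t) (emb ?C ?n z) = qform (bdiag ?\<Gamma> ?i t) z" if "z \<in> carrier_vec ?n'" for z
      by (rule emb[OF i din that])
    have qo: "qform (bdiag ?S ?o (t + 1)) (emb ?R ?m z) = qform (bdiag ?\<Gamma> ?o (t + 1)) z" if "z \<in> carrier_vec ?m'" for z
      by (rule emb[OF o dout that])
    have compress: "qform (bdiag ?\<Gamma> l s) (sel (keep H ?r l s) v) \<le> qform (bdiag ?S l s) v"
      if l: "set l \<subseteq> items H" "distinct l" and v: "v \<in> carrier_vec (ldim H l s)" for l s v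
    proof -
      let ?N = "ldim H l s"
      have Sl: "\<forall>c\<in>set l. ?S c s \<in> carrier_mat (dims H c s) (dims H c s)" using S l(1) by blast
      have dg: "diagonal_mat (bdiag ?S l s)"
        by (rule diagonal_diag_block_mat[OF Sl]) (use dec l(1) in \<open>auto simp: diag_decreasing_def\<close>)
      have fbl: "form_bounds \<beta> b ?N (bdiag ?S l s)"
        using fb l by (intro form_bounds_bdiag) blast+
      have pos: "0 \<le> bdiag ?S l s $$ (j, j)" if j: "j < ?N" for j
      proof -
        have "0 \<le> \<beta> * sqn (unit_vec ?N j)" using \<beta> by simp
        also have "\<dots> \<le> qform (bdiag ?S l s) (unit_vec ?N j)"
          using fbl by (simp add: form_bounds_def)
        also have "\<dots> = bdiag ?S l s $$ (j, j)"
          using diag_block_mat_carrier[OF Sl] j by (simp add: qform_def)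
        finally show ?thesis .
      qed
      have "sel (keep H ?r l s) v \<in> carrier_vec (\<Sum>c\<leftarrow>l. ?r c s)"
        using card_keep[OF l(1), of s] v by (intro carrier_vecI) simp
      then have "qform (bdiag ?\<Gamma> l s) (sel (keep H ?r l s) v) =
        qform (bdiag ?S l s) (emb (keep H ?r l s) ?N (sel (keep H ?r l s) v))"
        by (rule emb[OF l, symmetric])
      also have "\<dots> \<le> qform (bdiag ?S l s) v"
        by (rule qform_emb_sel_le[OF dg diag_block_mat_carrier[OF Sl] pos v])
      finally show ?thesis .
    qed
    show "mat_lt (Amat ?K k t * ibdiag ?\<Gamma> H k t * (Amat ?K k t)\<^sup>T -
      obdiag ?\<Gamma> H k t + Bmat ?K k t * (Bmat ?K k t)\<^sup>T) (- \<beta>)"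
      unfolding mat_lt_gramian_dual_iff[OF AK \<Gamma>i \<Gamma>o BK]
    proof (intro ballI impI)
      fix v :: "real vec" assume v: "v \<in> carrier_vec ?m'" "v \<noteq> 0\<^sub>v ?m'"
      let ?e = "emb ?R ?m v"
      have dv: "dim_vec v = card {j. j < ?m \<and> j \<in> ?R}" using v(1) co by simp
      have e: "sqn ?e = sqn v" by (rule sqn_emb[OF dv])
      then have e0: "?e \<noteq> 0\<^sub>v ?m" using sqn_pos[OF v] sqn_eq_0_iff[OF emb_carrier] by auto
      have "(Amat ?K k t)\<^sup>T *\<^sub>v v = sel ?C ((Amat H k t)\<^sup>T *\<^sub>v ?e)"
        unfolding truncation_simps transpose_submatrix
        using submatrix_mult_vec[of v "(Amat H k t)\<^sup>T" ?R ?C] A dv by simp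
      moreover have "(Bmat ?K k t)\<^sup>T *\<^sub>v v = (Bmat H k t)\<^sup>T *\<^sub>v ?e"
        unfolding truncation_simps transpose_submatrix
        using submatrix_mult_vec[of v "(Bmat H k t)\<^sup>T" ?R UNIV] B dv by simp
      moreover have "(Amat H k t)\<^sup>T *\<^sub>v ?e \<in> carrier_vec ?n"
        using A by (intro mult_mat_vec_carrier[of _ _ ?m]) simp_all
      from compress[OF i din this]
      have "qform (bdiag ?\<Gamma> ?i t) (sel ?C ((Amat H k t)\<^sup>T *\<^sub>v ?e)) \<le> qform (bdiag ?S ?i t) ((Amat H k t)\<^sup>T *\<^sub>v ?e)" .
      ultimately show "qform (bdiag ?\<Gamma> ?i t) ((Amat ?K k t)\<^sup>T *\<^sub>v v) -
          qform (bdiag ?\<Gamma> ?o (t + 1)) v + sqn ((Bmat ?K k t)\<^sup>T *\<^sub>v v) < - \<beta> * sqn v"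
        using lc[OF k emb_carrier e0] qo[OF v(1)] e by simp
    qed
    show "mat_lt ((Amat ?K k t)\<^sup>T * obdiag ?\<Gamma> H k t * Amat ?K k t -
      ibdiag ?\<Gamma> H k t + (Cmat ?K k t)\<^sup>T * Cmat ?K k t) (- \<beta>)"
      unfolding mat_lt_gramian_iff[OF AK \<Gamma>o \<Gamma>i CK]
    proof (intro ballI impI)
      fix v :: "real vec" assume v: "v \<in> carrier_vec ?n'" "v \<noteq> 0\<^sub>v ?n'"
      let ?e = "emb ?C ?n v"
      have dv: "dim_vec v = card {j. j < ?n \<and> j \<in> ?C}" using v(1) ci by simp
      have e: "sqn ?e = sqn v" by (rule sqn_emb[OF dv])
      then have e0: "?e \<noteq> 0\<^sub>v ?n" using sqn_pos[OF v] sqn_eq_0_iff[OF emb_carrier] by auto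
      have "Amat ?K k t *\<^sub>v v = sel ?R (Amat H k t *\<^sub>v ?e)"
        unfolding truncation_simps using submatrix_mult_vec[of v "Amat H k t" ?C ?R] A dv by simp
      moreover have "Cmat ?K k t *\<^sub>v v = Cmat H k t *\<^sub>v ?e"
        unfolding truncation_simps using submatrix_mult_vec[of v "Cmat H k t" ?C UNIV] C dv by simp
      moreover have "Amat H k t *\<^sub>v ?e \<in> carrier_vec ?m"
        using A by (intro mult_mat_vec_carrier[of _ _ ?n]) simp_all
      from compress[OF o dout this]
      have "qform (bdiag ?\<Gamma> ?o (t + 1)) (sel ?R (Amat H k t *\<^sub>v ?e)) \<le> qform (bdiag ?S ?o (t + 1)) (Amat H k t *\<^sub>v ?e)" .
      ultimately show "qform (bdiag ?\<Gamma> ?o (t + 1)) (Amat ?K k t *\<^sub>v v) -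
          qform (bdiag ?\<Gamma> ?i t) v + sqn (Cmat ?K k t *\<^sub>v v) < - \<beta> * sqn v"
        using lo[OF k emb_carrier e0] qi[OF v(1)] e by simp
    qed
  qed
  moreover have "(\<forall>k\<in>nodes H. \<forall>t. diag_decreasing (\<Gamma> k t)) \<and> (\<forall>e\<in>edges H. \<forall>t. diag_decreasing (\<Gamma>s e t))"
  proof -
    have "\<forall>c\<in>items H. \<forall>t. diag_decreasing (?\<Gamma> c t)" using \<Gamma>dec by blast
    then show ?thesis unfolding items_ball sum.case .
  qed
  ultimately show ?thesis
    unfolding balanced_gramians_def in_diag_eq out_diag_eq truncation_items truncation_simps(1,2)
    using \<beta> by blast
qed

end

text \<open>The truncated system is balanced as it stands, so the identity transformation makes it
  its own balanced realization.\<close>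

lemma state_transformed_refl:
  assumes G: "distributed_system G" shows "state_transformed G G"
proof -
  have one: "bdiag (case_sum (\<lambda>k t. 1\<^sub>m (tdim G k t)) (\<lambda>e t. 1\<^sub>m (sdim G e t))) l t =
    1\<^sub>m (ldim G l t)" for l t
  proof -
    have "case_sum (\<lambda>k t. 1\<^sub>m (tdim G k t)) (\<lambda>e t. 1\<^sub>m (sdim G e t)) = (\<lambda>c t. 1\<^sub>m (dims G c t) :: real mat)"
      by (intro ext) (simp add: dims_def split: sum.split)
    then show ?thesis by (simp only: diag_block_mat_one)
  qed
  have "Amat G k t = 1\<^sub>m (odim G k t) * Amat G k t * 1\<^sub>m (idim G k t)"
    "Bmat G k t = 1\<^sub>m (odim G k t) * Bmat G k t"
    "Cmat G k t = Cmat G k t * 1\<^sub>m (idim G k t)" if "k \<in> nodes G" for k t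
    by (simp_all only: left_mult_one_mat[OF Amat_carrier[OF G that]] right_mult_one_mat[OF Amat_carrier[OF G that]]
        left_mult_one_mat[OF Bmat_carrier[OF G that]] right_mult_one_mat[OF Cmat_carrier[OF G that]])
  moreover have "inverts_mat (1\<^sub>m n) (1\<^sub>m n :: real mat)" for n by (simp add: inverts_mat_def)
  ultimately show ?thesis
    unfolding state_transformed_def in_diag_eq out_diag_eq
    by (intro conjI ballI allI exI[of _ "\<lambda>k t. 1\<^sub>m (tdim G k t)"] exI[of _ "\<lambda>e t. 1\<^sub>m (sdim G e t)"])
      (simp_all only: one one_carrier_mat)
qed

lemma truncation_etp:
  assumes H: "distributed_system H" "etp_realization h q H" and r: "etp_family h q H r rs"
  shows "etp_realization h q (truncation H r rs)"
proof -
  have d: "\<forall>c\<in>items H. etp h q (dims H c)" "\<forall>c\<in>items H. etp h q (case_sum r rs c)"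
    using etp_realization_dims[OF H(2)] r unfolding etp_family_iff by blast+
  have K: "etp h q (keep H (case_sum r rs) l)" if l: "set l \<subseteq> items H" for l
  proof -
    have "\<forall>c\<in>set l. etp h q (\<lambda>t. (dims H c t, case_sum r rs c t))"
      using d l by (auto intro: etp_comp2)
    from etp_comp[OF etp_map[OF this]] show ?thesis .
  qed
  have "etp h q (Amat (truncation H r rs) k) \<and> etp h q (Bmat (truncation H r rs) k) \<and>
    etp h q (Cmat (truncation H r rs) k)" if k: "k \<in> nodes H" for k
  proof -
    have "etp h q (Amat H k)" "etp h q (Bmat H k)" "etp h q (Cmat H k)"
      using H(2) k by (auto simp: etp_realization_def)
    moreover have "etp h q (keep H (case_sum r rs) (in_items H k))"
      by (rule K[OF in_items_subset[OF H(1) k]])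
    moreover have "etp h q (\<lambda>t. keep H (case_sum r rs) (out_items H k) (t + 1))"
      by (rule etp_Suc[OF K[OF out_items_subset[OF H(1) k]]])
    ultimately show ?thesis unfolding etp_def truncation_simps by simp
  qed
  then show ?thesis
    using H(2) r by (simp add: etp_realization_def etp_family_def truncation_simps)
qed

subsection \<open>Truncated signal norms\<close>

text \<open>The norm up to a finite horizon, which is finite for every signal. The storage argument
  and the triangle inequality take place here; summability arises only at the end, in
  \<open>l2_ratio_le\<close>.\<close>

definition l2_upto :: "nat set \<Rightarrow> nat \<Rightarrow> signal \<Rightarrow> real" where
  "l2_upto V T w = sqrt (\<Sum>t<T. \<Sum>k\<in>V. sqn (w k t))"

lemma sqrt_sqn_triangle:
  assumes "dim_vec v = dim_vec w"
  shows "sqrt (sqn (v + w)) \<le> sqrt (sqn v) + sqrt (sqn w)"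
proof -
  have "sqrt (sqn (v + w)) = L2_set (\<lambda>i. v $ i + w $ i) {..<dim_vec w}"
    by (simp add: sqn_sum L2_set_def)
  also have "\<dots> \<le> L2_set (\<lambda>i. v $ i) {..<dim_vec w} + L2_set (\<lambda>i. w $ i) {..<dim_vec w}"
    by (rule L2_set_triangle_ineq)
  finally show ?thesis using assms by (simp add: sqn_sum L2_set_def)
qed

lemma l2_upto_L2_set: "l2_upto V T w = L2_set (\<lambda>(t, k). sqrt (sqn (w k t))) ({..<T} \<times> V)"
  by (simp add: l2_upto_def L2_set_def sum.cartesian_product split_beta)

lemma l2_upto_triangle:
  assumes "\<And>k t. k \<in> V \<Longrightarrow> dim_vec (v k t) = dim_vec (w k t)"
    and "\<And>k t. k \<in> V \<Longrightarrow> z k t = v k t + w k t"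
  shows "l2_upto V T z \<le> l2_upto V T v + l2_upto V T w"
proof -
  have "l2_upto V T z \<le> L2_set (\<lambda>(t, k). sqrt (sqn (v k t)) + sqrt (sqn (w k t))) ({..<T} \<times> V)"
    unfolding l2_upto_L2_set using sqrt_sqn_triangle[OF assms(1)] assms(2)
    by (intro L2_set_mono) auto
  also have "\<dots> \<le> l2_upto V T v + l2_upto V T w"
    unfolding l2_upto_L2_set
    using L2_set_triangle_ineq[of "\<lambda>(t, k). sqrt (sqn (v k t))" "\<lambda>(t, k). sqrt (sqn (w k t))"]
    by (simp add: case_prod_unfold)
  finally show ?thesis .
qed

lemma l2_upto_nonneg: "0 \<le> l2_upto V T w"
  by (simp add: l2_upto_def sum_nonneg)

text \<open>A bound that is uniform in the horizon bounds all partial sums of the error energy.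
  Hence the error is square summable, which excludes the infinite value of \<open>l2norm\<close>,
  and the bound passes to the limit.\<close>

lemma l2_ratio_le:
  assumes le: "\<And>T. l2_upto V T e \<le> K * l2_upto V T u" and K: "0 \<le> K"
    and u: "l2norm V u \<noteq> 0" "l2norm V u < \<infinity>"
  shows "l2norm V e / l2norm V u \<le> ennreal K"
proof -
  define f where "f = (\<lambda>(w :: signal) t. \<Sum>k\<in>V. sqn (w k t))"
  have f0: "0 \<le> f w t" for w t by (simp add: f_def sum_nonneg)
  have su: "summable (f u)" using u(2) by (simp add: l2norm_def f_def split: if_splits)
  have nu: "l2norm V u = ennreal (sqrt (\<Sum>t. f u t))" using su by (simp add: l2norm_def f_def)
  have su0: "0 \<le> (\<Sum>t. f u t)" by (rule suminf_nonneg[OF su f0])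
  have le2: "(\<Sum>t<T. f e t) \<le> K\<^sup>2 * (\<Sum>t. f u t)" for T
  proof -
    have "(l2_upto V T e)\<^sup>2 \<le> (K * l2_upto V T u)\<^sup>2"
      by (rule power_mono[OF le l2_upto_nonneg])
    then have "(\<Sum>t<T. f e t) \<le> K\<^sup>2 * (\<Sum>t<T. f u t)"
      by (simp add: l2_upto_def f_def power_mult_distrib sum_nonneg)
    also have "\<dots> \<le> K\<^sup>2 * (\<Sum>t. f u t)"
      by (intro mult_left_mono sum_le_suminf[OF su]) (auto simp: f0)
    finally show ?thesis .
  qed
  have se: "summable (f e)" by (rule summableI_nonneg_bounded[OF f0 le2])
  have "(\<Sum>t. f e t) \<le> K\<^sup>2 * (\<Sum>t. f u t)" by (rule suminf_le_const[OF se le2])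
  then have "sqrt (\<Sum>t. f e t) \<le> sqrt (K\<^sup>2 * (\<Sum>t. f u t))" by (rule real_sqrt_le_mono)
  then have r: "sqrt (\<Sum>t. f e t) \<le> K * sqrt (\<Sum>t. f u t)" using K by (simp add: real_sqrt_mult)
  have pu: "0 < sqrt (\<Sum>t. f u t)"
    using u(1) su0 unfolding nu by (auto simp: order.order_iff_strict)
  have ne: "l2norm V e = ennreal (sqrt (\<Sum>t. f e t))" using se by (simp add: l2norm_def f_def)
  have "l2norm V e / l2norm V u = ennreal (sqrt (\<Sum>t. f e t) / sqrt (\<Sum>t. f u t))"
    unfolding ne nu by (rule divide_ennreal) (use pu suminf_nonneg[OF se f0] in auto)
  also have "\<dots> \<le> ennreal K"
    using r pu by (intro ennreal_leI) (simp add: divide_le_eq)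
  finally show ?thesis .
qed

subsection \<open>Trajectories in terms of items\<close>

definition itrajectory :: "dsys \<Rightarrow> signal \<Rightarrow> (item \<Rightarrow> nat \<Rightarrow> real vec) \<Rightarrow> signal \<Rightarrow> bool" where
  "itrajectory G u X y \<longleftrightarrow>
     (\<forall>k\<in>nodes G. \<forall>t. u k t \<in> carrier_vec (udim G k t)) \<and>
     (\<forall>c\<in>items G. \<forall>t. X c t \<in> carrier_vec (dims G c t)) \<and>
     (\<forall>c\<in>items G. X c 0 = 0\<^sub>v (dims G c 0)) \<and>
     (\<forall>k\<in>nodes G. \<forall>t.
        stack X (out_items G k) (t + 1) = Amat G k t *\<^sub>v stack X (in_items G k) t + Bmat G k t *\<^sub>v u k t \<and>
        y k t = Cmat G k t *\<^sub>v stack X (in_items G k) t + Dmat G k t *\<^sub>v u k t)"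

lemma trajectory_iff: "trajectory G u x xs y \<longleftrightarrow> itrajectory G u (case_sum x xs) y"
  unfolding trajectory_def itrajectory_def items_ball dims_def outs_eq ins_eq sum.case by blast

lemma io_iff: "(u, y) \<in> io G \<longleftrightarrow> (\<exists>X. itrajectory G u X y)"
proof
  assume "\<exists>X. itrajectory G u X y"
  then obtain X where "itrajectory G u X y" by blast
  then have "trajectory G u (\<lambda>k. X (Inl k)) (\<lambda>e. X (Inr e)) y" by (simp add: trajectory_iff)
  then show "(u, y) \<in> io G" by (auto simp: io_def)
qed (auto simp: io_def trajectory_iff)

lemma itrajectory_stack:
  assumes G: "distributed_system G" and "itrajectory G u X y" and k: "k \<in> nodes G"
  shows "stack X (in_items G k) t \<in> carrier_vec (idim G k t)"
    "stack X (out_items G k) t \<in> carrier_vec (ldim G (out_items G k) t)"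
  using assms in_items_subset[OF G k] out_items_subset[OF G k]
  by (auto simp: itrajectory_def intro!: vconcat_map_carrier)

text \<open>The transformed states \<open>T x\<close> form a trajectory of \<open>H\<close>, zero at
  time 0, with the same input and output. Error bounds proved for \<open>H\<close> thereby apply to
  \<open>G\<close>.\<close>

lemma state_transformed_io:
  assumes G: "distributed_system G" and st: "state_transformed G H" and io: "(u, y) \<in> io G"
  shows "(u, y) \<in> io H"
proof -
  obtain X where X: "itrajectory G u X y" using io by (auto simp: io_iff)
  have Hs: "nnodes H = nnodes G" "edges H = edges G"
    and Hd: "\<forall>k\<in>nodes G. \<forall>t. tdim H k t = tdim G k t \<and> udim H k t = udim G k t"
      "\<forall>e\<in>edges G. \<forall>t. sdim H e t = sdim G e t"
    using st unfolding state_transformed_def by blast+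
  obtain T Ti Ts Tsi where inv: "\<forall>k\<in>nodes G. \<forall>t.
           T k t \<in> carrier_mat (tdim G k t) (tdim G k t) \<and> Ti k t \<in> carrier_mat (tdim G k t) (tdim G k t) \<and>
           inverts_mat (T k t) (Ti k t) \<and> inverts_mat (Ti k t) (T k t)"
      "\<forall>e\<in>edges G. \<forall>t.
           Ts e t \<in> carrier_mat (sdim G e t) (sdim G e t) \<and> Tsi e t \<in> carrier_mat (sdim G e t) (sdim G e t) \<and>
           inverts_mat (Ts e t) (Tsi e t) \<and> inverts_mat (Tsi e t) (Ts e t)"
    and mats: "\<And>k t. k \<in> nodes G \<Longrightarrow>
           Amat H k t = obdiag (case_sum T Ts) G k t * Amat G k t * ibdiag (case_sum Ti Tsi) G k t \<and>
           Bmat H k t = obdiag (case_sum T Ts) G k t * Bmat G k t \<and>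
           Cmat H k t = Cmat G k t * ibdiag (case_sum Ti Tsi) G k t \<and>
           Dmat H k t = Dmat G k t"
    using st unfolding state_transformed_def in_diag_eq out_diag_eq by blast
  let ?T = "case_sum T Ts" and ?Ti = "case_sum Ti Tsi"
  have i: "\<forall>c\<in>items G. \<forall>t. ?T c t \<in> carrier_mat (dims G c t) (dims G c t) \<and>
    ?Ti c t \<in> carrier_mat (dims G c t) (dims G c t) \<and>
    inverts_mat (?T c t) (?Ti c t) \<and> inverts_mat (?Ti c t) (?T c t)"
    unfolding items_ball dims_def sum.case using inv by blast
  have T: "?T c t \<in> carrier_mat (dims G c t) (dims G c t)" "?Ti c t \<in> carrier_mat (dims G c t) (dims G c t)"
    "?Ti c t * ?T c t = 1\<^sub>m (dims G c t)" if "c \<in> items G" for c t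
    using i that unfolding inverts_mat_def by (metis carrier_matD(1))+
  have d: "\<forall>c\<in>items G. \<forall>t. dims H c t = dims G c t"
    using Hd unfolding items_ball dims_def sum.case by blast
  note it = items_cong[OF Hs]
  define X' where "X' = (\<lambda>c t. ?T c t *\<^sub>v X c t)"
  have Xc: "X c t \<in> carrier_vec (dims G c t)" "X c 0 = 0\<^sub>v (dims G c 0)" if "c \<in> items G" for c t
    using X that unfolding itrajectory_def by blast+
  have stackX': "stack X' l t = bdiag ?T l t *\<^sub>v stack X l t" if "set l \<subseteq> items G" for l t
  proof -
    have "\<forall>c\<in>set l. ?T c t \<in> carrier_mat (dims G c t) (dims G c t)" "\<forall>c\<in>set l. X c t \<in> carrier_vec (dims G c t)"
      using that T(1) Xc(1) by blast+
    then show ?thesis unfolding X'_def by (rule diag_block_mat_mult_vconcat[symmetric])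
  qed
  have step: "stack X' (out_items G k) (t + 1) = Amat H k t *\<^sub>v stack X' (in_items G k) t + Bmat H k t *\<^sub>v u k t \<and>
    y k t = Cmat H k t *\<^sub>v stack X' (in_items G k) t + Dmat H k t *\<^sub>v u k t" if k: "k \<in> nodes G" for k t
  proof -
    let ?n = "idim G k t" and ?m = "odim G k t"
    let ?xi = "stack X (in_items G k) t" and ?To = "obdiag ?T G k t"
    note A = Amat_carrier[OF G k, of t] and B = Bmat_carrier[OF G k, of t] and C = Cmat_carrier[OF G k, of t]
    have x: "?xi \<in> carrier_vec ?n" by (rule itrajectory_stack[OF G X k])
    have u: "u k t \<in> carrier_vec (udim G k t)" using X k unfolding itrajectory_def by blast
    have c: "\<forall>c\<in>set (in_items G k). ?T c t \<in> carrier_mat (dims G c t) (dims G c t)"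
      "\<forall>c\<in>set (in_items G k). ?Ti c t \<in> carrier_mat (dims G c t) (dims G c t)"
      "\<forall>c\<in>set (in_items G k). ?Ti c t * ?T c t = 1\<^sub>m (dims G c t)"
      "\<forall>c\<in>set (out_items G k). ?T c (t + 1) \<in> carrier_mat (dims G c (t + 1)) (dims G c (t + 1))"
      using T in_items_subset[OF G k] out_items_subset[OF G k] by blast+
    have To: "?To \<in> carrier_mat ?m ?m" and Tii: "ibdiag ?Ti G k t \<in> carrier_mat ?n ?n"
      and Tin: "ibdiag ?T G k t \<in> carrier_mat ?n ?n"
      by (rule diag_block_mat_carrier[OF c(4)] diag_block_mat_carrier[OF c(2)] diag_block_mat_carrier[OF c(1)])+
    have recover: "ibdiag ?Ti G k t *\<^sub>v stack X' (in_items G k) t = ?xi"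
      unfolding stackX'[OF in_items_subset[OF G k]]
      by (rule diag_block_mat_inverse[OF c(2,1,3) distinct_in_items[OF G] x])
    have x': "stack X' (in_items G k) t \<in> carrier_vec ?n"
      unfolding stackX'[OF in_items_subset[OF G k]] using Tin x by (rule mult_mat_vec_carrier)
    have AH: "Amat H k t *\<^sub>v stack X' (in_items G k) t = ?To *\<^sub>v (Amat G k t *\<^sub>v ?xi)"
      unfolding conjunct1[OF mats[OF k]] mult_mat_vec_assoc3[OF To A Tii x'] recover ..
    have BH: "Bmat H k t *\<^sub>v u k t = ?To *\<^sub>v (Bmat G k t *\<^sub>v u k t)"
      unfolding conjunct1[OF conjunct2[OF mats[OF k]]] by (rule assoc_mult_mat_vec[OF To B u])
    have CH: "Cmat H k t *\<^sub>v stack X' (in_items G k) t = Cmat G k t *\<^sub>v ?xi"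
      using assoc_mult_mat_vec[OF C Tii x'] mats[OF k, of t] recover by simp
    have "stack X' (out_items G k) (t + 1) = ?To *\<^sub>v (Amat G k t *\<^sub>v ?xi + Bmat G k t *\<^sub>v u k t)"
      unfolding stackX'[OF out_items_subset[OF G k]] using X k unfolding itrajectory_def by simp
    also have "\<dots> = ?To *\<^sub>v (Amat G k t *\<^sub>v ?xi) + ?To *\<^sub>v (Bmat G k t *\<^sub>v u k t)"
      by (rule mult_add_distrib_mat_vec[OF To]) (use A B x u in \<open>auto intro: mult_mat_vec_carrier\<close>)
    finally show ?thesis
      using AH BH CH mats[OF k, of t] X k unfolding itrajectory_def by simp
  qed
  have "itrajectory H u X' y"
    unfolding itrajectory_def it Hs
  proof (intro conjI ballI allI)
    show "u k t \<in> carrier_vec (udim H k t)" if "k \<in> nodes G" for k t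
      using X Hd(1) that unfolding itrajectory_def by simp
    show "X' c t \<in> carrier_vec (dims H c t)" if "c \<in> items G" for c t
      unfolding X'_def bspec[OF d that, rule_format] using T(1)[OF that] Xc(1)[OF that] by (rule mult_mat_vec_carrier)
    show "X' c 0 = 0\<^sub>v (dims H c 0)" if "c \<in> items G" for c
      unfolding X'_def bspec[OF d that, rule_format] Xc(2)[OF that] by (rule mult_mat_vec_zero[OF T(1)[OF that]])
  qed (use step in blast)+
  then show ?thesis by (auto simp: io_iff)
qed

subsection \<open>Masked systems\<close>

text \<open>Masking rows is enough to remove a state: the component is then zero at the next time,
  and so the column that it multiplies has no effect.\<close>

definition rowmask :: "nat set \<Rightarrow> real mat \<Rightarrow> real mat" where
  "rowmask P A = mat (dim_row A) (dim_col A) (\<lambda>(i, j). if i \<in> P then A $$ (i, j) else 0)"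

lemma rowmask_carrier: "A \<in> carrier_mat m n \<Longrightarrow> rowmask P A \<in> carrier_mat m n"
  by (auto simp: rowmask_def)

lemma rowmask_mult_vec:
  assumes "A \<in> carrier_mat m n" "v \<in> carrier_vec n" "i < m"
  shows "(rowmask P A *\<^sub>v v) $ i = (if i \<in> P then (A *\<^sub>v v) $ i else 0)"
  using assms by (auto simp: rowmask_def scalar_prod_def intro!: sum.cong)

lemma sq_bounded_rowmask:
  assumes A: "A \<in> carrier_mat m n" and b: "sq_bounded b A"
  shows "sq_bounded b (rowmask P A)"
proof (rule sq_boundedI[OF rowmask_carrier[OF A]])
  fix v :: "real vec" assume v: "v \<in> carrier_vec n"
  have "sqn (rowmask P A *\<^sub>v v) = (\<Sum>i<m. ((rowmask P A *\<^sub>v v) $ i)\<^sup>2)"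
    using rowmask_carrier[OF A, of P] unfolding sqn_sum by simp
  also have "\<dots> \<le> (\<Sum>i<m. ((A *\<^sub>v v) $ i)\<^sup>2)"
    by (intro sum_mono) (simp add: rowmask_mult_vec[OF A v])
  also have "\<dots> = sqn (A *\<^sub>v v)" using A unfolding sqn_sum by simp
  finally show "sqn (rowmask P A *\<^sub>v v) \<le> b * sqn v" using sq_boundedD[OF b A v] by simp
qed

text \<open>Setting rows of \<open>A\<close> and \<open>B\<close> to zero has the same effect on the outputs as deleting the
  corresponding states, but all systems compared in the error bound keep the same dimensions.\<close>

definition masked :: "dsys \<Rightarrow> (nat \<Rightarrow> nat \<Rightarrow> nat set) \<Rightarrow> dsys" where
  "masked H P = H\<lparr>Amat := \<lambda>k t. rowmask (P k t) (Amat H k t), Bmat := \<lambda>k t. rowmask (P k t) (Bmat H k t)\<rparr>"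

lemma masked_simps:
  "nnodes (masked H P) = nnodes H" "edges (masked H P) = edges H"
  "tdim (masked H P) = tdim H" "sdim (masked H P) = sdim H"
  "udim (masked H P) = udim H" "ydim (masked H P) = ydim H"
  "Cmat (masked H P) = Cmat H" "Dmat (masked H P) = Dmat H" "dims (masked H P) = dims H"
  "Amat (masked H P) k t = rowmask (P k t) (Amat H k t)"
  "Bmat (masked H P) k t = rowmask (P k t) (Bmat H k t)"
  by (simp_all add: masked_def dims_def)

lemma masked_items:
  "in_items (masked H P) k = in_items H k" "out_items (masked H P) k = out_items H k"
  "items (masked H P) = items H"
  by (rule items_cong; simp add: masked_simps)+

lemma masked_UNIV: "masked H (\<lambda>k t. UNIV) = H"
proof -
  have "rowmask UNIV A = A" for A by (rule eq_matI) (auto simp: rowmask_def)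
  then show ?thesis by (simp add: masked_def)
qed

lemma masked_distributed_system:
  assumes H: "distributed_system H" shows "distributed_system (masked H P)"
proof -
  have *: "unif_bounded (nodes H) (Amat H)" "unif_bounded (nodes H) (Bmat H)"
    using H unfolding distributed_system_def by blast+
  obtain a where a: "\<And>k t. k \<in> nodes H \<Longrightarrow> sq_bounded a (Amat H k t)"
    using unif_boundedE[OF *(1)] by blast
  obtain b where b: "\<And>k t. k \<in> nodes H \<Longrightarrow> sq_bounded b (Bmat H k t)"
    using unif_boundedE[OF *(2)] by blast
  have "unif_bounded (nodes H) (Amat (masked H P))"
    by (rule unif_boundedI, unfold masked_simps) (rule sq_bounded_rowmask[OF Amat_carrier[OF H] a])
  moreover have "unif_bounded (nodes H) (Bmat (masked H P))"
    by (rule unif_boundedI, unfold masked_simps) (rule sq_bounded_rowmask[OF Bmat_carrier[OF H] b])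
  ultimately show ?thesis
    using H rowmask_carrier
    unfolding distributed_system_def in_dim_eq out_dim_eq masked_items masked_simps by blast
qed

lemma masked_stack:
  assumes H: "distributed_system H" and X: "itrajectory (masked H P) u X y" and k: "k \<in> nodes H"
    and i: "i < odim H k t"
  shows "stack X (out_items H k) (t + 1) $ i =
    (if i \<in> P k t then (Amat H k t *\<^sub>v stack X (in_items H k) t + Bmat H k t *\<^sub>v u k t) $ i else 0)"
proof -
  note A = Amat_carrier[OF H k, of t] and B = Bmat_carrier[OF H k, of t]
  have x: "stack X (in_items H k) t \<in> carrier_vec (idim H k t)"
    using itrajectory_stack(1)[OF masked_distributed_system[OF H] X, of k t] k
    by (simp only: masked_items masked_simps)
  have u: "u k t \<in> carrier_vec (udim H k t)"
    using X k unfolding itrajectory_def masked_items masked_simps by blast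
  have "stack X (out_items H k) (t + 1) =
    rowmask (P k t) (Amat H k t) *\<^sub>v stack X (in_items H k) t + rowmask (P k t) (Bmat H k t) *\<^sub>v u k t"
    using X k unfolding itrajectory_def masked_items masked_simps by blast
  then show ?thesis
    using i A B rowmask_carrier[OF A, of "P k t"] rowmask_carrier[OF B, of "P k t"]
      rowmask_mult_vec[OF A x i] rowmask_mult_vec[OF B u i] by simp
qed

subsection \<open>The one-step error bound\<close>

lemma sum_lessThan_add: "(\<Sum>i<n + m. f i) = (\<Sum>i<n. f i) + (\<Sum>i<m. f (n + i) :: real)" for n m :: nat
  by (induction m) (simp_all add: add.assoc)

text \<open>Splits the storage of a node into contributions of single items; only in that form can
  the outgoing states of one node be regrouped as incoming states of another. \<phi> is arbitrary
  because the storage of an entry depends jointly on the gramian value and on the states of both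
  systems.\<close>

lemma sum_stacked:
  fixes \<phi> :: "real \<Rightarrow> real \<Rightarrow> real \<Rightarrow> real"
  assumes "\<forall>c\<in>set l. M c \<in> carrier_mat (n c) (n c)" "\<forall>c\<in>set l. f c \<in> carrier_vec (n c)"
    and "\<forall>c\<in>set l. g c \<in> carrier_vec (n c)"
  shows "(\<Sum>i<(\<Sum>c\<leftarrow>l. n c). \<phi> (diag_block_mat (map M l) $$ (i, i)) (vconcat (map f l) $ i) (vconcat (map g l) $ i)) =
    (\<Sum>c\<leftarrow>l. \<Sum>i<n c. \<phi> (M c $$ (i, i)) (f c $ i) (g c $ i))"
  using assms
proof (induction l)
  case (Cons a l)
  let ?N = "\<Sum>c\<leftarrow>l. n c"
  have d: "dim_row (diag_block_mat (map M l)) = ?N" "dim_col (diag_block_mat (map M l)) = ?N"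
    "dim_vec (vconcat (map f l)) = ?N" "dim_vec (vconcat (map g l)) = ?N"
    using diag_block_mat_carrier[of l M n] vconcat_map_carrier[of l f n] vconcat_map_carrier[of l g n] Cons.prems
    by auto
  have a: "dim_row (M a) = n a" "dim_col (M a) = n a" "dim_vec (f a) = n a" "dim_vec (g a) = n a"
    using Cons.prems by auto
  have "(\<Sum>i<?N. \<phi> (diag_block_mat (map M l) $$ (i, i)) (vconcat (map f l) $ i) (vconcat (map g l) $ i)) =
    (\<Sum>c\<leftarrow>l. \<Sum>i<n c. \<phi> (M c $$ (i, i)) (f c $ i) (g c $ i))"
    using Cons by simp
  moreover have "(\<Sum>i<n a. \<phi> (diag_block_mat (map M (a # l)) $$ (i, i)) (vconcat (map f (a # l)) $ i) (vconcat (map g (a # l)) $ i)) =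
    (\<Sum>i<n a. \<phi> (M a $$ (i, i)) (f a $ i) (g a $ i))"
    by (intro sum.cong refl) (simp add: Let_def d a)
  moreover have "(\<Sum>i<?N. \<phi> (diag_block_mat (map M (a # l)) $$ (n a + i, n a + i)) (vconcat (map f (a # l)) $ (n a + i)) (vconcat (map g (a # l)) $ (n a + i))) =
    (\<Sum>i<?N. \<phi> (diag_block_mat (map M l) $$ (i, i)) (vconcat (map f l) $ i) (vconcat (map g l) $ i))"
    by (intro sum.cong refl) (simp add: Let_def d a)
  ultimately show ?case by (simp only: list.map sum_list.Cons sum_lessThan_add)
qed simp

text \<open>With \<open>p = x - z\<close> and \<open>s = x + z\<close>, the storage function \<open>p\<^sup>T S p + \<sigma>\<^sup>2 s\<^sup>T S\<^sup>-\<^sup>1 s\<close> can be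
  compared entry by entry: where only the second system is masked, both summands are \<open>\<sigma>\<close> times
  the square of the same number, and the parallelogram law applies.\<close>

lemma mask_entry_le:
  fixes a b \<sigma> s x z :: real
  assumes "0 < s" "0 \<le> \<sigma>" "x = (if P then a else 0)" "z = (if Q then b else 0)" "Q \<longrightarrow> P" "P \<and> \<not> Q \<longrightarrow> s = \<sigma>"
  shows "s * (x - z)\<^sup>2 + \<sigma>\<^sup>2 * ((x + z)\<^sup>2 / s) \<le> s * (a - b)\<^sup>2 + \<sigma>\<^sup>2 * ((a + b)\<^sup>2 / s)"
proof (cases "P \<and> \<not> Q")
  case True
  with assms have "s * (x - z)\<^sup>2 + \<sigma>\<^sup>2 * ((x + z)\<^sup>2 / s) = 2 * \<sigma> * a\<^sup>2"
    "s * (a - b)\<^sup>2 + \<sigma>\<^sup>2 * ((a + b)\<^sup>2 / s) = 2 * \<sigma> * a\<^sup>2 + 2 * \<sigma> * b\<^sup>2"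
    by (auto simp: field_simps power2_eq_square)
  then show ?thesis using assms(2) by simp
next
  \<comment> \<open>Either neither entry is masked, with equality, or both are, and the left side is
    zero.\<close>
  case False
  with assms show ?thesis by auto
qed

context
  fixes H :: dsys and S :: "item \<Rightarrow> nat \<Rightarrow> real mat" and \<rho> :: real
  assumes H: "distributed_system H"
    and S: "\<And>c t. c \<in> items H \<Longrightarrow> S c t \<in> carrier_mat (dims H c t) (dims H c t)"
    and S_pos: "\<And>c t i. c \<in> items H \<Longrightarrow> i < dims H c t \<Longrightarrow> 0 < S c t $$ (i, i)"
    and S_pos_out: "\<And>k t i. k \<in> nodes H \<Longrightarrow> i < ldim H (out_items H k) t \<Longrightarrow>
      0 < bdiag S (out_items H k) t $$ (i, i)"
    and S_pos_in: "\<And>k t i. k \<in> nodes H \<Longrightarrow> i < idim H k t \<Longrightarrow>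
      0 < ibdiag S H k t $$ (i, i)"
    and obs: "\<And>k t v. k \<in> nodes H \<Longrightarrow> v \<in> carrier_vec (idim H k t) \<Longrightarrow>
      (\<Sum>i<odim H k t. obdiag S H k t $$ (i, i) * ((Amat H k t *\<^sub>v v) $ i)\<^sup>2)
        + sqn (Cmat H k t *\<^sub>v v)
      \<le> (\<Sum>i<idim H k t. ibdiag S H k t $$ (i, i) * (v $ i)\<^sup>2)"
    and con: "\<And>k t v u. k \<in> nodes H \<Longrightarrow> v \<in> carrier_vec (idim H k t) \<Longrightarrow>
      u \<in> carrier_vec (udim H k t) \<Longrightarrow>
      (\<Sum>i<odim H k t.
         ((Amat H k t *\<^sub>v v + Bmat H k t *\<^sub>v u) $ i)\<^sup>2 / obdiag S H k t $$ (i, i))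
      \<le> \<rho> * ((\<Sum>i<idim H k t. (v $ i)\<^sup>2 / ibdiag S H k t $$ (i, i)) + sqn u)"
    and \<rho>: "0 < \<rho>" "\<rho> \<le> 1"
begin

text \<open>The unmasked next states \<open>a\<close> and \<open>b\<close> satisfy
  \<open>a - b = A (x - z)\<close> and \<open>a + b = A (x + z) + B (2u)\<close>. Thus
  \<open>obs\<close> pays for the output error \<open>C (x - z)\<close> out of the first summand of
  the storage function, \<open>con\<close> lets the second grow by at most
  \<open>4 \<sigma>\<^sup>2 \<rho>\<close> times the input energy, and the masks enter only
  afterwards, entry by entry, through \<open>mask_entry_le\<close>. Starting from zero storage, the
  steps telescope over time.\<close>

lemma mask_error_bound:
  assumes \<sigma>: "0 \<le> \<sigma>" and PQ: "\<And>k t. k \<in> nodes H \<Longrightarrow> Q k t \<subseteq> P k t"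
    and PQ\<sigma>: "\<And>k t i. k \<in> nodes H \<Longrightarrow> i < odim H k t \<Longrightarrow>
      i \<in> P k t \<Longrightarrow> i \<notin> Q k t \<Longrightarrow> obdiag S H k t $$ (i, i) = \<sigma>"
    and y: "(u, y) \<in> io (masked H P)" and y': "(u, y') \<in> io (masked H Q)"
  shows "l2_upto (nodes H) T (\<lambda>k t. y k t - y' k t) \<le> 2 * \<sigma> * sqrt \<rho> * l2_upto (nodes H) T u"
proof -
  obtain X where X: "itrajectory (masked H P) u X y" using y by (auto simp: io_iff)
  obtain Z where Z: "itrajectory (masked H Q) u Z y'" using y' by (auto simp: io_iff)
  define \<phi> where "\<phi> = (\<lambda>s a b. s * (a - b)\<^sup>2 + \<sigma>\<^sup>2 * ((a + b)\<^sup>2 / s) :: real)"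
  define v where "v = (\<lambda>t c. \<Sum>i<dims H c t. \<phi> (S c t $$ (i, i)) (X c t $ i) (Z c t $ i))"
  define E where "E = (\<lambda>t. \<Sum>c\<in>items H. v t c)"
  have Xc: "X c t \<in> carrier_vec (dims H c t)" "Z c t \<in> carrier_vec (dims H c t)"
    "X c 0 = 0\<^sub>v (dims H c 0)" "Z c 0 = 0\<^sub>v (dims H c 0)" if "c \<in> items H" for c t
    using X Z that unfolding itrajectory_def masked_items masked_simps by blast+
  have sums: "(\<Sum>i<ldim H l t. \<phi> (bdiag S l t $$ (i, i)) (stack X l t $ i) (stack Z l t $ i)) = (\<Sum>c\<leftarrow>l. v t c)"
    if "set l \<subseteq> items H" for l t
    unfolding v_def by (rule sum_stacked) (use that S Xc in blast)+
  have step: "(\<Sum>c\<leftarrow>out_items H k. v (t + 1) c) + sqn (y k t - y' k t) \<le>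
    (\<Sum>c\<leftarrow>in_items H k. v t c) + 4 * \<sigma>\<^sup>2 * \<rho> * sqn (u k t)" if k: "k \<in> nodes H" for k t
  proof -
    let ?n = "idim H k t" and ?m = "odim H k t"
    let ?Si = "\<lambda>i. ibdiag S H k t $$ (i, i)" and ?So = "\<lambda>i. obdiag S H k t $$ (i, i)"
    let ?A = "Amat H k t" and ?B = "Bmat H k t" and ?C = "Cmat H k t" and ?D = "Dmat H k t" and ?u = "u k t"
    let ?x = "stack X (in_items H k) t" and ?z = "stack Z (in_items H k) t"
    note A = Amat_carrier[OF H k, of t] and B = Bmat_carrier[OF H k, of t]
      and C = Cmat_carrier[OF H k, of t] and D = Dmat_carrier[OF H k, of t]
    have x: "?x \<in> carrier_vec ?n" and z: "?z \<in> carrier_vec ?n"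
      by (rule vconcat_map_carrier; use Xc in_items_subset[OF H k] in blast)+
    have u: "?u \<in> carrier_vec (udim H k t)"
      using X k unfolding itrajectory_def masked_items masked_simps by blast
    define a where "a = ?A *\<^sub>v ?x + ?B *\<^sub>v ?u"
    define b where "b = ?A *\<^sub>v ?z + ?B *\<^sub>v ?u"
    have Ax: "?A *\<^sub>v ?x \<in> carrier_vec ?m" "?A *\<^sub>v ?z \<in> carrier_vec ?m" "?B *\<^sub>v ?u \<in> carrier_vec ?m"
      using A B x z u by (auto intro: mult_mat_vec_carrier)
    have p: "?x - ?z \<in> carrier_vec ?n" and s: "?x + ?z \<in> carrier_vec ?n" using x z by simp_all
    have u2: "2 \<cdot>\<^sub>v ?u \<in> carrier_vec (udim H k t)" using u by simp
    have ab: "(?A *\<^sub>v (?x - ?z)) $ i = a $ i - b $ i"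
      "(?A *\<^sub>v (?x + ?z) + ?B *\<^sub>v (2 \<cdot>\<^sub>v ?u)) $ i = a $ i + b $ i" if "i < ?m" for i
      using that Ax carrier_vecD[OF Ax(1)] carrier_vecD[OF Ax(2)] carrier_vecD[OF Ax(3)]
      unfolding a_def b_def mult_minus_distrib_mat_vec[OF A x z] mult_add_distrib_mat_vec[OF A x z]
        mult_mat_vec[OF B u] by simp_all
    have "(\<Sum>c\<leftarrow>out_items H k. v (t + 1) c) =
      (\<Sum>i<?m. \<phi> (?So i) (stack X (out_items H k) (t + 1) $ i) (stack Z (out_items H k) (t + 1) $ i))"
      by (rule sums[OF out_items_subset[OF H k], symmetric])
    also have "\<dots> \<le> (\<Sum>i<?m. \<phi> (?So i) (a $ i) (b $ i))"
      unfolding \<phi>_def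
    proof (rule sum_mono)
      fix i assume "i \<in> {..<?m}"
      then have i: "i < ?m" by simp
      show "?So i * (stack X (out_items H k) (t + 1) $ i - stack Z (out_items H k) (t + 1) $ i)\<^sup>2 +
          \<sigma>\<^sup>2 * ((stack X (out_items H k) (t + 1) $ i + stack Z (out_items H k) (t + 1) $ i)\<^sup>2 / ?So i)
        \<le> ?So i * (a $ i - b $ i)\<^sup>2 + \<sigma>\<^sup>2 * ((a $ i + b $ i)\<^sup>2 / ?So i)"
        by (rule mask_entry_le[OF S_pos_out[OF k i] \<sigma>,
              OF masked_stack[OF H X k i, folded a_def] masked_stack[OF H Z k i, folded b_def]])
          (use PQ[OF k] PQ\<sigma>[OF k i] in blast)+
    qed
    also have "\<dots> = (\<Sum>i<?m. ?So i * ((?A *\<^sub>v (?x - ?z)) $ i)\<^sup>2) +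
        \<sigma>\<^sup>2 * (\<Sum>i<?m. ((?A *\<^sub>v (?x + ?z) + ?B *\<^sub>v (2 \<cdot>\<^sub>v ?u)) $ i)\<^sup>2 / ?So i)"
      unfolding \<phi>_def sum.distrib sum_distrib_left using ab by simp
    finally have 1: "(\<Sum>c\<leftarrow>out_items H k. v (t + 1) c) \<le> \<dots>" .
    have "(\<Sum>i<?m. ((?A *\<^sub>v (?x + ?z) + ?B *\<^sub>v (2 \<cdot>\<^sub>v ?u)) $ i)\<^sup>2 / ?So i)
      \<le> \<rho> * ((\<Sum>i<?n. ((?x + ?z) $ i)\<^sup>2 / ?Si i) + sqn (2 \<cdot>\<^sub>v ?u))"
      by (rule con[OF k s u2])
    also have "\<dots> = \<rho> * (\<Sum>i<?n. ((?x + ?z) $ i)\<^sup>2 / ?Si i) + 4 * \<rho> * sqn ?u"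
      by (simp only: sqn_smult) (simp add: algebra_simps)
    \<comment> \<open>On the state term \<rho> is raised to 1, so that the storage at time
      \<open>t\<close> appears unweighted and telescopes; on the input term \<rho> is kept, and the
      strictness of the final bound comes from there.\<close>
    also have "\<rho> * (\<Sum>i<?n. ((?x + ?z) $ i)\<^sup>2 / ?Si i) \<le> 1 * (\<Sum>i<?n. ((?x + ?z) $ i)\<^sup>2 / ?Si i)"
    proof (rule mult_right_mono[OF \<rho>(2)])
      show "0 \<le> (\<Sum>i<?n. ((?x + ?z) $ i)\<^sup>2 / ?Si i)"
        by (intro sum_nonneg divide_nonneg_pos zero_le_power2 S_pos_in[OF k]) simp
    qed
    finally have "(\<Sum>i<?m. ((?A *\<^sub>v (?x + ?z) + ?B *\<^sub>v (2 \<cdot>\<^sub>v ?u)) $ i)\<^sup>2 / ?So i)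
      \<le> (\<Sum>i<?n. ((?x + ?z) $ i)\<^sup>2 / ?Si i) + 4 * \<rho> * sqn ?u" by simp
    then have 2: "\<sigma>\<^sup>2 * (\<Sum>i<?m. ((?A *\<^sub>v (?x + ?z) + ?B *\<^sub>v (2 \<cdot>\<^sub>v ?u)) $ i)\<^sup>2 / ?So i)
      \<le> \<sigma>\<^sup>2 * ((\<Sum>i<?n. ((?x + ?z) $ i)\<^sup>2 / ?Si i) + 4 * \<rho> * sqn ?u)"
      by (rule mult_left_mono) simp
    have yy: "y k t - y' k t = ?C *\<^sub>v (?x - ?z)"
    proof -
      have "y k t = ?C *\<^sub>v ?x + ?D *\<^sub>v ?u" "y' k t = ?C *\<^sub>v ?z + ?D *\<^sub>v ?u"
        using X Z k unfolding itrajectory_def masked_items masked_simps by blast+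
      moreover have "dim_vec (?C *\<^sub>v ?x) = ydim H k t" "dim_vec (?C *\<^sub>v ?z) = ydim H k t" "dim_vec (?D *\<^sub>v ?u) = ydim H k t"
        using C D by simp_all
      ultimately show ?thesis
        unfolding mult_minus_distrib_mat_vec[OF C x z] by (intro eq_vecI) simp_all
    qed
    have "(\<Sum>c\<leftarrow>in_items H k. v t c) = (\<Sum>i<?n. \<phi> (?Si i) (?x $ i) (?z $ i))"
      by (rule sums[OF in_items_subset[OF H k], symmetric])
    also have "\<dots> = (\<Sum>i<?n. ?Si i * ((?x - ?z) $ i)\<^sup>2) + \<sigma>\<^sup>2 * (\<Sum>i<?n. ((?x + ?z) $ i)\<^sup>2 / ?Si i)"
      unfolding \<phi>_def sum.distrib sum_distrib_left using carrier_vecD[OF x] carrier_vecD[OF z] by simp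
    finally have 3: "(\<Sum>c\<leftarrow>in_items H k. v t c) = \<dots>" .
    show ?thesis using 1 2 3 obs[OF k p] unfolding yy by (simp add: algebra_simps)
  qed
  have E_step: "E (t + 1) + (\<Sum>k\<in>nodes H. sqn (y k t - y' k t)) \<le> E t + 4 * \<sigma>\<^sup>2 * \<rho> * (\<Sum>k\<in>nodes H. sqn (u k t))" for t
  proof -
    have "(\<Sum>k\<in>nodes H. (\<Sum>c\<leftarrow>out_items H k. v (t + 1) c) + sqn (y k t - y' k t)) \<le>
      (\<Sum>k\<in>nodes H. (\<Sum>c\<leftarrow>in_items H k. v t c) + 4 * \<sigma>\<^sup>2 * \<rho> * sqn (u k t))"
      by (rule sum_mono[OF step])
    then show ?thesis
      unfolding sum.distrib sum_in_items[OF H] sum_out_items[OF H] E_def sum_distrib_left .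
  qed
  have E_nonneg: "0 \<le> E t" for t
    unfolding E_def v_def \<phi>_def using S_pos by (intro sum_nonneg) (simp add: less_imp_le)
  have E0: "E 0 = 0"
    unfolding E_def v_def by (intro sum.neutral) (simp add: Xc(3,4) \<phi>_def)
  have "E T + (\<Sum>t<T. \<Sum>k\<in>nodes H. sqn (y k t - y' k t)) \<le> 4 * \<sigma>\<^sup>2 * \<rho> * (\<Sum>t<T. \<Sum>k\<in>nodes H. sqn (u k t))"
  proof (induction T)
    case (Suc T)
    then show ?case using E_step[of T] by (simp add: distrib_left)
  qed (simp add: E0)
  then have "(\<Sum>t<T. \<Sum>k\<in>nodes H. sqn (y k t - y' k t)) \<le> 4 * \<sigma>\<^sup>2 * \<rho> * (\<Sum>t<T. \<Sum>k\<in>nodes H. sqn (u k t))"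
    using E_nonneg[of T] by linarith
  then have "l2_upto (nodes H) T (\<lambda>k t. y k t - y' k t) \<le> sqrt (4 * \<sigma>\<^sup>2 * \<rho> * (\<Sum>t<T. \<Sum>k\<in>nodes H. sqn (u k t)))"
    unfolding l2_upto_def by (rule real_sqrt_le_mono)
  also have "\<dots> = 2 * \<sigma> * sqrt \<rho> * l2_upto (nodes H) T u"
    using \<sigma> by (simp add: l2_upto_def real_sqrt_mult)
  finally show ?thesis .
qed

end

subsection \<open>The error bound\<close>

lemma form_bounds_diag:
  assumes "form_bounds \<beta> b n M" "i < n" shows "\<beta> \<le> M $$ (i, i)"
proof -
  have M: "M \<in> carrier_mat n n" using assms(1) by (simp add: form_bounds_def)
  have "\<beta> * sqn (unit_vec n i) \<le> qform M (unit_vec n i)"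
    using assms(1) by (simp add: form_bounds_def)
  then show ?thesis using M assms(2) by (simp add: qform_def)
qed

text \<open>Young's inequality with weight \<open>1 / \<rho>\<close> replaces the usual Schur complement argument.\<close>

lemma reachability_dual:
  fixes A B So Si :: "real mat"
  assumes A: "A \<in> carrier_mat m n" and B: "B \<in> carrier_mat m l"
    and Si: "Si \<in> carrier_mat n n" "diagonal_mat Si" "\<And>i. i < n \<Longrightarrow> 0 < Si $$ (i, i)"
    and So: "So \<in> carrier_mat m m" "diagonal_mat So" "\<And>i. i < m \<Longrightarrow> 0 < So $$ (i, i)"
    and le: "\<And>f. f \<in> carrier_vec m \<Longrightarrow> qform Si (A\<^sup>T *\<^sub>v f) + sqn (B\<^sup>T *\<^sub>v f) \<le> \<rho> * qform So f"
    and \<rho>: "0 < \<rho>" and v: "v \<in> carrier_vec n" and u: "u \<in> carrier_vec l"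
  shows "(\<Sum>i<m. ((A *\<^sub>v v + B *\<^sub>v u) $ i)\<^sup>2 / So $$ (i, i)) \<le>
    \<rho> * ((\<Sum>i<n. (v $ i)\<^sup>2 / Si $$ (i, i)) + sqn u)"
proof -
  define w where "w = A *\<^sub>v v + B *\<^sub>v u"
  \<comment> \<open>The test vector \<open>So\<^sup>-\<^sup>1 w\<close>: both
    \<open>f \<bullet> w\<close> and the form of \<open>So\<close> at \<open>f\<close> are then the
    sum \<open>N\<close> to be bounded, so the estimate reads
    \<open>2 N \<le> N + ...\<close>.\<close>
  define f where "f = vec m (\<lambda>i. w $ i / So $$ (i, i))"
  define N where "N = (\<Sum>i<m. (w $ i)\<^sup>2 / So $$ (i, i))"
  have f: "f \<in> carrier_vec m" by (simp add: f_def)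
  have Av: "A *\<^sub>v v \<in> carrier_vec m" using A v by (rule mult_mat_vec_carrier)
  have Bu: "B *\<^sub>v u \<in> carrier_vec m" using B u by (rule mult_mat_vec_carrier)
  have g: "A\<^sup>T *\<^sub>v f \<in> carrier_vec n" using A f by (intro mult_mat_vec_carrier[of _ _ m]) simp_all
  have dg: "dim_vec (A\<^sup>T *\<^sub>v f) = n" "dim_vec (B\<^sup>T *\<^sub>v f) = dim_vec u" using A B u by simp_all
  have "f \<bullet> w = N"
    unfolding N_def scalar_prod_def using A B
    by (simp add: f_def w_def lessThan_atLeast0 power2_eq_square)
  moreover have "f \<bullet> w = (A\<^sup>T *\<^sub>v f) \<bullet> v + (B\<^sup>T *\<^sub>v f) \<bullet> u"
    unfolding w_def scalar_prod_add_distrib[OF f Av Bu] transpose_adjoint[OF A f v] transpose_adjoint[OF B f u] ..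
  ultimately have "2 * N = 2 * ((A\<^sup>T *\<^sub>v f) \<bullet> v) + 2 * ((B\<^sup>T *\<^sub>v f) \<bullet> u)" by simp
  also have "2 * ((B\<^sup>T *\<^sub>v f) \<bullet> u) \<le> 1 / \<rho> * sqn (B\<^sup>T *\<^sub>v f) + sqn u / (1 / \<rho>)"
    using \<rho> by (intro scalar_prod_young dg(2)) simp
  also have "2 * ((A\<^sup>T *\<^sub>v f) \<bullet> v) \<le> 1 / \<rho> * qform Si (A\<^sup>T *\<^sub>v f) + \<rho> * (\<Sum>i<n. (v $ i)\<^sup>2 / Si $$ (i, i))"
  proof -
    have "2 * ((A\<^sup>T *\<^sub>v f) \<bullet> v) = (\<Sum>i<n. 2 * ((A\<^sup>T *\<^sub>v f) $ i * v $ i))"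
      using carrier_vecD[OF v] unfolding scalar_prod_def by (simp add: sum_distrib_left lessThan_atLeast0)
    also have "\<dots> \<le> (\<Sum>i<n. Si $$ (i, i) / \<rho> * ((A\<^sup>T *\<^sub>v f) $ i)\<^sup>2 + (v $ i)\<^sup>2 / (Si $$ (i, i) / \<rho>))"
      using Si(3) \<rho> by (intro sum_mono weighted_young) simp
    also have "\<dots> = 1 / \<rho> * qform Si (A\<^sup>T *\<^sub>v f) + \<rho> * (\<Sum>i<n. (v $ i)\<^sup>2 / Si $$ (i, i))"
      unfolding qform_diagonal[OF Si(2,1) g] sum.distrib sum_distrib_left
      by (intro arg_cong2[where f = "(+)"] sum.cong refl) (simp_all add: mult.commute)
    finally show ?thesis .
  qed
  finally have "2 * N \<le> 1 / \<rho> * (qform Si (A\<^sup>T *\<^sub>v f) + sqn (B\<^sup>T *\<^sub>v f)) +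
    \<rho> * ((\<Sum>i<n. (v $ i)\<^sup>2 / Si $$ (i, i)) + sqn u)"
    by (simp add: algebra_simps)
  also have "1 / \<rho> * (qform Si (A\<^sup>T *\<^sub>v f) + sqn (B\<^sup>T *\<^sub>v f)) \<le> 1 / \<rho> * (\<rho> * qform So f)"
    using le[OF f] \<rho> by (intro mult_left_mono) auto
  also have "1 / \<rho> * (\<rho> * qform So f) = N"
  proof -
    have "qform So f = N"
      unfolding qform_diagonal[OF So(2,1) f] N_def using So(3)
      by (intro sum.cong refl) (simp add: f_def power2_eq_square)
    then show ?thesis using \<rho> by simp
  qed
  finally show ?thesis by (simp add: N_def w_def)
qed

text \<open>The mask interpolates between \<open>H\<close>, for empty \<open>F\<close>, and the
  removal of every index outside \<open>R\<close> whose value lies in \<open>F\<close>. Inserting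
  \<sigma> into \<open>F\<close> newly masks exactly the indices outside \<open>R\<close> with value
  \<sigma>, whereas indices in \<open>R\<close> with the same value stay. So each insertion is one
  application of \<open>mask_error_bound\<close>, and the errors add up by the triangle inequality.
  \<rho> depends on the gramians alone and is common to all steps.\<close>

lemma masked_error_bound:
  assumes H: "distributed_system H" and gram: "balanced_gramians H \<Sigma> \<Sigma>s"
  obtains \<rho> where "0 < \<rho>" "\<rho> < 1" "\<And>F R u y y' T. finite F \<Longrightarrow> \<forall>\<sigma>\<in>F. 0 < \<sigma> \<Longrightarrow> (u, y) \<in> io H \<Longrightarrow>
    (u, y') \<in> io (masked H (\<lambda>k t. R k t \<union> {i. obdiag (case_sum \<Sigma> \<Sigma>s) H k t $$ (i, i) \<notin> F})) \<Longrightarrow>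
    l2_upto (nodes H) T (\<lambda>k t. y k t - y' k t) \<le> 2 * \<Sum>F * sqrt \<rho> * l2_upto (nodes H) T u"
proof -
  let ?S = "case_sum \<Sigma> \<Sigma>s"
  obtain \<beta> b where \<beta>: "\<beta> > 0" and b: "\<beta> < b" and fam: "gramian_family H \<beta> \<Sigma> \<Sigma>s"
    and dec: "\<And>c t. c \<in> items H \<Longrightarrow> diag_decreasing (?S c t)"
    and fb: "\<And>c t. c \<in> items H \<Longrightarrow> form_bounds \<beta> b (dims H c t) (?S c t)"
    and lc: "\<And>k t v. k \<in> nodes H \<Longrightarrow> v \<in> carrier_vec (odim H k t) \<Longrightarrow>
       v \<noteq> 0\<^sub>v (odim H k t) \<Longrightarrow>
       qform (ibdiag ?S H k t) ((Amat H k t)\<^sup>T *\<^sub>v v) -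
       qform (obdiag ?S H k t) v + sqn ((Bmat H k t)\<^sup>T *\<^sub>v v) < - \<beta> * sqn v"
    and lo: "\<And>k t v. k \<in> nodes H \<Longrightarrow> v \<in> carrier_vec (idim H k t) \<Longrightarrow>
       v \<noteq> 0\<^sub>v (idim H k t) \<Longrightarrow>
       qform (obdiag ?S H k t) (Amat H k t *\<^sub>v v) -
       qform (ibdiag ?S H k t) v + sqn (Cmat H k t *\<^sub>v v) < - \<beta> * sqn v"
    by (rule balanced_gramiansE[OF H gram]) (rule that)
  \<comment> \<open>Since the form of a stacked gramian is at most \<open>b |f|^2\<close>, the
    margin \<open>\<beta> |f|^2\<close> is at least the fraction \<open>\<beta> / b\<close> of that
    form; this makes the additive margin multiplicative.\<close>
  define \<rho> where "\<rho> = 1 - \<beta> / b"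
  have \<rho>: "0 < \<rho>" "\<rho> < 1" using \<beta> b by (simp_all add: \<rho>_def)
  have S: "?S c t \<in> carrier_mat (dims H c t) (dims H c t)" if "c \<in> items H" for c t
    using fb[OF that] by (simp add: form_bounds_def)
  have S_pos: "0 < ?S c t $$ (i, i)" if "c \<in> items H" "i < dims H c t" for c t i
    using form_bounds_diag[OF fb[OF that(1)] that(2)] \<beta> by simp
  have fbl: "form_bounds \<beta> b (ldim H l t) (bdiag ?S l t)" if "set l \<subseteq> items H" "distinct l" for l t
    using fb that by (intro form_bounds_bdiag) blast+
  have bS: "bdiag ?S l t \<in> carrier_mat (ldim H l t) (ldim H l t)" "diagonal_mat (bdiag ?S l t)"
    "\<And>i. i < ldim H l t \<Longrightarrow> 0 < bdiag ?S l t $$ (i, i)"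
    if l: "set l \<subseteq> items H" "distinct l" for l t
  proof -
    have Sl: "\<forall>c\<in>set l. ?S c t \<in> carrier_mat (dims H c t) (dims H c t)" using S l(1) by blast
    show "bdiag ?S l t \<in> carrier_mat (ldim H l t) (ldim H l t)"
      by (rule diag_block_mat_carrier[OF Sl])
    show "diagonal_mat (bdiag ?S l t)"
      by (rule diagonal_diag_block_mat[OF Sl]) (use dec l(1) in \<open>auto simp: diag_decreasing_def\<close>)
    show "0 < bdiag ?S l t $$ (i, i)" if "i < ldim H l t" for i
      using form_bounds_diag[OF fbl[OF l] that] \<beta> by simp
  qed
  note inS = bS[OF in_items_subset[OF H] distinct_in_items[OF H]]
    and outS = bS[OF out_items_subset[OF H] distinct_out_items[OF H]]
  have obs: "(\<Sum>i<odim H k t. obdiag ?S H k t $$ (i, i) * ((Amat H k t *\<^sub>v v) $ i)\<^sup>2)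
        + sqn (Cmat H k t *\<^sub>v v)
      \<le> (\<Sum>i<idim H k t. ibdiag ?S H k t $$ (i, i) * (v $ i)\<^sup>2)"
    if k: "k \<in> nodes H" and v: "v \<in> carrier_vec (idim H k t)" for k t v
  proof -
    let ?n = "idim H k t"
    note A = Amat_carrier[OF H k, of t]
    have Av: "Amat H k t *\<^sub>v v \<in> carrier_vec (odim H k t)"
      using A v by (rule mult_mat_vec_carrier)
    have "qform (obdiag ?S H k t) (Amat H k t *\<^sub>v v) + sqn (Cmat H k t *\<^sub>v v)
      \<le> qform (ibdiag ?S H k t) v"
    proof (cases "v = 0\<^sub>v ?n")
      case True
      then show ?thesis
        using outS(1)[OF k, of "t + 1"] inS(1)[OF k, of t]
        by (simp add: mult_mat_vec_zero[OF A] mult_mat_vec_zero[OF Cmat_carrier[OF H k]])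
    next
      case False
      have "0 \<le> \<beta> * sqn v" using \<beta> by simp
      then show ?thesis using lo[OF k v False] by simp
    qed
    then show ?thesis
      unfolding qform_diagonal[OF outS(2,1)[OF k] Av] qform_diagonal[OF inS(2,1)[OF k] v] .
  qed
  have con: "(\<Sum>i<odim H k t.
         ((Amat H k t *\<^sub>v v + Bmat H k t *\<^sub>v u) $ i)\<^sup>2 / obdiag ?S H k t $$ (i, i))
      \<le> \<rho> * ((\<Sum>i<idim H k t. (v $ i)\<^sup>2 / ibdiag ?S H k t $$ (i, i)) + sqn u)"
    if k: "k \<in> nodes H" and v: "v \<in> carrier_vec (idim H k t)"
      and u: "u \<in> carrier_vec (udim H k t)" for k t v u
  proof (rule reachability_dual[OF Amat_carrier[OF H k] Bmat_carrier[OF H k] inS(1,2)[OF k] _ outS(1,2)[OF k] _ _ \<rho>(1) v u])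
    let ?m = "odim H k t" and ?So = "obdiag ?S H k t"
    fix f :: "real vec" assume f: "f \<in> carrier_vec ?m"
    have "qform ?So f \<le> b * sqn f"
      using fbl[OF out_items_subset[OF H k] distinct_out_items[OF H], of "t + 1"] f unfolding form_bounds_def by blast
    then have "\<beta> / b * qform ?So f \<le> \<beta> / b * (b * sqn f)" using \<beta> b by (intro mult_left_mono) auto
    then have "\<beta> / b * qform ?So f \<le> \<beta> * sqn f" using \<beta> b by simp
    moreover have "qform (ibdiag ?S H k t) ((Amat H k t)\<^sup>T *\<^sub>v f) + sqn ((Bmat H k t)\<^sup>T *\<^sub>v f) \<le>
      qform ?So f - \<beta> * sqn f"
    proof (cases "f = 0\<^sub>v ?m")
      case True
      have At: "(Amat H k t)\<^sup>T \<in> carrier_mat (idim H k t) ?m"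
        and Bt: "(Bmat H k t)\<^sup>T \<in> carrier_mat (udim H k t) ?m"
        by (simp_all only: transpose_carrier_mat Amat_carrier[OF H k] Bmat_carrier[OF H k])
      show ?thesis
        unfolding True mult_mat_vec_zero[OF At] mult_mat_vec_zero[OF Bt]
          qform_zero[OF inS(1)[OF k]] qform_zero[OF outS(1)[OF k]] by simp
    next
      case False
      show ?thesis using lc[OF k f False] by simp
    qed
    ultimately show "qform (ibdiag ?S H k t) ((Amat H k t)\<^sup>T *\<^sub>v f) + sqn ((Bmat H k t)\<^sup>T *\<^sub>v f) \<le> \<rho> * qform ?So f"
      by (simp add: \<rho>_def left_diff_distrib)
  qed (fact inS(3)[OF k] outS(3)[OF k])+
  have \<rho>1: "\<rho> \<le> 1" using \<rho>(2) by simp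
  have "l2_upto (nodes H) T (\<lambda>k t. y k t - y' k t) \<le> 2 * \<Sum>F * sqrt \<rho> * l2_upto (nodes H) T u"
    if F: "finite F" "\<forall>\<sigma>\<in>F. 0 < \<sigma>" and y: "(u, y) \<in> io H"
      and y': "(u, y') \<in> io (masked H (\<lambda>k t. R k t \<union> {i. obdiag ?S H k t $$ (i, i) \<notin> F}))"
    for F R u y y' T
    using F y'
  proof (induction F arbitrary: y' rule: finite_induct)
    case empty
    then have "(u, y') \<in> io H" by (simp add: masked_UNIV)
    then have "y k t = y' k t" if "k \<in> nodes H" for k t using io_unique[OF H y _ that] by blast
    then have "l2_upto (nodes H) T (\<lambda>k t. y k t - y' k t) = 0"
      by (simp add: l2_upto_def sqn_sum)
    then show ?case by simp
  next
    case (insert \<sigma> F)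
    let ?P = "\<lambda>F k t. R k t \<union> {i. obdiag ?S H k t $$ (i, i) \<notin> F}"
    have MP: "distributed_system (masked H (?P F))" by (rule masked_distributed_system[OF H])
    have "u k t \<in> carrier_vec (udim (masked H (?P F)) k t)" if "k \<in> nodes (masked H (?P F))" for k t
      using y that unfolding io_iff itrajectory_def masked_simps by blast
    \<comment> \<open>The induction needs an output of the intermediate system for the same input;
      totality of \<open>io\<close> provides it.\<close>
    from io_total[OF MP this] obtain z where z: "(u, z) \<in> io (masked H (?P F))" by blast
    have 1: "l2_upto (nodes H) T (\<lambda>k t. y k t - z k t) \<le> 2 * \<Sum>F * sqrt \<rho> * l2_upto (nodes H) T u"
      using insert.IH[OF _ z] insert.prems(1) by blast
    have 2: "l2_upto (nodes H) T (\<lambda>k t. z k t - y' k t) \<le> 2 * \<sigma> * sqrt \<rho> * l2_upto (nodes H) T u"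
    proof (rule mask_error_bound[where H = H and S = ?S and P = "?P F" and Q = "?P (insert \<sigma> F)"])
      show "0 \<le> \<sigma>" using insert.prems(1) by simp
      show "obdiag ?S H k t $$ (i, i) = \<sigma>"
        if "i \<in> ?P F k t" "i \<notin> ?P (insert \<sigma> F) k t" for k t i using that by blast
      show "?P (insert \<sigma> F) k t \<subseteq> ?P F k t" for k t by blast
    qed (fact H S S_pos outS(3) inS(3) obs con \<rho>(1) \<rho>1 z insert.prems(2))+
    have dim: "dim_vec (y k t) = ydim H k t" "dim_vec (z k t) = ydim H k t" "dim_vec (y' k t) = ydim H k t"
      if k: "k \<in> nodes H" for k t
    proof -
      have *: "dim_vec (Dmat H k t *\<^sub>v w) = ydim H k t" for w using Dmat_carrier[OF H k, of t] by simp
      show "dim_vec (y k t) = ydim H k t" "dim_vec (z k t) = ydim H k t" "dim_vec (y' k t) = ydim H k t"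
        using y z insert.prems(2) k * unfolding io_iff itrajectory_def masked_simps by auto
    qed
    have "l2_upto (nodes H) T (\<lambda>k t. y k t - y' k t) \<le>
      l2_upto (nodes H) T (\<lambda>k t. y k t - z k t) + l2_upto (nodes H) T (\<lambda>k t. z k t - y' k t)"
    proof (rule l2_upto_triangle)
      fix k t assume k: "k \<in> nodes H"
      show "dim_vec (y k t - z k t) = dim_vec (z k t - y' k t)" using dim[OF k] by simp
      show "y k t - y' k t = y k t - z k t + (z k t - y' k t)" using dim[OF k] by (intro eq_vecI) simp_all
    qed
    also have "\<dots> \<le> 2 * \<Sum>(insert \<sigma> F) * sqrt \<rho> * l2_upto (nodes H) T u"
      using 1 2 insert.hyps by (simp add: algebra_simps)
    finally show ?case .
  qed
  with \<rho> that show thesis by blast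
qed

section \<open>Truncation as masking\<close>

lemma not_kept_entry:
  assumes "\<forall>c\<in>set l. r c \<le> n c" "\<forall>c\<in>set l. M c \<in> carrier_mat (n c) (n c)"
    and "i < (\<Sum>c\<leftarrow>l. n c)" "i \<notin> kept (map (\<lambda>c. (n c, r c)) l)"
  shows "\<exists>c\<in>set l. \<exists>j. r c \<le> j \<and> j < n c \<and> diag_block_mat (map M l) $$ (i, i) = M c $$ (j, j)"
  using assms
proof (induction l arbitrary: i)
  case (Cons a l)
  let ?N = "\<Sum>c\<leftarrow>l. n c"
  have d: "dim_row (diag_block_mat (map M l)) = ?N" "dim_col (diag_block_mat (map M l)) = ?N"
    using diag_block_mat_carrier[of l M n] Cons.prems(2) by auto
  have a: "dim_row (M a) = n a" "dim_col (M a) = n a" using Cons.prems(2) by auto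
  show ?case
  proof (cases "i < n a")
    case True
    then have "r a \<le> i" using Cons.prems(4) by auto
    moreover have "diag_block_mat (map M (a # l)) $$ (i, i) = M a $$ (i, i)"
      using True by (simp add: Let_def d a)
    ultimately show ?thesis using True by auto
  next
    case False
    have "i - n a \<notin> kept (map (\<lambda>c. (n c, r c)) l)"
      using Cons.prems(4) False by (force intro: image_eqI[of _ _ "i - n a"])
    moreover have "i - n a < ?N" using Cons.prems(3) False by auto
    ultimately obtain c j where "c \<in> set l" "r c \<le> j" "j < n c"
      "diag_block_mat (map M l) $$ (i - n a, i - n a) = M c $$ (j, j)"
      using Cons.IH[of "i - n a"] Cons.prems(1,2) by auto
    moreover have "diag_block_mat (map M (a # l)) $$ (i, i) = diag_block_mat (map M l) $$ (i - n a, i - n a)"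
      using False Cons.prems(3) by (simp add: Let_def d a)
    ultimately show ?thesis by (metis list.set_intros(2))
  qed
qed simp

lemma emb_sel_add:
  assumes "dim_vec v = m" "dim_vec w = m" "i < m"
  shows "emb R m (sel R v + sel R w) $ i = (if i \<in> R then (v + w) $ i else 0)"
  using assms card_below_less[of i m R] by (auto simp: emb_def sel_def pick_card_in_set)

text \<open>The reduced states, padded with zeros, are a trajectory of the masked system: embedding
  after selecting is masking. \<open>P\<close> is compared with the kept set on valid indices only,
  because the mask of \<open>masked_error_bound\<close> is defined by matrix entries, which are
  unspecified outside the matrix.\<close>

lemma truncation_io_masked:
  assumes H: "distributed_system H" and le: "\<And>c t. c \<in> items H \<Longrightarrow> case_sum r rs c t \<le> dims H c t"
    and P: "\<And>k t i. k \<in> nodes H \<Longrightarrow> i < odim H k t \<Longrightarrow>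
      i \<in> P k t \<longleftrightarrow> i \<in> keep H (case_sum r rs) (out_items H k) (t + 1)"
    and io: "(u, y) \<in> io (truncation H r rs)"
  shows "(u, y) \<in> io (masked H P)"
proof -
  let ?r = "case_sum r rs" and ?K = "truncation H r rs"
  obtain Z where "itrajectory ?K u Z y" using io by (auto simp: io_iff)
  then have Z: "\<And>k t. k \<in> nodes H \<Longrightarrow> u k t \<in> carrier_vec (udim H k t)"
    "\<And>c t. c \<in> items H \<Longrightarrow> Z c t \<in> carrier_vec (?r c t)" "\<And>c. c \<in> items H \<Longrightarrow> Z c 0 = 0\<^sub>v (?r c 0)"
    "\<And>k t. k \<in> nodes H \<Longrightarrow> stack Z (out_items H k) (t + 1) = Amat ?K k t *\<^sub>v stack Z (in_items H k) t + Bmat ?K k t *\<^sub>v u k t"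
    "\<And>k t. k \<in> nodes H \<Longrightarrow> y k t = Cmat ?K k t *\<^sub>v stack Z (in_items H k) t + Dmat H k t *\<^sub>v u k t"
    unfolding itrajectory_def truncation_items truncation_simps(1-8) by blast+
  define X where "X = (\<lambda>c t. pad (dims H c t) (Z c t))"
  have X: "X c t \<in> carrier_vec (dims H c t)" if "c \<in> items H" for c t
    unfolding X_def using carrier_vecD[OF Z(2)[OF that, of t]] le[OF that, of t] by (intro pad_carrier) simp
  have st: "stack X l t = emb (keep H ?r l t) (ldim H l t) (stack Z l t)" if "set l \<subseteq> items H" for l t
  proof -
    have "\<forall>c\<in>set l. ?r c t \<le> dims H c t" "\<forall>c\<in>set l. Z c t \<in> carrier_vec (?r c t)"
      using that le Z(2) by blast+
    from emb_kept_vconcat[OF this] show ?thesis by (simp only: X_def)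
  qed
  have "itrajectory (masked H P) u X y"
    unfolding itrajectory_def masked_items masked_simps
  proof (intro conjI ballI allI)
    show "u k t \<in> carrier_vec (udim H k t)" if "k \<in> nodes H" for k t by (rule Z(1)[OF that])
    show "X c t \<in> carrier_vec (dims H c t)" if "c \<in> items H" for c t by (rule X[OF that])
    show "X c 0 = 0\<^sub>v (dims H c 0)" if "c \<in> items H" for c
      unfolding X_def Z(3)[OF that] using le[OF that, of 0] by (intro eq_vecI) (auto simp: pad_def)
    fix k t assume k: "k \<in> nodes H"
    let ?n = "idim H k t" and ?m = "odim H k t"
    let ?x = "stack X (in_items H k) t" and ?z = "stack Z (in_items H k) t"
    let ?R = "keep H ?r (out_items H k) (t + 1)" and ?C = "keep H ?r (in_items H k) t"
    note A = Amat_carrier[OF H k, of t] and B = Bmat_carrier[OF H k, of t] and C = Cmat_carrier[OF H k, of t]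
    have x: "?x \<in> carrier_vec ?n"
      by (rule vconcat_map_carrier) (use X in_items_subset[OF H k] in blast)
    have "?z \<in> carrier_vec (\<Sum>c\<leftarrow>in_items H k. ?r c t)"
      by (rule vconcat_map_carrier) (use Z(2) in_items_subset[OF H k] in blast)
    moreover have "card {j. j < ?n \<and> j \<in> ?C} = (\<Sum>c\<leftarrow>in_items H k. ?r c t)"
      by (rule card_kept) (use le in_items_subset[OF H k] in blast)
    ultimately have dz: "dim_vec ?z = card {j. j < ?n \<and> j \<in> ?C}" by simp
    have du: "dim_vec (u k t) = dim_col (Bmat H k t)" using Z(1)[OF k, of t] B by simp
    have e: "emb ?C ?n ?z = ?x" by (rule st[OF in_items_subset[OF H k], symmetric])
    have AK: "Amat ?K k t *\<^sub>v ?z = sel ?R (Amat H k t *\<^sub>v ?x)"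
      unfolding truncation_simps using submatrix_mult_vec[of ?z "Amat H k t" ?C ?R] A dz e by simp
    have BK: "Bmat ?K k t *\<^sub>v u k t = sel ?R (Bmat H k t *\<^sub>v u k t)"
      unfolding truncation_simps using submatrix_mult_vec[of "u k t" "Bmat H k t" UNIV ?R] du
      by (simp add: emb_UNIV)
    have CK: "Cmat ?K k t *\<^sub>v ?z = Cmat H k t *\<^sub>v ?x"
      unfolding truncation_simps using submatrix_mult_vec[of ?z "Cmat H k t" ?C UNIV] C dz e by simp
    show "y k t = Cmat H k t *\<^sub>v ?x + Dmat H k t *\<^sub>v u k t" unfolding Z(5)[OF k] CK ..
    have so: "stack X (out_items H k) (t + 1) = emb ?R ?m (sel ?R (Amat H k t *\<^sub>v ?x) + sel ?R (Bmat H k t *\<^sub>v u k t))"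
      unfolding st[OF out_items_subset[OF H k]] Z(4)[OF k] AK BK ..
    show "stack X (out_items H k) (t + 1) =
      rowmask (P k t) (Amat H k t) *\<^sub>v ?x + rowmask (P k t) (Bmat H k t) *\<^sub>v u k t" (is "_ = ?rhs")
    proof (rule eq_vecI)
      have rd: "dim_row (rowmask (P k t) (Amat H k t)) = ?m" "dim_row (rowmask (P k t) (Bmat H k t)) = ?m"
        using A B by (simp_all add: rowmask_def)
      show "dim_vec (stack X (out_items H k) (t + 1)) = dim_vec ?rhs" unfolding so using rd by simp
      fix i assume "i < dim_vec ?rhs"
      then have i: "i < ?m" using rd by simp
      have d: "dim_vec (Amat H k t *\<^sub>v ?x) = ?m" "dim_vec (Bmat H k t *\<^sub>v u k t) = ?m" using A B by simp_all
      have "?rhs $ i = (rowmask (P k t) (Amat H k t) *\<^sub>v ?x) $ i + (rowmask (P k t) (Bmat H k t) *\<^sub>v u k t) $ i"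
        using i rd by (intro index_add_vec) simp
      also have "\<dots> = (if i \<in> P k t then (Amat H k t *\<^sub>v ?x) $ i + (Bmat H k t *\<^sub>v u k t) $ i else 0)"
        unfolding rowmask_mult_vec[OF A x i] rowmask_mult_vec[OF B Z(1)[OF k] i] by simp
      also have "\<dots> = (if i \<in> P k t then (Amat H k t *\<^sub>v ?x + Bmat H k t *\<^sub>v u k t) $ i else 0)"
        using d i by (simp only: index_add_vec)
      finally show "stack X (out_items H k) (t + 1) $ i = ?rhs $ i"
        unfolding so emb_sel_add[OF d i] P[OF k i] by simp
    qed
  qed
  then show ?thesis by (auto simp: io_iff)
qed

text \<open>\<open>zeta\<close> sees only the set of diagonal entries, so neither the order nor the
  repetition of blocks matters, and the outgoing items of all nodes together cover all
  items.\<close>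

lemma set_diag_total_diag:
  assumes G: "distributed_system G"
    and sq: "\<And>c t. c \<in> items G \<Longrightarrow> square_mat (case_sum \<Omega> \<Omega>s c t)"
  shows "set (diag_mat (total_diag G T \<Omega> \<Omega>s)) = (\<Union>t\<in>{..<T}. \<Union>c\<in>items G. set (diag_mat (case_sum \<Omega> \<Omega>s c t)))"
proof -
  let ?Ms = "concat (map (\<lambda>t. concat (map (\<lambda>k. outs G \<Omega> \<Omega>s k t) [1..<Suc (nnodes G)])) [0..<T])"
  have items: "items G = (\<Union>k\<in>nodes G. set (out_items G k))"
    using edges_subset[OF G] by (auto simp: set_out_items[OF G] items_def)
  have Ms: "set ?Ms = (\<Union>t\<in>{..<T}. (\<lambda>c. case_sum \<Omega> \<Omega>s c t) ` items G)"
    unfolding items by (simp add: outs_eq atLeastLessThanSuc_atLeastAtMost atLeast0LessThan image_UN del: upt_Suc)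
  have "\<forall>M\<in>set ?Ms. square_mat M" unfolding Ms using sq by blast
  then have "diag_mat (total_diag G T \<Omega> \<Omega>s) = concat (map diag_mat ?Ms)"
    unfolding total_diag_def by (rule diag_mat_diag_block_mat)
  then have "set (diag_mat (total_diag G T \<Omega> \<Omega>s)) = (\<Union>M\<in>set ?Ms. set (diag_mat M))"
    by (simp only: set_concat set_map image_image UN_simps)
  then show ?thesis unfolding Ms by blast
qed

text \<open>By periodicity the finite set \<open>F\<close> of values of \<Omega> before
  \<open>h + q\<close> contains every value truncated at any time, so masking by \<open>F\<close>
  with the kept sets protected is the truncation. A nonempty total matrix is required because
  without truncated states the strict bound would read \<open>0 < 0\<close>.\<close>

lemma truncation_error_less:
  assumes q: "q > 0" and G: "distributed_system G" and st: "state_transformed G H" and H: "distributed_system H"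
    and gram: "balanced_gramians H \<Sigma> \<Sigma>s"
    and etp: "etp_family h q H \<Sigma> \<Sigma>s" "etp_family h q H r rs"
    and part: "\<forall>c\<in>items H. \<forall>t. gramian_partition (case_sum r rs c t) (case_sum \<Sigma> \<Sigma>s c t)
      (case_sum \<Gamma> \<Gamma>s c t) (case_sum \<Omega> \<Omega>s c t)"
    and pos: "0 < dim_row (total_diag H (h + q) \<Omega> \<Omega>s)"
  shows "io_norm (nodes H) (error_io G (truncation H r rs)) < ennreal (2 * zeta (total_diag H (h + q) \<Omega> \<Omega>s))"
proof -
  let ?S = "case_sum \<Sigma> \<Sigma>s" and ?r = "case_sum r rs" and ?\<Omega> = "case_sum \<Omega> \<Omega>s"
  define F where "F = set (diag_mat (total_diag H (h + q) \<Omega> \<Omega>s))"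
  have S: "?S c t \<in> carrier_mat (dims H c t) (dims H c t)" if "c \<in> items H" for c t
    by (rule gramian_carrier[OF H gram part that])
  have le: "?r c t \<le> dims H c t" if "c \<in> items H" for c t
    by (rule order_le[OF H gram part that])
  have diag: "diag_mat (?S c t) = diag_mat (case_sum \<Gamma> \<Gamma>s c t) @ diag_mat (?\<Omega> c t)"
    "length (diag_mat (case_sum \<Gamma> \<Gamma>s c t)) = ?r c t" if "c \<in> items H" for c t
    using gramian_partition_diag_mat[OF item_partition[OF H gram part that]]
      gramian_partitionD(2)[OF item_partition[OF H gram part that, of t]]
    by (simp_all add: diag_mat_def)
  have F: "F = (\<Union>t\<in>{..<h + q}. \<Union>c\<in>items H. set (diag_mat (?\<Omega> c t)))"
    unfolding F_def
  proof (rule set_diag_total_diag[OF H])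
    show "square_mat (?\<Omega> c t)" if "c \<in> items H" for c t
      using gramian_partitionD(3)[OF item_partition[OF H gram part that, of t]] by auto
  qed
  have Fin: "finite F" by (simp add: F_def)
  have Fpos: "\<forall>\<sigma>\<in>F. 0 < \<sigma>"
  proof
    fix \<sigma> assume "\<sigma> \<in> F"
    then obtain c t where c: "c \<in> items H" "\<sigma> \<in> set (diag_mat (?S c t))" unfolding F using diag(1) by auto
    obtain \<beta> where \<beta>: "\<beta> > 0" "gramian_family H \<beta> \<Sigma> \<Sigma>s" using gram unfolding balanced_gramians_def by blast
    obtain b where "form_bounds \<beta> b (dims H c t) (?S c t)"
      using gramian_family_form_bounds[OF \<beta>(2)] c(1) by metis
    from form_bounds_diag[OF this] \<beta>(1) c(2) S[OF c(1), of t] show "0 < \<sigma>"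
      by (auto simp: set_diag_mat intro: less_le_trans)
  qed
  \<comment> \<open>A positive sum is what turns \<open>sqrt \<rho> < 1\<close> into a strict
    inequality at the end.\<close>
  have "F \<noteq> {}" using pos by (simp add: F_def diag_mat_def)
  then have \<Sigma>F: "0 < \<Sum>F" using Fin Fpos by (intro sum_pos) auto
  have entry: "?S c t $$ (j, j) \<in> F" if c: "c \<in> items H" and j: "?r c t \<le> j" "j < dims H c t" for c t j
  proof -
    \<comment> \<open>The time in \<open>{0..<h + q}\<close> at which gramian and truncation order
      agree with those at \<open>t\<close>.\<close>
    define s where "s = (if t < h then t else h + (t - h) mod q)"
    have s: "s < h + q" using q by (simp add: s_def)
    have eq: "?S c t = ?S c s" "?r c t = ?r c s"
      using etp c etp_reduce[of h q "?S c" t] etp_reduce[of h q "?r c" t]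
      unfolding etp_family_iff by (simp_all add: s_def)
    have "dims H c t = dims H c s" using S[OF c, of t] S[OF c, of s] unfolding eq(1) by auto
    with j have js: "?r c s \<le> j" "j < dim_row (?S c s)" using S[OF c, of s] by (simp_all add: eq)
    have "?S c s $$ (j, j) = diag_mat (?S c s) ! j" by (rule diag_mat_nth[OF js(2)])
    also have "\<dots> = diag_mat (?\<Omega> c s) ! (j - ?r c s)"
      unfolding diag(1)[OF c] nth_append diag(2)[OF c] using js(1) by simp
    also have "\<dots> \<in> set (diag_mat (?\<Omega> c s))"
    proof (rule nth_mem)
      have "length (diag_mat (?S c s)) = ?r c s + length (diag_mat (?\<Omega> c s))"
        unfolding diag(1)[OF c] length_append diag(2)[OF c] ..
      moreover have "length (diag_mat (?S c s)) = dim_row (?S c s)" by (simp add: diag_mat_def)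
      ultimately show "j - ?r c s < length (diag_mat (?\<Omega> c s))" using js by simp
    qed
    finally show ?thesis unfolding F eq(1) using s c by blast
  qed
  \<comment> \<open>On valid indices the second set adds nothing, since the value of every truncated
    entry lies in \<open>F\<close>; it is there to match the mask of
    \<open>masked_error_bound\<close>.\<close>
  let ?P = "\<lambda>k t. keep H ?r (out_items H k) (t + 1) \<union> {i. obdiag ?S H k t $$ (i, i) \<notin> F}"
  have P: "i \<in> ?P k t \<longleftrightarrow> i \<in> keep H ?r (out_items H k) (t + 1)"
    if k: "k \<in> nodes H" and i: "i < odim H k t" for k t i
  proof -
    have "obdiag ?S H k t $$ (i, i) \<in> F" if "i \<notin> keep H ?r (out_items H k) (t + 1)"
    proof -
      have "\<forall>c\<in>set (out_items H k). ?r c (t + 1) \<le> dims H c (t + 1)"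
        "\<forall>c\<in>set (out_items H k). ?S c (t + 1) \<in> carrier_mat (dims H c (t + 1)) (dims H c (t + 1))"
        using le S out_items_subset[OF H k] by blast+
      from not_kept_entry[OF this i that] show ?thesis using entry out_items_subset[OF H k] by auto
    qed
    then show ?thesis by blast
  qed
  obtain \<rho> where \<rho>: "0 < \<rho>" "\<rho> < 1" and bound: "\<And>F R u y y' T. finite F \<Longrightarrow> \<forall>\<sigma>\<in>F. 0 < \<sigma> \<Longrightarrow> (u, y) \<in> io H \<Longrightarrow>
    (u, y') \<in> io (masked H (\<lambda>k t. R k t \<union> {i. obdiag ?S H k t $$ (i, i) \<notin> F})) \<Longrightarrow>
    l2_upto (nodes H) T (\<lambda>k t. y k t - y' k t) \<le> 2 * \<Sum>F * sqrt \<rho> * l2_upto (nodes H) T u"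
    by (rule masked_error_bound[OF H gram]) (rule that)
  have "io_norm (nodes H) (error_io G (truncation H r rs)) \<le> ennreal (2 * \<Sum>F * sqrt \<rho>)"
    unfolding io_norm_def
  proof (rule SUP_least, clarify)
    fix u e assume e: "(u, e) \<in> error_io G (truncation H r rs)" and u: "l2norm (nodes H) u \<noteq> 0" "l2norm (nodes H) u < \<infinity>"
    obtain y y' where y: "(u, y) \<in> io G" "(u, y') \<in> io (truncation H r rs)" and e_def: "e = (\<lambda>k t. y k t - y' k t)"
      using e unfolding error_io_def by blast
    show "l2norm (nodes H) e / l2norm (nodes H) u \<le> ennreal (2 * \<Sum>F * sqrt \<rho>)"
    proof (rule l2_ratio_le[OF _ _ u])
      show "l2_upto (nodes H) T e \<le> 2 * \<Sum>F * sqrt \<rho> * l2_upto (nodes H) T u" for T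
        unfolding e_def
      proof (rule bound[OF Fin Fpos state_transformed_io[OF G st y(1)]])
        show "(u, y') \<in> io (masked H ?P)" by (rule truncation_io_masked[OF H _ _ y(2)]) (fact le P)+
      qed
      show "0 \<le> 2 * \<Sum>F * sqrt \<rho>" using \<Sigma>F \<rho>(1) by simp
    qed
  qed
  also have "\<dots> < ennreal (2 * \<Sum>F)"
  proof (rule ennreal_lessI)
    have "sqrt \<rho> < 1" using \<rho> by simp
    then show "2 * \<Sum>F * sqrt \<rho> < 2 * \<Sum>F" using \<Sigma>F by simp
  qed (use \<Sigma>F in simp)
  finally show ?thesis by (simp only: zeta_def F_def)
qed

theorem corollary1:
  fixes h q :: nat and G :: dsys
  assumes "q > 0"
    and "distributed_system G"
    and "strongly_stable G"
    and "etp_realization h q G"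
  shows "(\<exists>H \<Sigma> \<Sigma>s. balanced_realization G H \<and> etp_realization h q H \<and>
            balanced_gramians H \<Sigma> \<Sigma>s \<and> etp_family h q G \<Sigma> \<Sigma>s) \<and>
    (\<forall>H \<Sigma> \<Sigma>s r rs \<Gamma> \<Gamma>s \<Omega> \<Omega>s.
       balanced_realization G H \<and> etp_realization h q H \<and>
       balanced_gramians H \<Sigma> \<Sigma>s \<and> etp_family h q G \<Sigma> \<Sigma>s \<and>
       etp_family h q G r rs \<and>
       (\<forall>k\<in>nodes G. \<forall>t. gramian_partition (r k t) (\<Sigma> k t) (\<Gamma> k t) (\<Omega> k t)) \<and>
       (\<forall>e\<in>edges G. \<forall>t. gramian_partition (rs e t) (\<Sigma>s e t) (\<Gamma>s e t) (\<Omega>s e t)) \<longrightarrow>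
       (\<exists>K. balanced_realization (truncation H r rs) K \<and> etp_realization h q K) \<and>
       (dim_row (total_diag G (h + q) \<Omega> \<Omega>s) > 0 \<longrightarrow>
          io_norm (nodes G) (error_io G (truncation H r rs))
            < ennreal (2 * zeta (total_diag G (h + q) \<Omega> \<Omega>s))))"
proof (intro conjI allI impI; (elim conjE)?)
  show "\<exists>H \<Sigma> \<Sigma>s. balanced_realization G H \<and> etp_realization h q H \<and>
      balanced_gramians H \<Sigma> \<Sigma>s \<and> etp_family h q G \<Sigma> \<Sigma>s"
    by (rule etp_balanced_realization_exists[OF assms])
next
  fix H \<Sigma> \<Sigma>s r rs \<Gamma> \<Gamma>s \<Omega> \<Omega>s
  assume bal: "balanced_realization G H" and eH: "etp_realization h q H" and gram: "balanced_gramians H \<Sigma> \<Sigma>s"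
    and e\<Sigma>: "etp_family h q G \<Sigma> \<Sigma>s" and er: "etp_family h q G r rs"
    and pn: "\<forall>k\<in>nodes G. \<forall>t. gramian_partition (r k t) (\<Sigma> k t) (\<Gamma> k t) (\<Omega> k t)"
    and pe: "\<forall>e\<in>edges G. \<forall>t. gramian_partition (rs e t) (\<Sigma>s e t) (\<Gamma>s e t) (\<Omega>s e t)"
  have H: "distributed_system H" and st: "state_transformed G H" using bal by (auto simp: balanced_realization_def)
  have GH: "nnodes H = nnodes G" "edges H = edges G" using st unfolding state_transformed_def by blast+
  have eH': "etp_family h q H \<Sigma> \<Sigma>s" "etp_family h q H r rs"
    using e\<Sigma> er unfolding etp_family_iff items_cong(3)[OF GH] by blast+
  have part: "\<forall>c\<in>items H. \<forall>t. gramian_partition (case_sum r rs c t) (case_sum \<Sigma> \<Sigma>s c t)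
      (case_sum \<Gamma> \<Gamma>s c t) (case_sum \<Omega> \<Omega>s c t)"
    unfolding items_ball sum.case GH using pn pe by blast
  have K: "distributed_system (truncation H r rs)"
    by (rule truncation_distributed_system[OF H gram part])
  show "\<exists>K. balanced_realization (truncation H r rs) K \<and> etp_realization h q K"
    using K state_transformed_refl[OF K] truncation_balanced_gramians[OF H gram part] truncation_etp[OF H eH eH'(2)]
    unfolding balanced_realization_def by blast
  have td: "total_diag G (h + q) \<Omega> \<Omega>s = total_diag H (h + q) \<Omega> \<Omega>s"
    by (simp add: total_diag_def outs_eq items_cong[OF GH] GH)
  assume "0 < dim_row (total_diag G (h + q) \<Omega> \<Omega>s)"
  then show "io_norm (nodes G) (error_io G (truncation H r rs)) < ennreal (2 * zeta (total_diag G (h + q) \<Omega> \<Omega>s))"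
    using truncation_error_less[OF assms(1,2) st H gram eH' part] unfolding td GH by blast
qed

end
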